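(* Let $m,n\in\mathbb{N}$, $A>0$, $0<p\le\infty$, $\alpha,\beta\in J_p$, and put $q:=\min\{1,p\}$. Let $0<t\le\varrho\,n^{-1}$, where $\varrho$ is a sufficiently small positive constant depending only on $\alpha,\beta,k$ and $q$ (with $k$ as below). Then, for any polynomial $P_n\in\mathbb{P}_n$ and any $k\in\mathbb{N}$ and $r\in\mathbb{N}_0$ such that $k+r=m$, $$t^{-k}\omega_{k,r}^{\varphi}(P_n^{(r)},t)_{\alpha,\beta,p}\ \sim\ t^{-k}\Psi_{k,r}^{\varphi}(P_n^{(r)},t)_{\alpha,\beta,p}\ \sim\ t^{-k}\Omega_{k,r}^{\varphi}(P_n^{(r)},A,t)_{\alpha,\beta,p}\ \sim\ \left\|w_{\alpha,\beta}\,\varphi^{m}P_n^{(m)}\right\|_p ,$$ where the equivalence constants depend only on $m,\alpha,\beta,A$ and $q$.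
   Context: $\mathbb{P}_n$ is the set of algebraic polynomials of degree $\le n-1$; $\|\cdot\|_p$ is the $L_p[-1,1]$ (quasi-)norm. $J_p:=(-1/p,\infty)$ if $0<p<\infty$ and $J_\infty:=[0,\infty)$. $w_{\alpha,\beta}(x):=(1-x)^\alpha(1+x)^\beta$ and $\varphi(x):=\sqrt{1-x^2}$. For an interval $S$, the $k$th symmetric difference is $\Delta_h^k(g,x;S):=\sum_{i=0}^k\binom{k}{i}(-1)^{k-i}g(x-\tfrac{kh}{2}+ih)$ if $[x-\tfrac{kh}{2},x+\tfrac{kh}{2}]\subseteq S$, and $\Delta_h^k(g,x;S):=0$ otherwise; $\Delta_h^k(g,x):=\Delta_h^k(g,x;[-1,1])$. Below the step at the point $x$ is $h\varphi(x)$. Put $\mathcal{W}_\delta^{\xi,\zeta}(x):=(1-x-\delta\varphi(x)/2)^\xi(1+x-\delta\varphi(x)/2)^\zeta$. The moduli are $$\omega_{k,r}^{\varphi}(f^{(r)},t)_{\alpha,\beta,p}:=\sup_{0\le h\le t}\left\|\mathcal{W}_{kh}^{r/2+\alpha,r/2+\beta}(\cdot)\,\Delta_{h\varphi(\cdot)}^k(f^{(r)},\cdot)\right\|_p$$ (the function inside the norm is understood as $0$ wherever $[x-kh\varphi(x)/2,x+kh\varphi(x)/2]\not\subseteq[-1,1]$), $$\Psi_{k,r}^{\varphi}(f^{(r)},t)_{\alpha,\beta,p}:=\sup_{0\le h\le t}\left\|w_{\alpha,\beta}(\cdot)\varphi^r(\cdot)\,\Delta_{h\varphi(\cdot)}^k(f^{(r)},\cdot)\right\|_p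 ,$$ $$\Omega_{k,r}^{\varphi}(f^{(r)},A,t)_{\alpha,\beta,p}:=\sup_{0\le h\le t}\left\|w_{\alpha,\beta}(\cdot)\varphi^r(\cdot)\,\Delta_{h\varphi(\cdot)}^k(f^{(r)},\cdot;\mathcal{I}_{A,h})\right\|_{L_p(\mathcal{I}_{A,h})},\quad \mathcal{I}_{A,h}:=[-1+Ah^2,1-Ah^2].$$ $X\sim Y$ means $c^{-1}Y\le X\le cY$ for some constant $c\ge1$ (the equivalence constant). The existence of the constant $\varrho=\varrho(\alpha,\beta,k,q)>0$ is part of the assertion.
   Formalization: In the upper bound of ω by Ψ, when r = 0 and min(α,β) < 0, the equivalence constant may depend on p itself and not only on q; with dependence on q alone the claim fails (α = −1/2, β = 0, k = 1, P(x) = x, p → 2 from below). *)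

theory Defs
  imports
    "HOL-Probability.Essential_Supremum"
    "HOL-Computational_Algebra.Polynomial"
begin

text \<open>
  The (quasi-)norm of \<open>L\<^sub>p(S)\<close> for \<open>0 < p \<le> \<infinity>\<close>, with values in the extended
  nonnegative reals. The library has no power with real exponent on \<^typ>\<open>ennreal\<close>, hence the
  detour through the reals for the \<open>p\<close>-th root.
\<close>

definition Lp_norm :: "ennreal \<Rightarrow> real set \<Rightarrow> (real \<Rightarrow> real) \<Rightarrow> ennreal" where
  "Lp_norm p S f =
    (if p = \<infinity> then esssup (lebesgue_on S) (\<lambda>x. ennreal \<bar>f x\<bar>)
     else let I = \<integral>\<^sup>+x. ennreal (\<bar>f x\<bar> powr enn2real p) \<partial>lebesgue_on S
          in if I = \<infinity> then \<infinity> else ennreal (enn2real I powr (1 / enn2real p)))"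

definition J_range :: "ennreal \<Rightarrow> real set" where
  "J_range p = (if p = \<infinity> then {0..} else {- (1 / enn2real p)<..})"

definition jacobi_weight :: "real \<Rightarrow> real \<Rightarrow> real \<Rightarrow> real" where
  "jacobi_weight \<alpha> \<beta> x = (1 - x) powr \<alpha> * (1 + x) powr \<beta>"

definition phi :: "real \<Rightarrow> real" where
  "phi x = sqrt (1 - x\<^sup>2)"

definition sym_diff :: "nat \<Rightarrow> real \<Rightarrow> (real \<Rightarrow> real) \<Rightarrow> real \<Rightarrow> real set \<Rightarrow> real" where
  "sym_diff k h g x S =
    (if {x - real k * h / 2 .. x + real k * h / 2} \<subseteq> S
     then \<Sum>i\<le>k. real (k choose i) * (- 1) ^ (k - i) * g (x - real k * h / 2 + real i * h)
     else 0)"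

text \<open>
  Both bases are nonnegative wherever \<open>[x - \<delta>\<phi>(x)/2, x + \<delta>\<phi>(x)/2] \<subseteq> [-1,1]\<close>; elsewhere
  the weight is only used multiplied by a vanishing \<^const>\<open>sym_diff\<close>.
\<close>

definition shifted_weight :: "real \<Rightarrow> real \<Rightarrow> real \<Rightarrow> real \<Rightarrow> real" where
  "shifted_weight \<delta> \<xi> \<zeta> x =
    (1 - x - \<delta> * phi x / 2) powr \<xi> * (1 + x - \<delta> * phi x / 2) powr \<zeta>"

text \<open>In the three moduli the argument \<open>g\<close> stands for the derivative \<open>f\<^sup>(\<^sup>r\<^sup>)\<close>.\<close>

definition omega_mod ::
    "nat \<Rightarrow> nat \<Rightarrow> (real \<Rightarrow> real) \<Rightarrow> real \<Rightarrow> real \<Rightarrow> real \<Rightarrow> ennreal \<Rightarrow> ennreal" where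
  "omega_mod k r g t \<alpha> \<beta> p =
    (SUP h\<in>{0..t}. Lp_norm p {-1..1}
      (\<lambda>x. shifted_weight (real k * h) (real r / 2 + \<alpha>) (real r / 2 + \<beta>) x
            * sym_diff k (h * phi x) g x {-1..1}))"

definition Psi_mod ::
    "nat \<Rightarrow> nat \<Rightarrow> (real \<Rightarrow> real) \<Rightarrow> real \<Rightarrow> real \<Rightarrow> real \<Rightarrow> ennreal \<Rightarrow> ennreal" where
  "Psi_mod k r g t \<alpha> \<beta> p =
    (SUP h\<in>{0..t}. Lp_norm p {-1..1}
      (\<lambda>x. jacobi_weight \<alpha> \<beta> x * phi x ^ r * sym_diff k (h * phi x) g x {-1..1}))"

definition main_interval :: "real \<Rightarrow> real \<Rightarrow> real set" where
  "main_interval A h = {-1 + A * h\<^sup>2 .. 1 - A * h\<^sup>2}"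

definition Omega_mod ::
    "nat \<Rightarrow> nat \<Rightarrow> (real \<Rightarrow> real) \<Rightarrow> real \<Rightarrow> real \<Rightarrow> real \<Rightarrow> real \<Rightarrow> ennreal \<Rightarrow> ennreal" where
  "Omega_mod k r g A t \<alpha> \<beta> p =
    (SUP h\<in>{0..t}. Lp_norm p (main_interval A h)
      (\<lambda>x. jacobi_weight \<alpha> \<beta> x * phi x ^ r
            * sym_diff k (h * phi x) g x (main_interval A h)))"

text \<open>
  Equivalence with constant \<open>c \<ge> 1\<close>. Constants that depend on \<open>p\<close> only through
  \<open>q = min 1 p\<close> have to be chosen before \<open>p\<close>. This is impossible for the upper bound of
  \<^const>\<open>omega_mod\<close> by \<^const>\<open>Psi_mod\<close> when \<open>r = 0\<close> and \<open>\<alpha>\<close> (or \<open>\<beta>\<close>) is negative: the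
  singularity of \<open>(1 - x - kh\<phi>(x)/2) powr \<alpha>\<close> lies inside \<open>[-1,1]\<close>, where \<open>\<phi>\<close> does not
  vanish, so its \<open>L\<^sub>p\<close>-norm is unbounded as \<open>p\<close> increases to \<open>-1/\<alpha>\<close>, while the other
  quantities stay bounded. In that case alone the constant may depend on \<open>p\<close> itself.
\<close>

definition equiv_within :: "real \<Rightarrow> ennreal \<Rightarrow> ennreal \<Rightarrow> bool" where
  "equiv_within c X Y \<longleftrightarrow> ennreal (1 / c) * Y \<le> X \<and> X \<le> ennreal c * Y"

end

theory Submission
  imports Defs
begin

text \<open>
  Write \<open>x = - cos \<theta>\<close> with \<open>\<theta> \<in> [0, \<pi>]\<close>, and \<open>Q = P\<^sup>(\<^sup>m\<^sup>)\<close>. The polynomial enters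
  only through \<open>Q\<close>: by the mean value theorem for differences, the \<open>k\<close>-th difference of
  \<open>P\<^sup>(\<^sup>r\<^sup>)\<close> at \<open>x\<close> with step \<open>h \<phi>(x)\<close> is \<open>(h \<phi>(x))\<^sup>k Q(\<xi>)\<close> for some \<open>\<xi>\<close> within
  \<open>k h \<phi>(x) / 2\<close> of \<open>x\<close>, and then the angle of \<open>\<xi>\<close> is within \<open>\<pi> k h / 2\<close> of \<open>\<theta>\<close>. So, for
  \<open>h\<close> below \<open>1 / n\<close>, the three moduli are weighted norms of \<open>h\<^sup>k Q\<close> sampled at points that
  are displaced by at most the natural resolution \<open>1 / n\<close> of a polynomial of degree below
  \<open>n\<close>. The theorem holds because such a displacement does not change the size of the norm.

  This is made precise by the local average
  \<open>G(\<theta>) = (n \<integral> |T(\<tau>)|\<^sup>q (1 + n |\<theta> - \<tau>|) powr (- M q) d\<tau>) powr (1/q)\<close> of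
  \<open>T(\<theta>) = Q(- cos \<theta>)\<close>, where \<open>q = min 1 p\<close> and \<open>M\<close> is large. It dominates both \<open>T\<close> and
  \<open>T' / n\<close> pointwise (\<open>local_average_bound\<close>), changes only by a bounded factor over a distance
  \<open>1 / n\<close>, and yet its weighted \<open>L\<^sub>p\<close>-norm is bounded by that of \<open>T\<close> itself
  (\<open>weighted_local_average_norm_le\<close>). In the variable \<open>\<theta>\<close> the weight \<open>w \<phi>\<^sup>m\<close> together with
  \<open>dx = sin \<theta> d\<theta>\<close> becomes a product of powers of \<open>sin (\<theta>/2)\<close> and \<open>cos (\<theta>/2)\<close>; adding
  \<open>1 / n\<close> to both bases gives a weight \<open>V\<close> that is also constant, up to a factor, at the scale
  \<open>1 / n\<close>. Every quantity of the theorem is compared with the norm \<open>R\<close> of \<open>V G\<close>.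

  \<^item> Upper bounds (\<open>Lp_norm_le_averaged_norm\<close>). A displaced sample of \<open>Q\<close> is at most a constant
    times \<open>G(\<theta>)\<close>. The actual weights are at most a constant times \<open>V\<close>, except for integrable
    singularities within \<open>1 / n\<close> of the ends, where \<open>V G\<close> is nearly constant.
  \<^item> Lower bounds (\<open>averaged_norm_le_Lp_norm\<close>). Moving all angles inwards by at most
    \<open>c / n\<close>, and then to the angle of the sample \<open>\<xi>\<close>, changes \<open>T\<close> by at most a multiple of
    \<open>c G\<close>; for small \<open>c\<close> this error is absorbed by \<open>R\<close>. So \<open>R\<close> is bounded by the samples
    that belong to angles in \<open>[c/n, \<pi> - c/n]\<close>, where all weights are comparable and where the
    interval of the difference stays inside \<open>[-1 + A h\<^sup>2, 1 - A h\<^sup>2]\<close> as soon as \<open>h\<close> is a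
    small multiple of \<open>1 / n\<close>. One such step \<open>h\<close> is enough, since the moduli are suprema.

  With one exception the constants depend on \<open>p\<close> through \<open>q\<close> alone, because for \<open>p \<ge> 1\<close> the
  exponents \<open>2 \<alpha> + m + 1/p\<close> and \<open>2 \<beta> + m + 1/p\<close> of \<open>V\<close> are nonnegative. The exception is due to
  the shifted weight of \<open>\<omega>\<close>, whose singularity lies inside \<open>[-1, 1]\<close> and contributes
  \<open>1 / (e p + 1)\<close> with \<open>e\<close> one of \<open>r/2 + \<alpha>\<close> and \<open>r/2 + \<beta>\<close>; this is bounded unless \<open>r = 0\<close> and
  \<open>e < 0\<close>. The case \<open>p = \<infinity>\<close> is the limit of the finite exponents.
\<close>

section \<open>Polynomials on the unit circle\<close>

lemma integral_cis_int:
  fixes j :: int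
  shows "((\<lambda>t. cis (of_int j * t)) has_integral (if j = 0 then 2 * pi else 0)) {-pi..pi}"
proof (cases "j = 0")
  case True
  then show ?thesis
    using has_integral_const_real[of "1::complex" "-pi" pi] by (simp add: scaleR_conv_of_real)
next
  case False
  have "((\<lambda>t. cis (of_int j * t)) has_integral
      (cis (of_int j * pi) / (\<i> * of_int j) - cis (of_int j * (-pi)) / (\<i> * of_int j))) {-pi..pi}"
  proof (rule fundamental_theorem_of_calculus)
    show "-pi \<le> pi" by simp
    fix x assume "x \<in> {-pi..pi}"
    show "((\<lambda>t. cis (of_int j * t) / (\<i> * of_int j)) has_vector_derivative cis (of_int j * x)) (at x within
        {-pi..pi})"
      unfolding has_vector_derivative_def using False
      by (auto intro!: derivative_eq_intros simp: scaleR_conv_of_real fun_eq_iff algebra_simps)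
  qed
  moreover have "cis (of_int j * pi) = cis (of_int j * (-pi))"
    by (auto simp: complex_eq_iff)
       (metis sin_integer_2pi mult.commute sin_times_pi_eq_0 Ints_of_int)
  ultimately show ?thesis using False by simp
qed

lemma coeff_eq_circle_integral:
  fixes p :: "complex poly"
  assumes "degree p \<le> d" "j \<le> d"
  shows "((\<lambda>t. poly p (cis t) * cis (- of_nat j * t)) has_integral 2 * pi * coeff p j) {-pi..pi}"
proof -
  have e: "poly p (cis t) * cis (- of_nat j * t) = (\<Sum>i\<le>d. coeff p i * cis (of_int (int i - int j) * t))" for t
  proof -
    have "poly p (cis t) = (\<Sum>i\<le>d. coeff p i * cis t ^ i)"
      unfolding poly_altdef using assms(1)
      by (intro sum.mono_neutral_left) (auto simp: coeff_eq_0)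
    then show ?thesis
      by (simp add: sum_distrib_right Complex.DeMoivre cis_mult mult.assoc left_diff_distrib)
  qed
  have "((\<lambda>t. \<Sum>i\<le>d. coeff p i * cis (of_int (int i - int j) * t)) has_integral
     (\<Sum>i\<le>d. coeff p i * (if int i - int j = 0 then 2 * pi else 0))) {-pi..pi}"
    by (intro has_integral_sum has_integral_mult_right integral_cis_int finite_atMost)
  also have "(\<Sum>i\<le>d. coeff p i * (if int i - int j = 0 then 2 * pi else 0)) = 2 * pi * coeff p j"
    using assms(2) by (simp add: if_distrib sum.delta cong: if_cong)
  finally show ?thesis unfolding e .
qed

lemma norm_coeff_le_circle_integral:
  fixes p :: "complex poly"
  assumes "degree p \<le> d" "j \<le> d"
  shows "cmod (coeff p j) \<le> integral {-pi..pi} (\<lambda>t. cmod (poly p (cis t)))"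
proof -
  let ?I = "integral {-pi..pi} (\<lambda>t. cmod (poly p (cis t)))"
  have c: "continuous_on {-pi..pi} (\<lambda>t. cmod (poly p (cis t)))"
    by (intro continuous_intros)
  have "cmod (2 * pi * coeff p j) \<le> ?I"
    using coeff_eq_circle_integral[OF assms]
    by (metis (mono_tags, lifting) c has_integral_integrable_integral integrable_continuous_real
       integral_norm_bound_integral norm_cis norm_mult mult.right_neutral order_refl)
  moreover have "cmod (coeff p j) \<le> cmod (2 * pi * coeff p j)"
    using pi_ge_two mult_right_mono[of 1 "2*pi" "cmod (coeff p j)"] by (simp add: norm_mult)
  ultimately show ?thesis by linarith
qed

lemmas hk_integral_nonneg = Henstock_Kurzweil_Integration.integral_nonneg

text \<open>
  A polynomial of degree \<open>d\<close> has \<open>d + 1\<close> coefficients, each of them bounded by the mean of the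
  modulus over the circle, and differentiation multiplies them by at most \<open>d\<close>. The factor
  \<open>d + 1\<close> is harmless: below, the integrand is concentrated on an arc of length \<open>1 / d\<close>.
\<close>
lemma poly_circle_L1_bound:
  fixes p :: "complex poly"
  assumes "degree p \<le> d"
  shows "cmod (poly p (cis \<theta>)) \<le> (real d + 1) * integral {-pi..pi} (\<lambda>t. cmod (poly p (cis t)))"
    and "cmod (poly (pderiv p) (cis \<theta>)) \<le> d * ((real d + 1) * integral {-pi..pi} (\<lambda>t. cmod (poly p (cis t))))"
proof -
  let ?I = "integral {-pi..pi} (\<lambda>t. cmod (poly p (cis t)))"
  note c = norm_coeff_le_circle_integral[OF assms]
  have I0: "?I \<ge> 0" by (intro integral_nonneg integrable_continuous_real continuous_intros) auto
  have "poly p (cis \<theta>) = (\<Sum>i\<le>d. coeff p i * cis \<theta> ^ i)"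
    unfolding poly_altdef using assms
    by (intro sum.mono_neutral_left) (auto simp: coeff_eq_0)
  also have "cmod \<dots> \<le> (\<Sum>i\<le>d. ?I)"
    by (intro sum_norm_le) (auto simp: norm_mult norm_power intro: c)
  finally show "cmod (poly p (cis \<theta>)) \<le> (real d + 1) * ?I" by (simp add: add.commute)
  have "poly (pderiv p) (cis \<theta>) = (\<Sum>i\<le>d. coeff (pderiv p) i * cis \<theta> ^ i)"
    unfolding poly_altdef using assms
    by (intro sum.mono_neutral_left) (auto simp: coeff_eq_0 degree_pderiv)
  also have "cmod \<dots> \<le> (\<Sum>i\<le>d. d * ?I)"
  proof (intro sum_norm_le)
    fix i assume "i \<in> {..d}"
    show "cmod (coeff (pderiv p) i * cis \<theta> ^ i) \<le> d * ?I"
    proof (cases "i < d")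
      case True
      then have "cmod (coeff p (Suc i)) \<le> ?I" "real (Suc i) \<le> d" by (auto intro: c)
      then have "real (Suc i) * cmod (coeff p (Suc i)) \<le> d * ?I" by (intro mult_mono) auto
      then show ?thesis by (simp add: norm_mult norm_power coeff_pderiv del: of_nat_Suc)
    next
      case False
      then have "coeff p (Suc i) = 0" using assms by (intro coeff_eq_0) auto
      then show ?thesis using I0 by (simp add: coeff_pderiv)
    qed
  qed
  finally show "cmod (poly (pderiv p) (cis \<theta>)) \<le> d * ((real d + 1) * ?I)" by (simp add: algebra_simps)
qed

text \<open>
  With \<open>S\<close> the maximum of the modulus, \<open>|p| \<le> S powr (1 - q) * |p| powr q\<close>. Inserted into the
  bound by the \<open>L\<^sub>1\<close>-norm at a point where the maximum is attained, this gives
  \<open>S powr q \<le> (d + 1) \<integral> |p| powr q\<close>, and a second insertion gives both claims.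
\<close>
lemma poly_circle_Lq_bound:
  fixes p :: "complex poly" and q :: real
  assumes "degree p \<le> d" and q: "0 < q" "q \<le> 1"
  defines "Y \<equiv> ((real d + 1) * integral {-pi..pi} (\<lambda>t. cmod (poly p (cis t)) powr q)) powr (1 / q)"
  shows "cmod (poly p (cis \<theta>)) \<le> Y"
    and "cmod (poly (pderiv p) (cis \<theta>)) \<le> d * Y"
proof -
  define f where "f t = cmod (poly p (cis t))" for t
  define J where "J = integral {-pi..pi} (\<lambda>t. f t powr q)"
  have cf: "continuous_on A f" for A unfolding f_def by (intro continuous_intros)
  have cfq: "continuous_on A (\<lambda>t. f t powr q)" for A
    using q by (intro continuous_on_powr' continuous_on_const) (auto simp: f_def intro!: continuous_intros)
  have J0: "J \<ge> 0" unfolding J_def by (intro integral_nonneg integrable_continuous_real cfq) auto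
  obtain s where s: "s \<in> {-pi..pi}" "\<And>t. t \<in> {-pi..pi} \<Longrightarrow> f t \<le> f s"
    using continuous_attains_sup[OF compact_Icc _ cf[of "{-pi..pi}"]] by force
  define S where "S = f s"
  have S0: "S \<ge> 0" by (simp add: S_def f_def)
  have main: "(real d + 1) * integral {-pi..pi} f \<le> ((real d + 1) * J) powr (1 / q)"
  proof (cases "S = 0")
    case True
    then have "integral {-pi..pi} f \<le> integral {-pi..pi} (\<lambda>_. 0)"
      using s S_def by (intro integral_le integrable_continuous_real cf) auto
    then have "integral {-pi..pi} f \<le> 0" by simp
    then have "(real d + 1) * integral {-pi..pi} f \<le> 0" by (simp add: mult_nonneg_nonpos)
    then show ?thesis using powr_ge_zero order_trans by blast
  next
    case False
    then have Sp: "S > 0" using S0 by simp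
    have "integral {-pi..pi} f \<le> integral {-pi..pi} (\<lambda>t. S powr (1 - q) * f t powr q)"
    proof (intro integral_le integrable_continuous_real cf continuous_on_mult continuous_on_const cfq)
      fix t assume t: "t \<in> {-pi..pi}"
      have f0: "0 \<le> f t" by (simp add: f_def)
      have "f t = f t powr (1 - q) * f t powr q"
        using f0 by (cases "f t = 0") (auto simp: powr_add[symmetric])
      also have "\<dots> \<le> S powr (1 - q) * f t powr q"
        using s(2)[OF t] f0 q unfolding S_def by (intro mult_right_mono powr_mono2) auto
      finally show "f t \<le> S powr (1 - q) * f t powr q" .
    qed
    also have "\<dots> = S powr (1 - q) * J" unfolding J_def by simp
    finally have 1: "(real d + 1) * integral {-pi..pi} f \<le> S powr (1 - q) * ((real d + 1) * J)"
      by (smt (verit) mult.left_commute mult_left_mono of_nat_0_le_iff)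
    have "S \<le> (real d + 1) * integral {-pi..pi} f"
      using poly_circle_L1_bound(1)[OF assms(1), of s] unfolding S_def f_def by simp
    then have "S \<le> S powr (1 - q) * ((real d + 1) * J)" using 1 by linarith
    moreover have "S powr q * S powr (1 - q) = S" using Sp by (simp add: powr_add[symmetric])
    ultimately have "S powr q * S powr (1 - q) \<le> S powr (1 - q) * ((real d + 1) * J)" by simp
    then have 2: "S powr q \<le> (real d + 1) * J" using Sp by (simp add: mult.commute)
    then have "(S powr q) powr ((1 - q) / q) \<le> ((real d + 1) * J) powr ((1 - q) / q)"
      using q by (intro powr_mono2) auto
    then have 3: "S powr (1 - q) \<le> ((real d + 1) * J) powr ((1 - q) / q)"
      using q by (simp add: powr_powr)
    have pos: "(real d + 1) * J > 0" using 2 Sp by (metis less_le_trans powr_gt_zero less_numeral_extra(3))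
    have "S powr (1 - q) * ((real d + 1) * J) \<le> ((real d + 1) * J) powr ((1 - q) / q) * ((real d + 1) * J) powr 1"
      using 3 pos J0 by (simp add: mult_right_mono)
    also have "\<dots> = ((real d + 1) * J) powr (1 / q)"
      using q by (subst powr_add[symmetric]) (simp add: field_simps)
    finally show ?thesis using 1 by linarith
  qed
  have Y: "Y = ((real d + 1) * J) powr (1 / q)" unfolding Y_def J_def f_def ..
  show "cmod (poly p (cis \<theta>)) \<le> Y"
    using poly_circle_L1_bound(1)[OF assms(1), of \<theta>] main unfolding Y f_def by linarith
  have "cmod (poly (pderiv p) (cis \<theta>)) \<le> d * ((real d + 1) * integral {-pi..pi} f)"
    using poly_circle_L1_bound(2)[OF assms(1), of \<theta>] unfolding f_def by simp
  also have "\<dots> \<le> d * Y" using main unfolding Y by (intro mult_left_mono) auto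
  finally show "cmod (poly (pderiv p) (cis \<theta>)) \<le> d * Y" .
qed

section \<open>Local averages of cosine polynomials\<close>

text \<open>
  An \<open>L\<^sub>q\<close>-mean of \<open>f\<close> around \<open>\<theta>\<close> at resolution \<open>1 / n\<close>. The decay order \<open>M\<close> of the kernel has to
  outweigh the growth of the endpoint weights below.
\<close>
definition local_average :: "real \<Rightarrow> nat \<Rightarrow> nat \<Rightarrow> (real \<Rightarrow> real) \<Rightarrow> real \<Rightarrow> real" where
  "local_average q M n f \<theta> =
    (n * integral {0..pi} (\<lambda>\<tau>. \<bar>f \<tau>\<bar> powr q * (1 + n * \<bar>\<theta> - \<tau>\<bar>) powr (- (M * q)))) powr (1 / q)"

lemma sin_half_ge:
  assumes "0 \<le> s" "s \<le> pi"
  shows "s / pi \<le> sin (s / 2)"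
proof -
  have "convex_on {0..pi} (\<lambda>x. - sin x)"
    by (rule f''_ge0_imp_convex[where f' = "\<lambda>x. - cos x" and f'' = sin])
       (auto intro!: derivative_eq_intros sin_ge_zero)
  from convex_onD[OF this, of "s / pi" 0 "pi / 2"] assms
  show ?thesis by simp
qed

text \<open>
  The \<open>M\<close>-th power of the normalized geometric sum in \<open>z cis (- \<theta>)\<close>. It equals \<open>1\<close> at \<open>cis \<theta>\<close> and is
  small away from that point; multiplication by it localizes a polynomial while raising the
  degree by at most \<open>n M\<close>.
\<close>
definition peak :: "nat \<Rightarrow> nat \<Rightarrow> real \<Rightarrow> complex poly" where
  "peak M n \<theta> = (\<Sum>j<n. monom (cis (- (j * \<theta>)) / n) j) ^ M"

lemma degree_peak: "degree (peak M n \<theta>) \<le> n * M"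
proof -
  have "degree (\<Sum>j<n. monom (cis (- (j * \<theta>)) / of_nat n) j) \<le> n"
    by (intro degree_sum_le) (auto intro: order_trans[OF degree_monom_le])
  then show ?thesis unfolding peak_def
    by (rule order_trans[OF degree_power_le mult_le_mono1])
qed

lemma peak_eq_geometric:
  "poly (peak M n \<theta>) (cis \<tau>) = ((\<Sum>j<n. cis (\<tau> - \<theta>) ^ j) / n) ^ M"
  by (simp add: peak_def poly_power poly_sum poly_monom Complex.DeMoivre cis_mult sum_divide_distrib
      right_diff_distrib)

lemma pderiv_sum_poly: "pderiv (\<Sum>i\<in>A. f i) = (\<Sum>i\<in>A. pderiv (f i))"
  by (induction A rule: infinite_finite_induct) (auto simp: pderiv_add)

lemma peak_center:
  assumes "n \<ge> 1"
  shows "poly (peak M n \<theta>) (cis \<theta>) = 1"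
    and "cmod (poly (pderiv (peak M n \<theta>)) (cis \<theta>)) \<le> M * n"
proof -
  show "poly (peak M n \<theta>) (cis \<theta>) = 1"
    using assms by (simp add: peak_eq_geometric)
  let ?s = "\<Sum>j<n. monom (cis (- (j * \<theta>)) / of_nat n) j"
  have s1: "poly ?s (cis \<theta>) = 1"
    using assms by (simp add: poly_sum poly_monom Complex.DeMoivre cis_mult)
  have "cmod (poly (pderiv ?s) (cis \<theta>)) \<le> (\<Sum>j<n. 1)"
    unfolding pderiv_sum_poly poly_sum
  proof (intro sum_norm_le)
    fix j assume "j \<in> {..<n}"
    then show "cmod (poly (pderiv (monom (cis (- (j * \<theta>)) / of_nat n) j)) (cis \<theta>)) \<le> 1"
      by (simp add: pderiv_monom poly_monom norm_mult norm_divide norm_power)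
  qed
  then have "cmod (poly (pderiv ?s) (cis \<theta>)) \<le> n" by simp
  then have "M * cmod (poly (pderiv ?s) (cis \<theta>)) \<le> real M * real n" by (intro mult_left_mono) auto
  then show "cmod (poly (pderiv (peak M n \<theta>)) (cis \<theta>)) \<le> M * n"
    unfolding peak_def pderiv_power by (simp add: s1 norm_mult poly_power)
qed

text \<open>
  The geometric sum is at most \<open>n\<close> in modulus, and at most \<open>2 / |cis (\<tau> - \<theta>) - 1|\<close>. Since
  \<open>sin \<theta> \<ge> 0\<close>, a negative \<open>\<tau>\<close> is not closer to \<open>\<theta>\<close> on the circle than \<open>\<bar>\<tau>\<bar>\<close>; so the bound may be
  expressed by \<open>\<bar>\<tau>\<bar>\<close>, which later folds integrals over the circle onto \<open>[0, \<pi>]\<close>.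
\<close>
lemma cmod_peak_le:
  assumes n: "n \<ge> 1" and \<theta>: "0 \<le> \<theta>" "\<theta> \<le> pi" and \<tau>: "-pi \<le> \<tau>" "\<tau> \<le> pi"
  shows "cmod (poly (peak M n \<theta>) (cis \<tau>)) \<le> ((1 + pi) / (1 + n * \<bar>\<theta> - \<bar>\<tau>\<bar>\<bar>)) ^ M"
proof -
  define \<sigma> where "\<sigma> = \<bar>\<theta> - \<bar>\<tau>\<bar>\<bar>"
  have \<sigma>: "0 \<le> \<sigma>" "\<sigma> \<le> pi" using \<theta> \<tau> by (auto simp: \<sigma>_def)
  define D where "D = (\<Sum>j<n. cis (\<tau> - \<theta>) ^ j)"
  have D1: "cmod D \<le> n"
    unfolding D_def by (rule order_trans[OF norm_sum]) (simp add: norm_power)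
  have "D * (cis (\<tau> - \<theta>) - 1) = cis (\<tau> - \<theta>) ^ n - 1"
    unfolding D_def by (metis mult.commute power_diff_1_eq)
  then have D2: "cmod D * cmod (cis (\<tau> - \<theta>) - 1) \<le> 2"
    using norm_triangle_ineq4[of "cis (\<tau> - \<theta>) ^ n" 1] by (simp add: norm_mult[symmetric] norm_power)
  have "cos (\<tau> - \<theta>) \<le> cos \<sigma>"
  proof -
    have "cos \<sigma> = cos (\<bar>\<tau>\<bar> - \<theta>)" unfolding \<sigma>_def by (metis cos_abs_real abs_minus_commute)
    also have "\<dots> = cos \<tau> * cos \<theta> + sin \<bar>\<tau>\<bar> * sin \<theta>" by (simp add: cos_diff abs_if)
    finally have "cos \<sigma> - cos (\<tau> - \<theta>) = (sin \<bar>\<tau>\<bar> - sin \<tau>) * sin \<theta>"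
      by (simp add: cos_diff algebra_simps)
    moreover have "sin \<bar>\<tau>\<bar> \<ge> sin \<tau>"
      using sin_ge_zero[of "-\<tau>"] \<tau> by (auto simp: abs_if)
    ultimately show ?thesis using sin_ge_zero[OF \<theta>] by (metis diff_ge_0_iff_ge mult_nonneg_nonneg)
  qed
  moreover have "cmod (cis (\<tau> - \<theta>) - 1) ^ 2 = 2 - 2 * cos (\<tau> - \<theta>)"
  proof -
    have "cmod (cis (\<tau> - \<theta>) - 1) ^ 2 = (cos (\<tau> - \<theta>) - 1) ^ 2 + sin (\<tau> - \<theta>) ^ 2"
      by (simp add: cmod_power2)
    then show ?thesis using sin_cos_squared_add[of "\<tau> - \<theta>"] by (simp add: power2_diff)
  qed
  moreover have "2 - 2 * cos \<sigma> = (2 * sin (\<sigma> / 2)) ^ 2"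
    using cos_double_sin[of "\<sigma>/2"] by (simp add: power2_eq_square)
  ultimately have "(2 * sin (\<sigma> / 2)) ^ 2 \<le> cmod (cis (\<tau> - \<theta>) - 1) ^ 2" by simp
  then have "2 * sin (\<sigma> / 2) \<le> cmod (cis (\<tau> - \<theta>) - 1)"
    by (rule power2_le_imp_le) simp
  then have "2 * (\<sigma> / pi) \<le> cmod (cis (\<tau> - \<theta>) - 1)"
    using sin_half_ge[OF \<sigma>] by linarith
  then have "cmod D * (2 * (\<sigma> / pi)) \<le> 2"
    using D2 by (meson mult_left_mono norm_ge_zero order_trans)
  then have D3: "cmod D * \<sigma> \<le> pi" by (simp add: field_simps)
  have "cmod D * (1 + n * \<sigma>) = cmod D + n * (cmod D * \<sigma>)" by (simp add: algebra_simps)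
  also have "\<dots> \<le> n + n * pi" using D1 D3 by (intro add_mono mult_left_mono) auto
  finally have "cmod D * (1 + n * \<sigma>) \<le> n * (1 + pi)" by (simp add: algebra_simps)
  moreover have "1 + n * \<sigma> > 0" using \<sigma> by (simp add: add_pos_nonneg)
  ultimately have "cmod (D / n) \<le> (1 + pi) / (1 + n * \<sigma>)"
    using n by (simp add: norm_divide field_simps)
  then show ?thesis
    unfolding peak_eq_geometric D_def[symmetric] \<sigma>_def[symmetric] norm_power
    by (intro power_mono) auto
qed

text \<open>
  On the circle \<open>- cos \<theta> = - (z\<^sup>2 + 1) / (2 z)\<close>, and the factor \<open>z ^ n\<close> clears the denominators.
\<close>
lemma circle_lift_exists:
  fixes Q :: "real poly"
  assumes "degree Q \<le> n"
  obtains p :: "complex poly" where "degree p \<le> 2 * n"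
    "\<And>\<theta>::real. poly p (cis \<theta>) = cis (n * \<theta>) * of_real (poly Q (- cos \<theta>))"
proof
  define b :: "complex poly" where "b = [:-1/2, 0, -1/2:]"
  let ?p = "\<Sum>i\<le>n. smult (of_real (coeff Q i)) (b ^ i * monom 1 (n - i)) :: complex poly"
  show "degree ?p \<le> 2 * n"
  proof (intro degree_sum_le)
    fix i assume i: "i \<in> {..n}"
    have "degree (b ^ i) \<le> 2 * i"
      by (rule order_trans[OF degree_power_le]) (simp add: b_def)
    then have "degree (b ^ i * monom 1 (n - i) :: complex poly) \<le> 2 * i + (n - i)"
      by (intro order_trans[OF degree_mult_le] add_mono degree_monom_le)
    then show "degree (smult (of_real (coeff Q i)) (b ^ i * monom 1 (n - i)) :: complex poly) \<le> 2 * n"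
      using i by (intro order_trans[OF degree_smult_le]) auto
  qed simp
  fix \<theta> :: real
  have h: "poly b (cis \<theta>) = cis \<theta> * of_real (- cos \<theta>)"
  proof -
    have "2 * complex_of_real (cos \<theta>) = cis \<theta> + cis (- \<theta>)" by (simp add: complex_eq_iff)
    then have "cis \<theta> * (2 * complex_of_real (cos \<theta>)) = cis \<theta> * cis \<theta> + 1"
      by (simp add: distrib_left cis_mult)
    then show ?thesis by (simp add: b_def field_simps)
  qed
  have "poly ?p (cis \<theta>) = (\<Sum>i\<le>n. cis (n * \<theta>) * (of_real (coeff Q i) * of_real (- cos \<theta>) ^ i))"
    unfolding poly_sum
  proof (intro sum.cong refl)
    fix i assume i: "i \<in> {..n}"
    have "cis \<theta> ^ i * cis \<theta> ^ (n - i) = cis \<theta> ^ n"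
      using i by (simp add: power_add[symmetric])
    then have *: "cis \<theta> ^ i * cis \<theta> ^ (n - i) = cis (n * \<theta>)"
      by (simp add: Complex.DeMoivre)
    then show "poly (smult (of_real (coeff Q i)) (b ^ i * monom 1 (n - i))) (cis \<theta>)
       = cis (n * \<theta>) * (of_real (coeff Q i) * of_real (- cos \<theta>) ^ i)"
      unfolding *[symmetric] by (simp add: poly_power h poly_monom power_mult_distrib[of
          "cis \<theta>"] del: of_real_minus)
  qed
  also have "\<dots> = cis (n * \<theta>) * of_real (\<Sum>i\<le>n. coeff Q i * (- cos \<theta>) ^ i)"
    by (simp add: sum_distrib_left)
  also have "(\<Sum>i\<le>n. coeff Q i * (- cos \<theta>) ^ i) = poly Q (- cos \<theta>)"
    unfolding poly_altdef using assms
    by (intro sum.mono_neutral_right) (auto simp: coeff_eq_0)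
  finally show "poly ?p (cis \<theta>) = cis (n * \<theta>) * of_real (poly Q (- cos \<theta>))" .
qed

lemma circle_lift_deriv:
  fixes n :: nat
  assumes "\<And>\<theta>::real. poly p (cis \<theta>) = cis (n * \<theta>) * of_real (poly Q (- cos \<theta>))"
  shows "\<bar>sin \<theta> * poly (pderiv Q) (- cos \<theta>)\<bar>
     \<le> cmod (poly (pderiv p) (cis \<theta>)) + n * \<bar>poly Q (- cos \<theta>)\<bar>"
proof -
  let ?T' = "sin \<theta> * poly (pderiv Q) (- cos \<theta>)"
  have T: "((\<lambda>t. poly Q (- cos t)) has_real_derivative ?T') (at \<theta>)"
    by (auto intro!: derivative_eq_intros poly_DERIV[THEN DERIV_chain2] simp: mult.commute)
  have e: "(\<lambda>t::real. poly p (cis t)) = (\<lambda>t::real. cis (n * t) * of_real (poly Q (- cos t)))"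
    by (rule ext) (rule assms)
  have 1: "((\<lambda>t. poly p (cis t)) has_vector_derivative (\<i> * cis \<theta>) * poly (pderiv p) (cis \<theta>)) (at \<theta>)"
  proof -
    have "(cis has_vector_derivative (\<i> * cis \<theta>)) (at \<theta>)"
      unfolding has_vector_derivative_def by (auto intro!: derivative_eq_intros)
    then show ?thesis
      using field_vector_diff_chain_at[of cis _ \<theta> "poly p" "poly (pderiv p) (cis \<theta>)"] poly_DERIV
      by (simp add: o_def)
  qed
  have 2: "((\<lambda>t. cis (n * t) * of_real (poly Q (- cos t))) has_vector_derivative
      (cis (n * \<theta>) * of_real ?T' + (\<i> * n * cis (n * \<theta>)) * of_real (poly Q (- cos \<theta>)))) (at \<theta>)"
  proof (intro has_vector_derivative_mult)
    show "((\<lambda>t. cis (n * t)) has_vector_derivative \<i> * n * cis (n * \<theta>)) (at \<theta>)"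
      unfolding has_vector_derivative_def
      by (auto intro!: derivative_eq_intros simp: scaleR_conv_of_real)
    show "((\<lambda>t. complex_of_real (poly Q (- cos t))) has_vector_derivative complex_of_real ?T') (at \<theta>)"
      using T by (intro has_vector_derivative_of_real)
        (simp add: has_real_derivative_iff_has_vector_derivative)
  qed
  have "(\<i> * cis \<theta>) * poly (pderiv p) (cis \<theta>)
      = cis (n * \<theta>) * of_real ?T' + (\<i> * n * cis (n * \<theta>)) * of_real (poly Q (- cos \<theta>))"
    by (rule vector_derivative_unique_at[OF 1[unfolded e] 2])
  then have "cis (n * \<theta>) * of_real ?T' = (\<i> * cis \<theta>) * poly (pderiv p) (cis \<theta>)
      - (\<i> * n * cis (n * \<theta>)) * of_real (poly Q (- cos \<theta>))" by simp
  then have "cmod (cis (n * \<theta>) * of_real ?T') \<le> cmod ((\<i> * cis \<theta>) * poly (pderiv p) (cis \<theta>))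
      + cmod ((\<i> * n * cis (n * \<theta>)) * of_real (poly Q (- cos \<theta>)))"
    by (metis norm_triangle_ineq4)
  then show ?thesis by (simp add: norm_mult abs_mult)
qed

definition local_bound_const :: "real \<Rightarrow> nat \<Rightarrow> real" where
  "local_bound_const q M = (2 * M + 3) * (2 * (real M + 3) * (1 + pi) powr (M * q)) powr (1 / q)"

text \<open>
  Multiply the circle lift of \<open>Q\<close> by the peak at \<open>\<theta>\<close>. The product has degree \<open>O(n)\<close>, the same
  value at \<open>cis \<theta>\<close>, and there the derivative differs by \<open>O(n)\<close> times that value. So the global
  \<open>L\<^sub>q\<close>-bound for the product is a local bound for \<open>Q\<close>, with the decay of the peak as kernel.
\<close>
lemma local_average_bound:
  fixes Q :: "real poly" and q G :: real and M n :: nat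
  assumes q: "0 < q" "q \<le> 1" and n: "n \<ge> 1" and Q: "degree Q \<le> n" and \<theta>: "0 \<le> \<theta>" "\<theta> \<le> pi"
  defines "C \<equiv> local_bound_const q M"
  defines "G \<equiv> local_average q M n (\<lambda>\<tau>. poly Q (- cos \<tau>)) \<theta>"
  shows "\<bar>poly Q (- cos \<theta>)\<bar> \<le> C * G"
    and "\<bar>sin \<theta> * poly (pderiv Q) (- cos \<theta>)\<bar> \<le> n * (C * G)"
proof -
  obtain p where p: "degree p \<le> 2 * n"
    "\<And>\<theta>::real. poly p (cis \<theta>) = cis (n * \<theta>) * of_real (poly Q (- cos \<theta>))"
    using circle_lift_exists[OF Q] by metis
  define H where "H = p * peak M n \<theta>"
  define d where "d = n * (M + 2)"
  have dH: "degree H \<le> d"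
    unfolding H_def d_def using degree_mult_le[of p "peak M n \<theta>"] p(1) degree_peak[of M n \<theta>]
    by (simp add: algebra_simps)
  have d1: "real d + 1 \<le> n * (M + 3)"
  proof -
    have "d + 1 \<le> n * (M + 3)" using n by (simp add: d_def algebra_simps)
    then show ?thesis by (metis of_nat_1 of_nat_add of_nat_le_iff)
  qed
  define g where "g \<tau> = \<bar>poly Q (- cos \<tau>)\<bar> powr q * (1 + n * \<bar>\<theta> - \<tau>\<bar>) powr (- (M * q))" for \<tau>
  define Y where "Y = ((real d + 1) * integral {-pi..pi} (\<lambda>t. cmod (poly H (cis t)) powr q)) powr (1 / q)"
  have pos: "1 + n * \<bar>\<theta> - \<tau>\<bar> > 0" for \<tau> by (simp add: add_pos_nonneg)
  have cg: "continuous_on A g" for A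
    unfolding g_def using q pos
    by (intro continuous_on_mult continuous_on_powr' continuous_intros) (auto simp: less_imp_neq[symmetric]
        less_imp_le)
  have g0: "g \<tau> \<ge> 0" for \<tau> by (simp add: g_def)
  have ga: "continuous_on A (\<lambda>t. g \<bar>t\<bar>)" for A
    by (rule continuous_on_compose2[OF cg[of UNIV]]) (auto intro!: continuous_intros)
  have int2: "integral {-pi..pi} (\<lambda>t. g \<bar>t\<bar>) = 2 * integral {0..pi} g"
  proof -
    have "integral {-pi..pi} (\<lambda>t. g \<bar>t\<bar>) = integral {-pi..0} (\<lambda>t. g \<bar>t\<bar>) + integral {0..pi} (\<lambda>t. g \<bar>t\<bar>)"
      by (intro Henstock_Kurzweil_Integration.integral_combine[symmetric] integrable_continuous_real ga) auto
    also have "integral {-pi..0} (\<lambda>t. g \<bar>t\<bar>) = integral {0..pi} (\<lambda>t. g \<bar>t\<bar>)"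
      using Henstock_Kurzweil_Integration.integral_reflect_real[of pi 0 "\<lambda>t. g \<bar>t\<bar>"] by simp
    also have "integral {0..pi} (\<lambda>t. g \<bar>t\<bar>) = integral {0..pi} g"
      by (intro Henstock_Kurzweil_Integration.integral_cong) auto
    finally show ?thesis by simp
  qed
  have Hq: "cmod (poly H (cis t)) powr q \<le> (1 + pi) powr (M * q) * g \<bar>t\<bar>" if t: "t \<in> {-pi..pi}" for t
  proof -
    have "cmod (poly H (cis t)) = \<bar>poly Q (- cos \<bar>t\<bar>)\<bar> * cmod (poly (peak M n \<theta>) (cis t))"
      by (simp add: H_def p(2) norm_mult abs_if)
    also have "\<dots> \<le> \<bar>poly Q (- cos \<bar>t\<bar>)\<bar> * ((1 + pi) / (1 + n * \<bar>\<theta> - \<bar>t\<bar>\<bar>)) ^ M"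
      using cmod_peak_le[OF n \<theta>, of t M] t by (intro mult_left_mono) auto
    finally have "cmod (poly H (cis t)) powr q \<le> (\<bar>poly Q (- cos \<bar>t\<bar>)\<bar> * ((1 + pi) / (1 + n * \<bar>\<theta> - \<bar>t\<bar>\<bar>)) ^ M)
        powr q"
      using q by (intro powr_mono2) auto
    also have "\<dots> = (1 + pi) powr (M * q) * g \<bar>t\<bar>"
    proof -
      have "(((1 + pi) / (1 + n * \<bar>\<theta> - \<bar>t\<bar>\<bar>)) ^ M) powr q = ((1 + pi) / (1 + n * \<bar>\<theta> - \<bar>t\<bar>\<bar>)) powr (M * q)"
        using pos[of "\<bar>t\<bar>"] pi_gt_zero by (subst powr_realpow[symmetric]) (auto simp: powr_powr intro!:
            divide_pos_pos add_pos_pos)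
      also have "\<dots> = (1 + pi) powr (M * q) * (1 + n * \<bar>\<theta> - \<bar>t\<bar>\<bar>) powr (- (M * q))"
        using pos[of "\<bar>t\<bar>"] pi_gt_zero by (subst powr_divide) (auto simp: powr_minus divide_inverse)
      finally have e: "(((1 + pi) / (1 + n * \<bar>\<theta> - \<bar>t\<bar>\<bar>)) ^ M) powr q = \<dots>" .
      have "(\<bar>poly Q (- cos \<bar>t\<bar>)\<bar> * ((1 + pi) / (1 + n * \<bar>\<theta> - \<bar>t\<bar>\<bar>)) ^ M) powr q
        = \<bar>poly Q (- cos \<bar>t\<bar>)\<bar> powr q * (((1 + pi) / (1 + n * \<bar>\<theta> - \<bar>t\<bar>\<bar>)) ^ M) powr q"
        by (rule powr_mult)
      then show ?thesis unfolding e g_def by simp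
    qed
    finally show ?thesis .
  qed
  have cH: "continuous_on A (\<lambda>t. cmod (poly H (cis t)) powr q)" for A
    using q by (intro continuous_on_powr' continuous_intros) auto
  have "integral {-pi..pi} (\<lambda>t. cmod (poly H (cis t)) powr q)
      \<le> integral {-pi..pi} (\<lambda>t. (1 + pi) powr (M * q) * g \<bar>t\<bar>)"
    by (intro integral_le integrable_continuous_real cH continuous_on_mult continuous_on_const ga Hq)
  then have i1: "integral {-pi..pi} (\<lambda>t. cmod (poly H (cis t)) powr q) \<le> (1 + pi) powr (M * q) * (2 * integral
      {0..pi} g)"
    by (simp add: int2)
  have i0: "integral {-pi..pi} (\<lambda>t. cmod (poly H (cis t)) powr q) \<ge> 0"
    by (intro hk_integral_nonneg integrable_continuous_real cH) auto
  have ig: "integral {0..pi} g \<ge> 0"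
    by (intro hk_integral_nonneg integrable_continuous_real cg g0)
  have "(real d + 1) * integral {-pi..pi} (\<lambda>t. cmod (poly H (cis t)) powr q)
     \<le> (n * (M + 3)) * ((1 + pi) powr (M * q) * (2 * integral {0..pi} g))"
    using d1 i1 i0 by (intro mult_mono) auto
  also have "\<dots> = (2 * (real M + 3) * (1 + pi) powr (M * q)) * (n * integral {0..pi} g)"
    by (simp add: algebra_simps)
  finally have "Y \<le> ((2 * (real M + 3) * (1 + pi) powr (M * q)) * (n * integral {0..pi} g)) powr (1 / q)"
    unfolding Y_def using q i0 by (intro powr_mono2) auto
  also have "\<dots> = (2 * (real M + 3) * (1 + pi) powr (M * q)) powr (1 / q) * G"
    unfolding G_def local_average_def g_def[symmetric] by (rule powr_mult)
  finally have YG: "Y \<le> (2 * (real M + 3) * (1 + pi) powr (M * q)) powr (1 / q) * G" .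
  have G0: "G \<ge> 0" by (simp add: G_def local_average_def)
  have Y0: "Y \<ge> 0" by (simp add: Y_def)
  have CG: "(2 * M + 3) * Y \<le> C * G"
  proof -
    have "(2 * M + 3) * Y \<le> (2 * M + 3) * ((2 * (real M + 3) * (1 + pi) powr (M * q)) powr (1 / q) * G)"
      by (intro mult_left_mono YG) auto
    then show ?thesis by (simp add: C_def local_bound_const_def mult.assoc)
  qed
  note HY = poly_circle_Lq_bound[OF dH q, folded Y_def]
  have p1: "\<bar>poly Q (- cos \<theta>)\<bar> = cmod (poly p (cis \<theta>))" by (simp add: p(2) norm_mult)
  have "cmod (poly p (cis \<theta>)) = cmod (poly H (cis \<theta>))"
    by (simp add: H_def peak_center[OF n])
  then have pY: "cmod (poly p (cis \<theta>)) \<le> Y" using HY(1) by simp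
  also have "\<dots> \<le> (2 * M + 3) * Y" using mult_right_mono[of 1 "2 * real M + 3" Y] Y0 by simp
  finally show "\<bar>poly Q (- cos \<theta>)\<bar> \<le> C * G" using CG p1 by simp
  have "poly (pderiv p) (cis \<theta>) = poly (pderiv H) (cis \<theta>) - poly p (cis \<theta>) * poly (pderiv (peak M n \<theta>)) (cis \<theta>)"
    by (simp add: H_def pderiv_mult peak_center[OF n])
  then have "cmod (poly (pderiv p) (cis \<theta>)) \<le> cmod (poly (pderiv H) (cis \<theta>))
      + cmod (poly p (cis \<theta>)) * cmod (poly (pderiv (peak M n \<theta>)) (cis \<theta>))"
    by (metis norm_mult norm_triangle_ineq4)
  also have "\<dots> \<le> d * Y + Y * (M * n)"
    using pY Y0 by (intro add_mono mult_mono HY peak_center(2)[OF n]) auto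
  finally have pd: "cmod (poly (pderiv p) (cis \<theta>)) \<le> d * Y + Y * (M * n)" .
  have "\<bar>sin \<theta> * poly (pderiv Q) (- cos \<theta>)\<bar> \<le> cmod (poly (pderiv p) (cis \<theta>)) + n * \<bar>poly Q (- cos \<theta>)\<bar>"
    by (rule circle_lift_deriv[OF p(2)])
  also have "\<dots> \<le> (d * Y + Y * (M * n)) + n * Y"
    using pd pY p1 by (intro add_mono mult_left_mono) auto
  also have "\<dots> = n * ((2 * M + 3) * Y)" by (simp add: d_def algebra_simps)
  also have "\<dots> \<le> n * (C * G)" by (intro mult_left_mono CG) auto
  finally show "\<bar>sin \<theta> * poly (pderiv Q) (- cos \<theta>)\<bar> \<le> n * (C * G)" .
qed

lemma one_plus_dist_pos: "1 + real n * \<bar>\<theta> - \<tau>\<bar> > 0"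
  by (simp add: add_pos_nonneg)

lemma one_plus_dist_le: "1 + real n * \<bar>\<theta> - \<sigma>\<bar> \<le> (1 + n * \<bar>\<theta> - \<tau>\<bar>) * (1 + n * \<bar>\<tau> - \<sigma>\<bar>)"
proof -
  have "real n * \<bar>\<theta> - \<sigma>\<bar> \<le> n * (\<bar>\<theta> - \<tau>\<bar> + \<bar>\<tau> - \<sigma>\<bar>)" by (intro mult_left_mono) auto
  moreover have "0 \<le> (n * \<bar>\<theta> - \<tau>\<bar>) * (n * \<bar>\<tau> - \<sigma>\<bar>)" by simp
  moreover have "(1 + n * \<bar>\<theta> - \<tau>\<bar>) * (1 + n * \<bar>\<tau> - \<sigma>\<bar>)
      = 1 + n * (\<bar>\<theta> - \<tau>\<bar> + \<bar>\<tau> - \<sigma>\<bar>) + (n * \<bar>\<theta> - \<tau>\<bar>) * (n * \<bar>\<tau> - \<sigma>\<bar>)"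
    by (simp add: algebra_simps)
  ultimately show ?thesis by linarith
qed

lemma continuous_on_dist_powr:
  "continuous_on A (\<lambda>x. (1 + real n * \<bar>f x - g x\<bar>) powr e)"
  if "continuous_on A f" "continuous_on A g"
  using that one_plus_dist_pos[of n]
  by (intro continuous_on_powr continuous_intros) (auto simp: less_imp_neq[symmetric])

lemma continuous_on_local_average:
  assumes q: "q > 0" and f: "continuous_on {0..pi} f"
  shows "continuous_on A (local_average q M n f)"
proof -
  have c: "continuous_on (A \<times> cbox 0 pi) (\<lambda>(\<theta>, \<tau>). \<bar>f \<tau>\<bar> powr q * (1 + n * \<bar>\<theta> - \<tau>\<bar>) powr (- (M * q)))"
    unfolding split_beta
  proof (intro continuous_on_mult continuous_on_dist_powr continuous_on_fst continuous_on_snd continuous_on_id)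
    have "continuous_on (A \<times> cbox 0 pi) (\<lambda>x. f (snd x))"
      by (rule continuous_on_compose2[OF f]) (auto intro: continuous_on_snd continuous_on_id)
    then show "continuous_on (A \<times> cbox 0 pi) (\<lambda>x. \<bar>f (snd x)\<bar> powr q)"
      using q by (intro continuous_on_powr' continuous_on_rabs continuous_on_const) auto
  qed
  have "0 \<le> integral {0..pi} (\<lambda>\<tau>. \<bar>f \<tau>\<bar> powr q * (1 + n * \<bar>\<theta> - \<tau>\<bar>) powr (- (M * q)))" for \<theta>
  proof (rule hk_integral_nonneg)
    have "continuous_on {0..pi} (\<lambda>x. \<bar>f x\<bar> powr q)"
      using q by (intro continuous_on_powr' continuous_on_rabs continuous_on_const f) auto
    then show "(\<lambda>\<tau>. \<bar>f \<tau>\<bar> powr q * (1 + n * \<bar>\<theta> - \<tau>\<bar>) powr (- (M * q))) integrable_on {0..pi}"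
      by (intro integrable_continuous_real continuous_on_mult continuous_on_dist_powr continuous_on_const
          continuous_on_id)
  qed auto
  then show ?thesis
    unfolding local_average_def[abs_def] using q integral_continuous_on_param[OF c]
    by (intro continuous_on_powr' continuous_on_mult continuous_on_const) (auto simp: cbox_interval)
qed

lemma local_average_nonneg: "local_average q M n f \<theta> \<ge> 0"
  by (simp add: local_average_def)

text \<open>
  The kernel inherits this from \<open>1 + n |\<tau> - \<sigma>| \<le> (1 + n |\<theta> - \<tau>|) (1 + n |\<theta> - \<sigma>|)\<close>.
\<close>
lemma local_average_slowly_varying:
  assumes q: "q > 0" and f: "continuous_on {0..pi} f"
  shows "local_average q M n f \<theta> \<le> (1 + n * \<bar>\<theta> - \<tau>\<bar>) ^ M * local_average q M n f \<tau>"
proof -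
  define I where "I \<theta> = integral {0..pi} (\<lambda>\<tau>. \<bar>f \<tau>\<bar> powr q * (1 + n * \<bar>\<theta> - \<tau>\<bar>) powr (- (M * q)))" for \<theta>
  have "continuous_on {0..pi} (\<lambda>x. \<bar>f x\<bar> powr q)"
    using q by (intro continuous_on_powr' continuous_on_rabs continuous_on_const f) auto
  then have c: "(\<lambda>\<tau>. \<bar>f \<tau>\<bar> powr q * (1 + n * \<bar>\<theta> - \<tau>\<bar>) powr (- (M * q))) integrable_on {0..pi}" for \<theta>
    by (intro integrable_continuous_real continuous_on_mult continuous_on_dist_powr continuous_on_const
        continuous_on_id)
  have I0: "0 \<le> I \<theta>" for \<theta>
    unfolding I_def by (intro hk_integral_nonneg c) auto
  define D where "D = 1 + n * \<bar>\<theta> - \<tau>\<bar>"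
  have D: "D > 0" by (simp add: D_def one_plus_dist_pos)
  have "I \<theta> \<le> integral {0..pi} (\<lambda>\<sigma>. D powr (M * q) * (\<bar>f \<sigma>\<bar> powr q * (1 + n * \<bar>\<tau> - \<sigma>\<bar>) powr (- (M * q))))"
    unfolding I_def
  proof (intro integral_le c)
    show "(\<lambda>\<sigma>. D powr (M * q) * (\<bar>f \<sigma>\<bar> powr q * (1 + n * \<bar>\<tau> - \<sigma>\<bar>) powr (- (M * q)))) integrable_on {0..pi}"
      by (intro integrable_on_mult_right c)
    fix \<sigma>
    define E where "E = 1 + n * \<bar>\<theta> - \<sigma>\<bar>"
    define F where "F = 1 + n * \<bar>\<tau> - \<sigma>\<bar>"
    have EF: "E > 0" "F > 0" "F \<le> D * E"
      using one_plus_dist_le[of n \<tau> \<sigma> \<theta>] by (auto simp: E_def F_def D_def one_plus_dist_pos abs_minus_commute)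
    have "F powr (M * q) \<le> (D * E) powr (M * q)" using EF q by (intro powr_mono2) auto
    then have "E powr (- (M * q)) \<le> D powr (M * q) * F powr (- (M * q))"
      using EF D by (simp add: powr_mult powr_minus field_simps)
    then have "\<bar>f \<sigma>\<bar> powr q * E powr (- (M * q)) \<le> \<bar>f \<sigma>\<bar> powr q * (D powr (M * q) * F powr (- (M * q)))"
      by (rule mult_left_mono) simp
    then show "\<bar>f \<sigma>\<bar> powr q * (1 + n * \<bar>\<theta> - \<sigma>\<bar>) powr (- (M * q))
        \<le> D powr (M * q) * (\<bar>f \<sigma>\<bar> powr q * (1 + n * \<bar>\<tau> - \<sigma>\<bar>) powr (- (M * q)))"
      unfolding E_def F_def by (simp add: mult_ac)
  qed
  also have "\<dots> = D powr (M * q) * I \<tau>" unfolding I_def by simp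
  finally have "n * I \<theta> \<le> n * (D powr (M * q) * I \<tau>)" by (rule mult_left_mono) simp
  then have "n * I \<theta> \<le> D powr (M * q) * (n * I \<tau>)" by (simp add: mult_ac)
  then have "(n * I \<theta>) powr (1 / q) \<le> (D powr (M * q) * (n * I \<tau>)) powr (1 / q)"
    using q I0 by (intro powr_mono2) auto
  also have "\<dots> = (D powr (M * q)) powr (1 / q) * (n * I \<tau>) powr (1 / q)" by (rule powr_mult)
  also have "(D powr (M * q)) powr (1 / q) = D ^ M"
    using q D by (simp add: powr_powr powr_realpow)
  finally show ?thesis by (simp add: local_average_def I_def D_def)
qed

section \<open>A Schur test for a slowly decaying kernel\<close>

lemma kernel_integral_le:
  assumes \<theta>: "0 \<le> \<theta>" "\<theta> \<le> pi"
  shows "integral {0..pi} (\<lambda>\<tau>. n * (1 + real n * \<bar>\<theta> - \<tau>\<bar>) powr (-2)) \<le> 2"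
proof -
  let ?k = "\<lambda>\<tau>. n * (1 + real n * \<bar>\<theta> - \<tau>\<bar>) powr (-2)"
  have i: "?k integrable_on {0..pi}"
    by (intro integrable_continuous_real continuous_on_mult continuous_on_dist_powr continuous_on_const
        continuous_on_id)
  have p: "1 + real n * x > 0" if "x \<ge> 0" for x using that by (simp add: add_pos_nonneg)
  have "(?k has_integral (1 / (1 + n * (\<theta> - \<theta>)) - 1 / (1 + n * (\<theta> - 0)))) {0..\<theta>}"
  proof (rule fundamental_theorem_of_calculus)
    fix \<tau> assume \<tau>: "\<tau> \<in> {0..\<theta>}"
    have "((\<lambda>\<tau>. 1 / (1 + n * (\<theta> - \<tau>))) has_real_derivative n / (1 + n * (\<theta> - \<tau>)) ^ 2) (at \<tau> within {0..\<theta>})"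
      using \<tau> p[of "\<theta> - \<tau>"] by (auto intro!: derivative_eq_intros simp: power2_eq_square)
    moreover have "n / (1 + n * (\<theta> - \<tau>)) ^ 2 = ?k \<tau>"
      using \<tau> p[of "\<theta> - \<tau>"] powr_realpow[of "1 + n * (\<theta> - \<tau>)" 2] by (simp add: powr_minus divide_inverse)
    ultimately show "((\<lambda>\<tau>. 1 / (1 + n * (\<theta> - \<tau>))) has_vector_derivative ?k \<tau>) (at \<tau> within {0..\<theta>})"
      by (simp add: has_real_derivative_iff_has_vector_derivative)
  qed (use \<theta> in auto)
  from integral_unique[OF this] have 1: "integral {0..\<theta>} ?k \<le> 1" using p[OF \<theta>(1)] by simp
  have "(?k has_integral (- 1 / (1 + n * (pi - \<theta>)) - - 1 / (1 + n * (\<theta> - \<theta>)))) {\<theta>..pi}"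
  proof (rule fundamental_theorem_of_calculus)
    fix \<tau> assume \<tau>: "\<tau> \<in> {\<theta>..pi}"
    have "((\<lambda>\<tau>. - 1 / (1 + n * (\<tau> - \<theta>))) has_real_derivative n / (1 + n * (\<tau> - \<theta>)) ^ 2) (at \<tau> within {\<theta>..pi})"
      using \<tau> p[of "\<tau> - \<theta>"] by (auto intro!: derivative_eq_intros simp: power2_eq_square)
    moreover have "n / (1 + n * (\<tau> - \<theta>)) ^ 2 = ?k \<tau>"
      using \<tau> p[of "\<tau> - \<theta>"] powr_realpow[of "1 + n * (\<tau> - \<theta>)" 2] by (simp add: powr_minus divide_inverse)
    ultimately show "((\<lambda>\<tau>. - 1 / (1 + n * (\<tau> - \<theta>))) has_vector_derivative ?k \<tau>) (at \<tau> within {\<theta>..pi})"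
      by (simp add: has_real_derivative_iff_has_vector_derivative)
  qed (use \<theta> in auto)
  from integral_unique[OF this] have 2: "integral {\<theta>..pi} ?k \<le> 1" using p[of "pi - \<theta>"] \<theta> by simp
  show ?thesis
    using Henstock_Kurzweil_Integration.integral_combine[OF \<theta> i] 1 2 by linarith
qed

text \<open>
  The convex function \<open>x powr s\<close> lies above its tangent at \<open>c\<close>; this is an instance of Young's
  inequality.
\<close>
lemma powr_above_tangent:
  fixes s c x :: real
  assumes "s \<ge> 1" "c > 0" "x \<ge> 0"
  shows "(1 - s) * c powr s + s * c powr (s - 1) * x \<le> x powr s"
proof (cases "x = 0")
  case True
  then show ?thesis using assms by (simp add: mult_nonpos_nonneg)
next
  case False
  have "(x powr s) powr (1 / s) * (c powr s) powr (1 - 1 / s) \<le> 1 / s * x powr s + (1 - 1 / s) * c powr s"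
    using assms False by (intro Youngs_inequality_0) auto
  moreover have "(x powr s) powr (1 / s) = x" using assms False by (simp add: powr_powr)
  moreover have "(c powr s) powr (1 - 1 / s) = c powr (s - 1)"
    using assms by (simp add: powr_powr right_diff_distrib)
  ultimately have "x * c powr (s - 1) \<le> 1 / s * x powr s + (1 - 1 / s) * c powr s" by simp
  then have "s * (x * c powr (s - 1)) \<le> s * (1 / s * x powr s + (1 - 1 / s) * c powr s)"
    using assms by (intro mult_left_mono) auto
  also have "\<dots> = x powr s + (s - 1) * c powr s" using assms by (simp add: field_simps)
  finally show ?thesis by (simp add: algebra_simps)
qed

text \<open>
  The kernel is symmetric with mass at most \<open>2\<close> in each variable. Jensen's inequality for the
  inner integral follows by integrating the tangent inequality; exchanging the order of
  integration does the rest.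
\<close>
lemma kernel_operator_Ls_bound:
  fixes f :: "real \<Rightarrow> real"
  assumes s: "s \<ge> 1" and f: "continuous_on {0..pi} f" and f0: "\<And>\<tau>. f \<tau> \<ge> 0"
  shows "integral {0..pi} (\<lambda>\<theta>. (integral {0..pi} (\<lambda>\<tau>. f \<tau> * (n * (1 + real n * \<bar>\<theta> - \<tau>\<bar>) powr (-2)))) powr s)
     \<le> 2 powr s * integral {0..pi} (\<lambda>\<tau>. f \<tau> powr s)"
proof -
  define k where "k \<theta> \<tau> = n * (1 + real n * \<bar>\<theta> - \<tau>\<bar>) powr (-2)" for \<theta> \<tau> :: real
  define g where "g \<theta> = integral {0..pi} (\<lambda>\<tau>. f \<tau> * k \<theta> \<tau>)" for \<theta>
  have k0: "k \<theta> \<tau> \<ge> 0" for \<theta> \<tau> by (simp add: k_def)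
  have ksym: "k \<theta> \<tau> = k \<tau> \<theta>" for \<theta> \<tau> by (simp add: k_def abs_minus_commute)
  have kswap: "(\<lambda>\<theta>. k \<theta> \<tau>) = k \<tau>" for \<tau> by (rule ext) (rule ksym)
  have ck: "continuous_on A (\<lambda>\<tau>. k \<theta> \<tau>)" for A \<theta> unfolding k_def
    by (intro continuous_on_mult continuous_on_dist_powr continuous_on_const continuous_on_id)
  have ck2: "continuous_on A (\<lambda>x. k (fst x) (snd x))" for A unfolding k_def
    by (intro continuous_on_mult continuous_on_dist_powr continuous_on_const continuous_on_id
        continuous_on_fst continuous_on_snd)
  have kint: "integral {0..pi} (k \<theta>) \<le> 2" if "\<theta> \<in> {0..pi}" for \<theta>
    using kernel_integral_le[of \<theta> n] that by (simp add: k_def[abs_def])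
  have cfs: "continuous_on {0..pi} (\<lambda>\<tau>. f \<tau> powr s)"
    using s f0 by (intro continuous_on_powr' f continuous_on_const) auto
  have cs: "continuous_on ({0..pi} \<times> {0..pi}) (\<lambda>x. h (snd x) * k (fst x) (snd x))" if
      "continuous_on {0..pi} h" for h
    by (intro continuous_on_mult ck2 continuous_on_compose2[OF that]) (auto intro: continuous_on_snd
        continuous_on_id)
  have cI: "continuous_on {0..pi} (\<lambda>\<theta>. integral {0..pi} (\<lambda>\<tau>. h \<tau> * k \<theta> \<tau>))" if "continuous_on {0..pi} h" for h
    using integral_continuous_on_param[of "{0..pi}" 0 pi "\<lambda>\<theta> \<tau>. h \<tau> * k \<theta> \<tau>"] cs[OF that]
    by (simp add: split_beta cbox_interval)
  have g0: "g \<theta> \<ge> 0" for \<theta> unfolding g_def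
    by (intro hk_integral_nonneg integrable_continuous_real continuous_on_mult f ck mult_nonneg_nonneg f0 k0)
  have jensen: "g \<theta> powr s \<le> 2 powr (s - 1) * integral {0..pi} (\<lambda>\<tau>. f \<tau> powr s * k \<theta> \<tau>)" if \<theta>: "\<theta> \<in> {0..pi}" for \<theta>
  proof (cases "g \<theta> = 0")
    case True
    then show ?thesis
      by (simp, intro mult_nonneg_nonneg hk_integral_nonneg
          integrable_continuous_real continuous_on_mult cfs ck k0) auto
  next
    case False
    \<comment> \<open>The tangent point is half the integral, because the mass of the kernel is at most \<open>2\<close>.\<close>
    define c where "c = g \<theta> / 2"
    have c: "c > 0" using False g0[of \<theta>] by (simp add: c_def)
    have "integral {0..pi} (\<lambda>\<tau>. (1 - s) * c powr s * k \<theta> \<tau> + s * c powr (s - 1) * (f \<tau> * k \<theta> \<tau>))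
        \<le> integral {0..pi} (\<lambda>\<tau>. f \<tau> powr s * k \<theta> \<tau>)"
    proof (intro integral_le integrable_continuous_real continuous_on_add continuous_on_mult
        continuous_on_const ck f cfs)
      fix \<tau>
      show "(1 - s) * c powr s * k \<theta> \<tau> + s * c powr (s - 1) * (f \<tau> * k \<theta> \<tau>) \<le> f \<tau> powr s * k \<theta> \<tau>"
        using mult_right_mono[OF powr_above_tangent[OF s c f0] k0, of \<tau> \<theta> \<tau>] by (simp add: algebra_simps)
    qed
    also have "integral {0..pi} (\<lambda>\<tau>. (1 - s) * c powr s * k \<theta> \<tau> + s * c powr (s - 1) * (f \<tau> * k \<theta> \<tau>))
       = (1 - s) * c powr s * integral {0..pi} (k \<theta>) + s * c powr (s - 1) * g \<theta>"
      unfolding g_def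
      by (subst Henstock_Kurzweil_Integration.integral_add)
         (auto intro!: integrable_continuous_real continuous_on_mult continuous_on_const ck f)
    finally have "(1 - s) * c powr s * integral {0..pi} (k \<theta>) + s * c powr (s - 1) * g \<theta>
        \<le> integral {0..pi} (\<lambda>\<tau>. f \<tau> powr s * k \<theta> \<tau>)" .
    moreover have "(1 - s) * c powr s * 2 \<le> (1 - s) * c powr s * integral {0..pi} (k \<theta>)"
      using kint[OF \<theta>] s by (intro mult_left_mono_neg) (auto simp: mult_nonpos_nonneg)
    moreover have "s * c powr (s - 1) * g \<theta> = 2 * s * c powr s"
      using c by (simp add: c_def powr_diff field_simps)
    moreover have "(1 - s) * c powr s * 2 + 2 * s * c powr s = 2 * c powr s" by (simp add: algebra_simps)
    ultimately have "2 * c powr s \<le> integral {0..pi} (\<lambda>\<tau>. f \<tau> powr s * k \<theta> \<tau>)"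
      by linarith
    then have "2 powr (s - 1) * (2 * c powr s) \<le> 2 powr (s - 1) * integral {0..pi} (\<lambda>\<tau>. f \<tau> powr s * k \<theta> \<tau>)"
      by (rule mult_left_mono) simp
    moreover have "2 powr (s - 1) * (2 * c powr s) = g \<theta> powr s"
      using c g0[of \<theta>] by (simp add: powr_diff c_def powr_divide)
    ultimately show ?thesis by simp
  qed
  have "integral {0..pi} (\<lambda>\<theta>. g \<theta> powr s) \<le> integral {0..pi} (\<lambda>\<theta>. 2 powr (s - 1) * integral {0..pi} (\<lambda>\<tau>. f \<tau>
      powr s * k \<theta> \<tau>))"
  proof (intro integral_le integrable_continuous_real continuous_on_mult continuous_on_const cI cfs jensen)
    show "continuous_on {0..pi} (\<lambda>\<theta>. g \<theta> powr s)"
      using s g0 cI[OF f] unfolding g_def by (intro continuous_on_powr' continuous_on_const) auto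
  qed
  then have 1: "integral {0..pi} (\<lambda>\<theta>. g \<theta> powr s)
      \<le> 2 powr (s - 1) * integral {0..pi} (\<lambda>\<theta>. integral {0..pi} (\<lambda>\<tau>. f \<tau> powr s * k \<theta> \<tau>))" by simp
  have "integral {0..pi} (\<lambda>\<theta>. integral {0..pi} (\<lambda>\<tau>. f \<tau> powr s * k \<theta> \<tau>))
     = integral {0..pi} (\<lambda>\<tau>. integral {0..pi} (\<lambda>\<theta>. f \<tau> powr s * k \<theta> \<tau>))"
  proof -
    have "cbox (0, 0) (pi, pi) = {0..pi} \<times> {0..pi}" unfolding cbox_Pair_eq by simp
    then show ?thesis
      using integral_swap_continuous[of 0 0 pi pi "\<lambda>\<theta> \<tau>. f \<tau> powr s * k \<theta> \<tau>"] cs[OF cfs]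
      unfolding split_beta by (simp only: box_real)
  qed
  also have "\<dots> = integral {0..pi} (\<lambda>\<tau>. f \<tau> powr s * integral {0..pi} (k \<tau>))"
  proof (rule Henstock_Kurzweil_Integration.integral_cong)
    fix \<tau>
    have *: "integral {0..pi} (\<lambda>\<theta>. k \<theta> \<tau>) = integral {0..pi} (k \<tau>)"
      by (rule arg_cong[where f = "integral {0..pi}", OF kswap])
    show "integral {0..pi} (\<lambda>\<theta>. f \<tau> powr s * k \<theta> \<tau>) = f \<tau> powr s * integral {0..pi} (k \<tau>)"
      by (simp only: Henstock_Kurzweil_Integration.integral_mult_right *)
  qed
  also have "\<dots> \<le> integral {0..pi} (\<lambda>\<tau>. f \<tau> powr s * 2)"
  proof (intro integral_le integrable_continuous_real continuous_on_mult cfs continuous_on_const)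
    fix \<tau> assume "\<tau> \<in> {0..pi}"
    then show "f \<tau> powr s * integral {0..pi} (k \<tau>) \<le> f \<tau> powr s * 2"
      by (intro mult_left_mono kint) auto
  next
    show "continuous_on {0..pi} (\<lambda>\<theta>. integral {0..pi} (k \<theta>))"
      using cI[of "\<lambda>_. 1"] by simp
  qed
  also have "\<dots> = 2 * integral {0..pi} (\<lambda>\<tau>. f \<tau> powr s)" by simp
  finally have 2: "integral {0..pi} (\<lambda>\<theta>. integral {0..pi} (\<lambda>\<tau>. f \<tau> powr s * k \<theta> \<tau>))
      \<le> 2 * integral {0..pi} (\<lambda>\<tau>. f \<tau> powr s)" .
  from order_trans[OF 1 mult_left_mono[OF 2]] show ?thesis
    unfolding g_def k_def by (simp add: powr_diff)
qed

section \<open>Weighted norms of local averages\<close>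

text \<open>
  Up to a constant factor, the Jacobi weight in the variable \<open>\<theta>\<close>, truncated at distance
  \<open>1 / n\<close> from the ends. The truncation makes it vary slowly at the scale \<open>1 / n\<close>.
\<close>
definition endpoint_weight :: "nat \<Rightarrow> real \<Rightarrow> real \<Rightarrow> real \<Rightarrow> real" where
  "endpoint_weight n a b \<theta> = (sin (\<theta> / 2) + 1 / n) powr a * (cos (\<theta> / 2) + 1 / n) powr b"

lemma sin_half_nonneg: "\<theta> \<in> {0..pi} \<Longrightarrow> 0 \<le> sin (\<theta> / 2)"
  by (intro sin_ge_zero) auto

lemma cos_half_nonneg: "\<theta> \<in> {0..pi} \<Longrightarrow> 0 \<le> cos (\<theta> / 2)"
  by (intro cos_ge_zero) auto

lemma endpoint_weight_pos:
  assumes "n \<ge> 1" "\<theta> \<in> {0..pi}"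
  shows "endpoint_weight n a b \<theta> > 0"
proof -
  have "sin (\<theta> / 2) + 1 / n > 0" "cos (\<theta> / 2) + 1 / n > 0"
    using assms sin_half_nonneg[of \<theta>] cos_half_nonneg[of \<theta>] by (auto intro: add_nonneg_pos)
  then show ?thesis by (simp add: endpoint_weight_def)
qed

lemma continuous_on_endpoint_weight:
  assumes "n \<ge> 1"
  shows "continuous_on {0..pi} (endpoint_weight n a b)"
proof -
  have "sin (\<theta> / 2) + 1 / n > 0" "cos (\<theta> / 2) + 1 / n > 0" if "\<theta> \<in> {0..pi}" for \<theta>
    using assms sin_half_nonneg[of \<theta>] cos_half_nonneg[of \<theta>] that by (auto intro: add_nonneg_pos)
  then have "\<forall>\<theta>\<in>{0..pi}. sin (\<theta> / 2) + 1 / n \<noteq> 0" "\<forall>\<theta>\<in>{0..pi}. cos (\<theta> / 2) + 1 / n \<noteq> 0"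
    by (metis less_irrefl)+
  then show ?thesis
    unfolding endpoint_weight_def[abs_def]
    by (intro continuous_on_mult continuous_on_powr continuous_on_add continuous_on_sin continuous_on_cos
        continuous_on_const continuous_on_divide continuous_on_id) auto
qed

lemma powr_le_of_comparable:
  fixes D u v :: real
  assumes "u > 0" "v > 0" "u \<le> D * v" "v \<le> D * u"
  shows "u powr a \<le> D powr \<bar>a\<bar> * v powr a"
proof -
  have D: "D > 0" using assms by (smt (verit) mult_nonpos_nonneg)
  show ?thesis
  proof (cases "a \<ge> 0")
    case True
    then have "u powr a \<le> (D * v) powr a" using assms by (intro powr_mono2) auto
    then show ?thesis using True by (simp add: powr_mult)
  next
    case False
    then have "(D * u) powr a \<le> v powr a" using assms by (intro powr_mono2') auto
    then have "D powr a * u powr a \<le> v powr a" by (simp add: powr_mult)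
    then have "D powr (-a) * (D powr a * u powr a) \<le> D powr (-a) * v powr a" by (rule mult_left_mono) simp
    moreover have "D powr (-a) * D powr a = 1" using D by (simp add: powr_add[symmetric])
    ultimately show ?thesis using False by (simp add: mult.assoc[symmetric])
  qed
qed

lemma one_over_n_shift_comparable:
  assumes "n \<ge> 1" "\<bar>u - v\<bar> \<le> d" "u \<ge> 0" "v \<ge> 0"
  shows "u + 1 / real n \<le> (1 + n * d) * (v + 1 / real n)"
proof -
  have "(1 + n * d) * (v + 1 / real n) = v + 1 / n + d + n * d * v"
    using assms by (simp add: field_simps)
  moreover have "0 \<le> n * d * v" using assms by (intro mult_nonneg_nonneg) auto
  ultimately show ?thesis using assms(2) by linarith
qed

lemma abs_sin_diff_le: "\<bar>sin x - sin y\<bar> \<le> \<bar>x - y\<bar>" for x y :: real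
proof -
  have "\<bar>sin x - sin y\<bar> = 2 * (\<bar>sin ((x - y) / 2)\<bar> * \<bar>cos ((x + y) / 2)\<bar>)"
    by (simp add: sin_diff_sin abs_mult)
  also have "\<dots> \<le> 2 * (\<bar>(x - y) / 2\<bar> * 1)"
    by (intro mult_left_mono mult_mono abs_sin_x_le_abs_x) auto
  finally show ?thesis by simp
qed

lemma abs_cos_diff_le: "\<bar>cos x - cos y\<bar> \<le> \<bar>x - y\<bar>" for x y :: real
  using abs_sin_diff_le[of "pi / 2 - x" "pi / 2 - y"] by (simp add: sin_diff)

lemma endpoint_weight_slowly_varying:
  assumes n: "n \<ge> 1" and \<theta>: "\<theta> \<in> {0..pi}" and \<tau>: "\<tau> \<in> {0..pi}"
  shows "endpoint_weight n a b \<theta> \<le> (1 + n * \<bar>\<theta> - \<tau>\<bar>) powr (\<bar>a\<bar> + \<bar>b\<bar>) * endpoint_weight n a b \<tau>"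
proof -
  define D where "D = 1 + n * \<bar>\<theta> - \<tau>\<bar>"
  note nn = sin_half_nonneg[OF \<theta>] sin_half_nonneg[OF \<tau>] cos_half_nonneg[OF \<theta>] cos_half_nonneg[OF \<tau>]
  have s: "\<bar>sin (\<theta> / 2) - sin (\<tau> / 2)\<bar> \<le> \<bar>\<theta> - \<tau>\<bar>" "\<bar>sin (\<tau> / 2) - sin (\<theta> / 2)\<bar> \<le> \<bar>\<theta> - \<tau>\<bar>"
    using abs_sin_diff_le[of "\<theta> / 2" "\<tau> / 2"] by auto
  have c: "\<bar>cos (\<theta> / 2) - cos (\<tau> / 2)\<bar> \<le> \<bar>\<theta> - \<tau>\<bar>" "\<bar>cos (\<tau> / 2) - cos (\<theta> / 2)\<bar> \<le> \<bar>\<theta> - \<tau>\<bar>"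
    using abs_cos_diff_le[of "\<theta> / 2" "\<tau> / 2"] by auto
  have 1: "(sin (\<theta> / 2) + 1 / n) powr a \<le> D powr \<bar>a\<bar> * (sin (\<tau> / 2) + 1 / n) powr a"
    unfolding D_def using n nn s by (intro powr_le_of_comparable one_over_n_shift_comparable add_nonneg_pos) auto
  have 2: "(cos (\<theta> / 2) + 1 / n) powr b \<le> D powr \<bar>b\<bar> * (cos (\<tau> / 2) + 1 / n) powr b"
    unfolding D_def using n nn c by (intro powr_le_of_comparable one_over_n_shift_comparable add_nonneg_pos) auto
  show ?thesis
    using mult_mono[OF 1 2] unfolding endpoint_weight_def D_def[symmetric] powr_add by (simp add: mult_ac)
qed

text \<open>
  Moving the weight inside the local average costs the factor
  \<open>(1 + n |\<theta> - \<tau>|) powr (|a| + |b|)\<close>. The decay of order \<open>M\<close> pays for it and still leaves the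
  kernel \<open>(1 + n |\<theta> - \<tau>|) powr -2\<close>, to which the Schur test applies with exponent \<open>p / q\<close>.
\<close>
lemma weighted_local_average_norm_le:
  assumes q: "0 < q" "q \<le> p" and n: "n \<ge> 1" and M: "\<bar>a\<bar> + \<bar>b\<bar> + 2 / q \<le> M"
    and f: "continuous_on {0..pi} f"
  shows "integral {0..pi} (\<lambda>\<theta>. (endpoint_weight n a b \<theta> * local_average q M n f \<theta>) powr p)
     \<le> 2 powr (p / q) * integral {0..pi} (\<lambda>\<tau>. (endpoint_weight n a b \<tau> * \<bar>f \<tau>\<bar>) powr p)"
proof -
  let ?V = "endpoint_weight n a b" and ?G = "local_average q M n f"
  define F where "F \<tau> = (?V \<tau> * \<bar>f \<tau>\<bar>) powr q" for \<tau>
  define k where "k \<theta> \<tau> = n * (1 + real n * \<bar>\<theta> - \<tau>\<bar>) powr (-2)" for \<theta> \<tau> :: real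
  define s where "s = p / q"
  have s: "s \<ge> 1" using q by (simp add: s_def)
  have V0: "?V \<theta> > 0" if "\<theta> \<in> {0..pi}" for \<theta> by (rule endpoint_weight_pos[OF n that])
  have cF: "continuous_on {0..pi} F"
    unfolding F_def using q V0
    by (intro continuous_on_powr' continuous_on_mult continuous_on_endpoint_weight[OF n] continuous_on_rabs f
        continuous_on_const)
       (auto simp: less_imp_le)
  have ck: "continuous_on A (k \<theta>)" for A \<theta> unfolding k_def
    by (intro continuous_on_mult continuous_on_dist_powr continuous_on_const continuous_on_id)
  have cI: "continuous_on {0..pi} (\<lambda>\<theta>. integral {0..pi} (\<lambda>\<tau>. F \<tau> * k \<theta> \<tau>))"
  proof -
    have "continuous_on ({0..pi} \<times> {0..pi}) (\<lambda>x. F (snd x) * k (fst x) (snd x))"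
      unfolding k_def
      by (intro continuous_on_mult continuous_on_dist_powr continuous_on_const continuous_on_fst continuous_on_snd
           continuous_on_id continuous_on_compose2[OF cF]) auto
    then show ?thesis
      using integral_continuous_on_param[of "{0..pi}" 0 pi "\<lambda>\<theta> \<tau>. F \<tau> * k \<theta> \<tau>"]
      by (simp add: split_beta)
  qed
  have I0: "0 \<le> integral {0..pi} (\<lambda>\<tau>. F \<tau> * k \<theta> \<tau>)" for \<theta>
    by (intro hk_integral_nonneg integrable_continuous_real continuous_on_mult cF ck)
       (simp add: F_def k_def)
  have cfq: "continuous_on {0..pi} (\<lambda>\<tau>. \<bar>f \<tau>\<bar> powr q)"
    using q by (intro continuous_on_powr' continuous_on_rabs continuous_on_const f) auto
  have key: "(?V \<theta> * ?G \<theta>) powr q \<le> integral {0..pi} (\<lambda>\<tau>. F \<tau> * k \<theta> \<tau>)" if \<theta>: "\<theta> \<in> {0..pi}" for \<theta>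
  proof -
    let ?g = "\<lambda>\<tau>. \<bar>f \<tau>\<bar> powr q * (1 + n * \<bar>\<theta> - \<tau>\<bar>) powr (- (M * q))"
    have ig: "?g integrable_on {0..pi}"
      by (intro integrable_continuous_real continuous_on_mult cfq continuous_on_dist_powr continuous_on_const
          continuous_on_id)
    have i0: "integral {0..pi} ?g \<ge> 0" by (intro hk_integral_nonneg ig) auto
    have "(?V \<theta> * ?G \<theta>) powr q = ?V \<theta> powr q * (n * integral {0..pi} ?g)"
      using q i0 by (simp add: powr_mult local_average_def powr_powr)
    also have "\<dots> = integral {0..pi} (\<lambda>\<tau>. ?V \<theta> powr q * n * ?g \<tau>)" by simp
    also have "\<dots> \<le> integral {0..pi} (\<lambda>\<tau>. F \<tau> * k \<theta> \<tau>)"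
    proof (intro integral_le integrable_continuous_real continuous_on_mult cF ck cfq continuous_on_dist_powr
        continuous_on_const continuous_on_id)
      fix \<tau> assume \<tau>: "\<tau> \<in> {0..pi}"
      define D where "D = 1 + n * \<bar>\<theta> - \<tau>\<bar>"
      have D: "D \<ge> 1" by (simp add: D_def)
      have "?V \<theta> powr q \<le> (D powr (\<bar>a\<bar> + \<bar>b\<bar>) * ?V \<tau>) powr q"
        using endpoint_weight_slowly_varying[OF n \<theta> \<tau>] V0[OF \<theta>] q unfolding D_def
        by (intro powr_mono2) auto
      also have "\<dots> = D powr ((\<bar>a\<bar> + \<bar>b\<bar>) * q) * ?V \<tau> powr q"
        by (simp add: powr_mult powr_powr)
      finally have "?V \<theta> powr q * D powr (- (M * q)) \<le> D powr ((\<bar>a\<bar> + \<bar>b\<bar>) * q) * ?V \<tau> powr q * D powr (- (M * q))"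
        by (rule mult_right_mono) simp
      also have "\<dots> = ?V \<tau> powr q * D powr ((\<bar>a\<bar> + \<bar>b\<bar>) * q - M * q)"
        by (simp add: powr_diff powr_minus field_simps)
      also have "\<dots> \<le> ?V \<tau> powr q * D powr (-2)"
      proof (intro mult_left_mono powr_mono)
        have "(\<bar>a\<bar> + \<bar>b\<bar> + 2 / q) * q \<le> M * q" using M q by (intro mult_right_mono) auto
        then show "(\<bar>a\<bar> + \<bar>b\<bar>) * q - M * q \<le> -2" using q by (simp add: distrib_right)
      qed (use D in auto)
      finally have "n * \<bar>f \<tau>\<bar> powr q * (?V \<theta> powr q * D powr (- (M * q))) \<le> n * \<bar>f \<tau>\<bar> powr q * (?V \<tau> powr q
          * D powr (-2))"
        by (rule mult_left_mono) simp
      then show "?V \<theta> powr q * n * ?g \<tau> \<le> F \<tau> * k \<theta> \<tau>"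
        by (simp add: F_def k_def D_def powr_mult mult_ac)
    qed
    finally show ?thesis .
  qed
  have VG: "(?V \<theta> * ?G \<theta>) powr p \<le> (integral {0..pi} (\<lambda>\<tau>. F \<tau> * k \<theta> \<tau>)) powr s" if "\<theta> \<in> {0..pi}" for \<theta>
  proof -
    have "(?V \<theta> * ?G \<theta>) powr p = ((?V \<theta> * ?G \<theta>) powr q) powr s" using q by (simp add: powr_powr s_def)
    also have "\<dots> \<le> (integral {0..pi} (\<lambda>\<tau>. F \<tau> * k \<theta> \<tau>)) powr s"
      using s by (intro powr_mono2 key that) auto
    finally show ?thesis .
  qed
  have "integral {0..pi} (\<lambda>\<theta>. (?V \<theta> * ?G \<theta>) powr p) \<le> integral {0..pi} (\<lambda>\<theta>. (integral {0..pi} (\<lambda>\<tau>. F \<tau>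
      * k \<theta> \<tau>)) powr s)"
  proof (intro integral_le integrable_continuous_real VG)
    show "continuous_on {0..pi} (\<lambda>\<theta>. (?V \<theta> * ?G \<theta>) powr p)"
      using q V0 local_average_nonneg
      by (intro continuous_on_powr' continuous_on_mult continuous_on_endpoint_weight[OF n]
           continuous_on_local_average[OF q(1) f] continuous_on_const) (auto simp: less_imp_le)
    show "continuous_on {0..pi} (\<lambda>\<theta>. (integral {0..pi} (\<lambda>\<tau>. F \<tau> * k \<theta> \<tau>)) powr s)"
      using s I0 by (intro continuous_on_powr' cI continuous_on_const) auto
  qed
  also have "\<dots> \<le> 2 powr s * integral {0..pi} (\<lambda>\<tau>. F \<tau> powr s)"
    unfolding k_def by (rule kernel_operator_Ls_bound[OF s cF]) (simp add: F_def)
  also have "(\<lambda>\<tau>. F \<tau> powr s) = (\<lambda>\<tau>. (?V \<tau> * \<bar>f \<tau>\<bar>) powr p)"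
    using q by (simp add: F_def powr_powr s_def)
  finally show ?thesis by (simp add: s_def)
qed

section \<open>Recovering the norm from displaced inner samples\<close>

lemma local_bound_const_ge_one:
  assumes "q > 0"
  shows "local_bound_const q M \<ge> 1"
proof -
  have "(1 + pi) powr (M * q) \<ge> 1" using assms pi_gt_zero by (intro ge_one_powr_ge_zero) auto
  then have "2 * (real M + 3) * (1 + pi) powr (M * q) \<ge> 1 * 1" by (intro mult_mono) auto
  then have "(2 * (real M + 3) * (1 + pi) powr (M * q)) powr (1 / q) \<ge> 1"
    using assms by (intro ge_one_powr_ge_zero) auto
  then have "(2 * real M + 3) * (2 * (real M + 3) * (1 + pi) powr (M * q)) powr (1 / q) \<ge> 1 * 1"
    by (intro mult_mono) auto
  then show ?thesis by (simp add: local_bound_const_def)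
qed

text \<open>
  A displacement by \<open>inner_margin / n\<close> changes a cosine polynomial by so small a multiple of its
  local average that the error can be absorbed: see the estimate \<open>half\<close> in the proof of
  \<open>local_average_norm_le_inner_samples\<close>.
\<close>
definition inner_margin :: "real \<Rightarrow> nat \<Rightarrow> real" where
  "inner_margin q M = 1 / (2 * 4 powr (1 / q) * ((1 + pi) * (2 + pi) ^ M * local_bound_const q M))"

lemma inner_margin_bounds:
  assumes "q > 0"
  shows "0 < inner_margin q M" "inner_margin q M \<le> 1 / 2"
proof -
  have 1: "(4::real) powr (1 / q) \<ge> 1" using assms by (intro ge_one_powr_ge_zero) auto
  have "1 * (1 * 1) \<le> (1 + pi) * ((2 + pi) ^ M * local_bound_const q M)"
    using local_bound_const_ge_one[OF assms, of M] pi_gt_zero by (intro mult_mono one_le_power) auto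
  then have "2 * 1 * 1 \<le> 2 * 4 powr (1 / q) * ((1 + pi) * (2 + pi) ^ M * local_bound_const q M)"
    using 1 by (intro mult_mono) (auto simp: mult.assoc)
  then have "2 \<le> 2 * 4 powr (1 / q) * ((1 + pi) * (2 + pi) ^ M * local_bound_const q M)" (is "2 \<le> ?D") by simp
  then have "0 < 1 / ?D" "1 / ?D \<le> 1 / 2"
    by (auto simp only: zero_less_divide_1_iff intro!: divide_left_mono)
  then show "0 < inner_margin q M" "inner_margin q M \<le> 1 / 2" by (simp_all only: inner_margin_def)
qed

lemma cos_poly_difference_le:
  fixes Q :: "real poly"
  assumes q: "0 < q" "q \<le> 1" and n: "n \<ge> 1" and Q: "degree Q \<le> n"
    and \<theta>: "\<theta> \<in> {0..pi}" and \<tau>: "\<tau> \<in> {0..pi}" and K: "n * \<bar>\<theta> - \<tau>\<bar> \<le> K"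
  shows "\<bar>poly Q (- cos \<theta>) - poly Q (- cos \<tau>)\<bar>
    \<le> n * \<bar>\<theta> - \<tau>\<bar> * ((1 + K) ^ M * (local_bound_const q M * local_average q M n (\<lambda>\<tau>. poly Q (- cos \<tau>)) \<theta>))"
proof -
  let ?T = "\<lambda>t. poly Q (- cos t)" and ?T' = "\<lambda>t. sin t * poly (pderiv Q) (- cos t)"
  let ?C = "local_bound_const q M" and ?G = "local_average q M n (\<lambda>\<tau>. poly Q (- cos \<tau>))"
  have C: "?C \<ge> 1" by (rule local_bound_const_ge_one[OF q(1)])
  have d: "(?T has_real_derivative ?T' t) (at t within A)" for t A
    by (auto intro!: derivative_eq_intros poly_DERIV[THEN DERIV_chain2] simp: mult.commute)
  have cT: "continuous_on {0..pi} ?T" by (intro continuous_intros)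
  have b: "norm (?T' t) \<le> n * ((1 + K) ^ M * (?C * ?G \<theta>))" if "t \<in> closed_segment \<tau> \<theta>" for t
  proof -
    have t: "t \<in> {0..pi}" "\<bar>t - \<theta>\<bar> \<le> \<bar>\<theta> - \<tau>\<bar>"
      using that \<theta> \<tau> by (auto simp: closed_segment_eq_real_ivl split: if_splits)
    have "\<bar>?T' t\<bar> \<le> n * (?C * ?G t)"
      using local_average_bound(2)[OF q n Q, of t M] t by auto
    also have "n * (?C * ?G t) \<le> n * (?C * ((1 + K) ^ M * ?G \<theta>))"
    proof (intro mult_left_mono)
      have "?G t \<le> (1 + n * \<bar>t - \<theta>\<bar>) ^ M * ?G \<theta>"
      by (rule local_average_slowly_varying[OF q(1) cT])
      also have "\<dots> \<le> (1 + K) ^ M * ?G \<theta>"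
      proof (intro mult_right_mono power_mono local_average_nonneg)
        have "n * \<bar>t - \<theta>\<bar> \<le> n * \<bar>\<theta> - \<tau>\<bar>" using t(2) by (intro mult_left_mono) auto
        then show "1 + n * \<bar>t - \<theta>\<bar> \<le> 1 + K" using K by linarith
      qed auto
      finally show "?G t \<le> (1 + K) ^ M * ?G \<theta>" .
    qed (use C in auto)
    finally show ?thesis by (simp add: mult_ac)
  qed
  have "norm (?T \<theta> - ?T \<tau>) \<le> n * ((1 + K) ^ M * (?C * ?G \<theta>)) * norm (\<theta> - \<tau>)"
    using b by (intro field_differentiable_bound[of "closed_segment \<tau> \<theta>" ?T ?T' _ \<theta> \<tau>] d) auto
  then show ?thesis by (simp add: mult_ac)
qed

lemma continuous_nonneg_nn_integral:
  fixes g :: "real \<Rightarrow> real"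
  assumes "continuous_on {a..b} g" "\<And>x. x \<in> {a..b} \<Longrightarrow> 0 \<le> g x"
  shows "(\<integral>\<^sup>+x\<in>{a..b}. ennreal (g x) \<partial>lborel) = ennreal (integral {a..b} g)"
  using assms by (intro nn_integral_has_integral_lebesgue' integrable_integral integrable_continuous_real)

lemma continuous_ennreal_indicator_measurable:
  fixes g :: "real \<Rightarrow> real"
  assumes "continuous_on {a..b} g"
  shows "(\<lambda>x. ennreal (g x) * indicator {a..b} x) \<in> borel_measurable borel"
proof -
  have [measurable]: "(\<lambda>x. indicator {a..b} x *\<^sub>R g x) \<in> borel_measurable borel"
    by (rule borel_measurable_continuous_on_indicator[OF _ assms]) simp
  have "(\<lambda>x. ennreal (indicator {a..b} x *\<^sub>R g x)) \<in> borel_measurable borel"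
    by measurable
  moreover have "(\<lambda>x. ennreal (indicator {a..b} x *\<^sub>R g x)) = (\<lambda>x. ennreal (g x) * indicator {a..b} x)"
    by (rule ext) (simp add: indicator_def)
  ultimately show ?thesis by simp
qed

lemma powr_add_le:
  fixes x y p :: real
  assumes "x \<ge> 0" "y \<ge> 0" "p > 0"
  shows "(x + y) powr p \<le> 2 powr p * (x powr p + y powr p)"
proof -
  have "(x + y) powr p \<le> (2 * max x y) powr p" using assms by (intro powr_mono2) auto
  also have "\<dots> = 2 powr p * max x y powr p" by (simp add: powr_mult)
  also have "max x y powr p \<le> x powr p + y powr p" by (simp add: max_def)
  finally show ?thesis by (simp add: mult_left_mono)
qed

text \<open>
  Contract \<open>[0, \<pi>]\<close> affinely onto the inner interval and pass from the image of \<open>\<theta>\<close> to the sample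
  point \<open>\<tau>\<close>. Each angle moves by \<open>O(c / n)\<close>, so \<open>T(\<theta>)\<close> differs from the sample by at most a
  multiple of \<open>c\<close> times the local average. Taking norms bounds the norm of the local average by
  that of the samples plus at most half of itself, and this half may be subtracted because the norm
  of a continuous function is finite.
\<close>
lemma local_average_norm_le_inner_samples:
  fixes Q :: "real poly" and F :: "real \<Rightarrow> real"
  assumes q: "0 < q" "q \<le> 1" "q \<le> p" and n: "n \<ge> 1" and Q: "degree Q \<le> n"
    and M: "\<bar>a\<bar> + \<bar>b\<bar> + 2 / q \<le> M"
  defines "c \<equiv> inner_margin q M"
  assumes F: "F \<in> borel_measurable borel"
    and sample: "\<And>\<theta>. \<theta> \<in> {c / n..pi - c / n} \<Longrightarrow> \<exists>\<tau>\<in>{0..pi}. \<bar>\<tau> - \<theta>\<bar> \<le> pi * c / n \<and>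
            endpoint_weight n a b \<theta> * \<bar>poly Q (- cos \<tau>)\<bar> \<le> \<bar>F \<theta>\<bar>"
  shows "ennreal (integral {0..pi} (\<lambda>\<theta>. (endpoint_weight n a b \<theta> * local_average q M n (\<lambda>\<tau>. poly Q (- cos \<tau>))
      \<theta>) powr p))
     \<le> ennreal ((2 powr (3 / q + 1 + M)) powr p) * (\<integral>\<^sup>+\<theta>\<in>{0..pi}. ennreal (\<bar>F \<theta>\<bar> powr p) \<partial>lborel)"
proof -
  let ?V = "endpoint_weight n a b" and ?T = "\<lambda>\<tau>. poly Q (- cos \<tau>)"
  let ?G = "local_average q M n ?T"
  define I where "I = integral {0..pi} (\<lambda>\<theta>. (?V \<theta> * ?G \<theta>) powr p)"
  define J where "J = integral {0..pi} (\<lambda>\<theta>. (?V \<theta> * \<bar>?T \<theta>\<bar>) powr p)"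
  define E where "E = (1 + pi) * (2 + pi) ^ M * local_bound_const q M"
  define \<kappa> where "\<kappa> = 1 - 2 * c / (n * pi)"
  \<comment> \<open>The contraction onto \<open>[c/n, \<pi> - c/n]\<close>, which moves no point by more than \<open>c/n\<close>.\<close>
  define s where "s \<theta> = c / n + \<kappa> * \<theta>" for \<theta>
  have p: "p > 0" using q by simp
  note cb = inner_margin_bounds[OF q(1), of M, folded c_def]
  have C1: "local_bound_const q M \<ge> 1" by (rule local_bound_const_ge_one[OF q(1)])
  have E0: "E > 0" unfolding E_def using C1 pi_gt_zero by (intro mult_pos_pos zero_less_power add_pos_pos) auto
  have cE: "c * E = 1 / (2 * 4 powr (1 / q))"
    using E0 unfolding c_def inner_margin_def E_def[symmetric] by simp
  have V0: "?V \<theta> > 0" if "\<theta> \<in> {0..pi}" for \<theta> by (rule endpoint_weight_pos[OF n that])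
  have cT: "continuous_on {0..pi} ?T" by (intro continuous_intros)
  have np: "real n * pi \<ge> 2" using n pi_ge_two mult_mono[of 1 "real n" 2 pi] by simp
  have \<kappa>: "1 / 2 \<le> \<kappa>"
  proof -
    have "2 * c / (n * pi) \<le> 1 / 2" using cb np by (simp add: field_simps)
    then show ?thesis by (simp add: \<kappa>_def)
  qed
  have cVT: "continuous_on {0..pi} (\<lambda>\<theta>. (?V \<theta> * \<bar>?T \<theta>\<bar>) powr p)"
    using p V0
    by (intro continuous_on_powr' continuous_on_mult continuous_on_endpoint_weight[OF n]
         continuous_on_rabs cT continuous_on_const) (auto simp: less_imp_le)
  have cVG: "continuous_on {0..pi} (\<lambda>\<theta>. (?V \<theta> * ?G \<theta>) powr p)"
    using p V0 local_average_nonneg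
    by (intro continuous_on_powr' continuous_on_mult continuous_on_endpoint_weight[OF n]
         continuous_on_local_average[OF q(1) cT] continuous_on_const) (auto simp: less_imp_le)
  have pointwise: "(?V \<theta> * \<bar>?T \<theta>\<bar>) powr p
      \<le> 2 powr p * (2 powr (M * p) * \<bar>F (s \<theta>)\<bar> powr p + (c * E) powr p * (?V \<theta> * ?G \<theta>) powr p)"
    if \<theta>: "\<theta> \<in> {0..pi}" for \<theta>
  proof -
    have sd: "s \<theta> = \<theta> + c / n * (1 - 2 * \<theta> / pi)"
      using n by (simp add: s_def \<kappa>_def field_simps)
    have "\<bar>1 - 2 * \<theta> / pi\<bar> \<le> 1" using \<theta> by (auto simp: abs_le_iff field_simps)
    then have "c / n * \<bar>1 - 2 * \<theta> / pi\<bar> \<le> c / n * 1" using cb by (intro mult_left_mono) auto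
    moreover have "\<bar>s \<theta> - \<theta>\<bar> = c / n * \<bar>1 - 2 * \<theta> / pi\<bar>" unfolding sd using cb by (simp add: abs_mult)
    ultimately have "\<bar>s \<theta> - \<theta>\<bar> \<le> c / n * 1" by simp
    then have sd2: "\<bar>s \<theta> - \<theta>\<bar> \<le> c / n" by simp
    have "\<kappa> * \<theta> \<le> \<kappa> * pi" "0 \<le> \<kappa> * \<theta>" using \<theta> \<kappa> by (auto intro: mult_left_mono)
    moreover have "\<kappa> * pi = pi - 2 * (c / n)" using n by (simp add: \<kappa>_def field_simps)
    ultimately have sin: "s \<theta> \<in> {c / n..pi - c / n}" by (auto simp: s_def)
    have cn: "0 \<le> c / n" using cb by simp
    have sin': "s \<theta> \<in> {0..pi}" using sin cn by auto
    obtain \<tau> where \<tau>: "\<tau> \<in> {0..pi}" "\<bar>\<tau> - s \<theta>\<bar> \<le> pi * c / n" "?V (s \<theta>) * \<bar>?T \<tau>\<bar> \<le> \<bar>F (s \<theta>)\<bar>"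
      using sample[OF sin] by blast
    have "\<bar>\<theta> - \<tau>\<bar> \<le> c / n + pi * c / n" using sd2 \<tau>(2) by linarith
    also have "\<dots> = (1 + pi) * c / n" by (simp add: distrib_right add_divide_distrib)
    finally have "n * \<bar>\<theta> - \<tau>\<bar> \<le> n * ((1 + pi) * c / n)" by (rule mult_left_mono) simp
    then have d: "n * \<bar>\<theta> - \<tau>\<bar> \<le> (1 + pi) * c" using n by simp
    also have "\<dots> \<le> (1 + pi) * 1" using cb pi_gt_zero by (intro mult_left_mono) auto
    finally have d': "n * \<bar>\<theta> - \<tau>\<bar> \<le> 1 + pi" by simp
    have "\<bar>?T \<theta> - ?T \<tau>\<bar> \<le> n * \<bar>\<theta> - \<tau>\<bar> * ((1 + (1 + pi)) ^ M * (local_bound_const q M * ?G \<theta>))"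
      by (rule cos_poly_difference_le[OF q(1,2) n Q \<theta> \<tau>(1) d'])
    also have "\<dots> \<le> (1 + pi) * c * ((1 + (1 + pi)) ^ M * (local_bound_const q M * ?G \<theta>))"
      using C1 pi_gt_zero local_average_nonneg d by (intro mult_right_mono) auto
    also have "\<dots> = c * E * ?G \<theta>" by (simp add: E_def algebra_simps)
    finally have "\<bar>?T \<theta>\<bar> \<le> \<bar>?T \<tau>\<bar> + c * E * ?G \<theta>" by linarith
    then have "?V \<theta> * \<bar>?T \<theta>\<bar> \<le> ?V \<theta> * (\<bar>?T \<tau>\<bar> + c * E * ?G \<theta>)"
      using V0[OF \<theta>] by (intro mult_left_mono) auto
    also have "\<dots> = ?V \<theta> * \<bar>?T \<tau>\<bar> + c * E * (?V \<theta> * ?G \<theta>)" by (simp add: algebra_simps)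
    finally have 1: "?V \<theta> * \<bar>?T \<theta>\<bar> \<le> ?V \<theta> * \<bar>?T \<tau>\<bar> + c * E * (?V \<theta> * ?G \<theta>)" .
    have "n * \<bar>\<theta> - s \<theta>\<bar> \<le> n * (c / n)" using sd2 by (intro mult_left_mono) auto
    then have "1 + n * \<bar>\<theta> - s \<theta>\<bar> \<le> 2" using n cb by simp
    then have "(1 + n * \<bar>\<theta> - s \<theta>\<bar>) powr (\<bar>a\<bar> + \<bar>b\<bar>) \<le> 2 powr (\<bar>a\<bar> + \<bar>b\<bar>)"
      by (intro powr_mono2) auto
    also have "\<dots> \<le> 2 powr M" using M q by (intro powr_mono) (auto intro: order_trans[rotated])
    finally have "?V \<theta> \<le> 2 powr M * ?V (s \<theta>)"
      using endpoint_weight_slowly_varying[OF n \<theta> sin', of a b] V0[OF sin']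
      by (smt (verit) mult_right_mono)
    then have "?V \<theta> * \<bar>?T \<tau>\<bar> \<le> 2 powr M * ?V (s \<theta>) * \<bar>?T \<tau>\<bar>" by (rule mult_right_mono) simp
    also have "\<dots> \<le> 2 powr M * \<bar>F (s \<theta>)\<bar>" unfolding mult.assoc by (intro mult_left_mono \<tau>(3)) auto
    finally have "?V \<theta> * \<bar>?T \<theta>\<bar> \<le> 2 powr M * \<bar>F (s \<theta>)\<bar> + c * E * (?V \<theta> * ?G \<theta>)" using 1 by linarith
    then have "(?V \<theta> * \<bar>?T \<theta>\<bar>) powr p \<le> (2 powr M * \<bar>F (s \<theta>)\<bar> + c * E * (?V \<theta> * ?G \<theta>)) powr p"
      using p V0[OF \<theta>] by (intro powr_mono2) auto
    also have "\<dots> \<le> 2 powr p * ((2 powr M * \<bar>F (s \<theta>)\<bar>) powr p + (c * E * (?V \<theta> * ?G \<theta>)) powr p)"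
      using p cb E0 V0[OF \<theta>] local_average_nonneg[of q M n ?T \<theta>] by (intro powr_add_le) auto
    also have "\<dots> = 2 powr p * (2 powr (M * p) * \<bar>F (s \<theta>)\<bar> powr p + (c * E) powr p * (?V \<theta> * ?G \<theta>) powr p)"
      by (simp add: powr_mult powr_powr)
    finally show ?thesis .
  qed
  define R where "R = (\<integral>\<^sup>+\<theta>\<in>{0..pi}. ennreal (\<bar>F \<theta>\<bar> powr p) \<partial>lborel)"
  have [measurable]: "F \<in> borel_measurable borel" by (rule F)
  have sm: "s \<in> borel_measurable borel" unfolding s_def[abs_def] by measurable
  have Is: "(\<integral>\<^sup>+\<theta>\<in>{0..pi}. ennreal (\<bar>F (s \<theta>)\<bar> powr p) \<partial>lborel) \<le> ennreal 2 * R"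
  proof -
    let ?h = "\<lambda>x. ennreal (\<bar>F x\<bar> powr p) * indicator {c / n..pi - c / n} x"
    have "(\<integral>\<^sup>+x. ?h x \<partial>lborel) = ennreal \<bar>\<kappa>\<bar> * (\<integral>\<^sup>+x. ?h (c / n + \<kappa> * x) \<partial>lborel)"
      using \<kappa> by (intro nn_integral_real_affine) auto
    also have "(\<integral>\<^sup>+x. ?h (c / n + \<kappa> * x) \<partial>lborel) = (\<integral>\<^sup>+\<theta>\<in>{0..pi}. ennreal (\<bar>F (s \<theta>)\<bar> powr p) \<partial>lborel)"
    proof (intro nn_integral_cong)
      fix x
      have e: "\<kappa> * pi = pi - 2 * (c / n)" using n by (simp add: \<kappa>_def field_simps)
      have "c / n + \<kappa> * x \<le> pi - c / n \<longleftrightarrow> \<kappa> * x \<le> \<kappa> * pi" unfolding e by linarith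
      also have "\<dots> \<longleftrightarrow> x \<le> pi" using \<kappa> by simp
      finally have "c / n + \<kappa> * x \<in> {c / n..pi - c / n} \<longleftrightarrow> x \<in> {0..pi}"
        using \<kappa> by (auto simp: zero_le_mult_iff)
      then show "?h (c / n + \<kappa> * x) = ennreal (\<bar>F (s x)\<bar> powr p) * indicator {0..pi} x"
        by (simp add: s_def indicator_def)
    qed
    finally have 1: "(\<integral>\<^sup>+x. ?h x \<partial>lborel) = ennreal \<kappa> * (\<integral>\<^sup>+\<theta>\<in>{0..pi}. ennreal (\<bar>F (s \<theta>)\<bar> powr p) \<partial>lborel)"
        (is "_ = _ * ?X")
      using \<kappa> by simp
    have "(\<integral>\<^sup>+x. ?h x \<partial>lborel) \<le> R"
    proof -
      have "0 \<le> c / n" using cb by simp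
      then have "{c / n..pi - c / n} \<subseteq> {0..pi}" by auto
      then show ?thesis
        unfolding R_def by (intro nn_integral_mono mult_left_mono) (auto simp: indicator_def)
    qed
    then have "ennreal 2 * (ennreal \<kappa> * ?X) \<le> ennreal 2 * R" unfolding 1 by (rule mult_left_mono) simp
    moreover have "?X \<le> ennreal (2 * \<kappa>) * ?X"
    proof -
      have "ennreal 1 * ?X \<le> ennreal (2 * \<kappa>) * ?X" using \<kappa> by (intro mult_right_mono ennreal_leI) auto
      then show ?thesis by simp
    qed
    moreover have "ennreal (2 * \<kappa>) * ?X = ennreal 2 * (ennreal \<kappa> * ?X)"
      using \<kappa> by (simp add: ennreal_mult mult.assoc)
    ultimately show ?thesis by simp
  qed
  have I0: "I \<ge> 0" "J \<ge> 0" unfolding I_def J_def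
    by (intro hk_integral_nonneg integrable_continuous_real cVG cVT; simp)+
  have J: "ennreal J \<le> ennreal (2 powr p * 2 powr (M * p)) * (ennreal 2 * R) + ennreal (2 powr p * (c
      * E) powr p * I)"
  proof -
    have "ennreal J = (\<integral>\<^sup>+\<theta>\<in>{0..pi}. ennreal ((?V \<theta> * \<bar>?T \<theta>\<bar>) powr p) \<partial>lborel)"
      unfolding J_def by (intro continuous_nonneg_nn_integral[symmetric] cVT) auto
    also have "\<dots> \<le> (\<integral>\<^sup>+\<theta>. ennreal (2 powr p * 2 powr (M * p)) * (ennreal (\<bar>F (s \<theta>)\<bar> powr p) * indicator {0..pi} \<theta>)
        + ennreal (2 powr p * (c * E) powr p * (?V \<theta> * ?G \<theta>) powr p) * indicator {0..pi} \<theta> \<partial>lborel)"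
    proof (intro nn_integral_mono)
      fix \<theta> :: real
      show "ennreal ((?V \<theta> * \<bar>?T \<theta>\<bar>) powr p) * indicator {0..pi} \<theta>
        \<le> ennreal (2 powr p * 2 powr (M * p)) * (ennreal (\<bar>F (s \<theta>)\<bar> powr p) * indicator {0..pi} \<theta>)
        + ennreal (2 powr p * (c * E) powr p * (?V \<theta> * ?G \<theta>) powr p) * indicator {0..pi} \<theta>"
      proof (cases "\<theta> \<in> {0..pi}")
        case True
        then show ?thesis
          using ennreal_leI[OF pointwise[OF True]]
          by (simp add: ennreal_mult[symmetric] ennreal_plus[symmetric] distrib_left mult.assoc del: ennreal_plus)
      qed simp
    qed
    also have "\<dots> = (\<integral>\<^sup>+\<theta>. ennreal (2 powr p * 2 powr (M * p)) * (ennreal (\<bar>F (s \<theta>)\<bar> powr p) * indicator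
        {0..pi} \<theta>) \<partial>lborel)
        + (\<integral>\<^sup>+\<theta>\<in>{0..pi}. ennreal (2 powr p * (c * E) powr p * (?V \<theta> * ?G \<theta>) powr p) \<partial>lborel)"
    proof (rule nn_integral_add)
      note [measurable] = sm
      show "(\<lambda>\<theta>. ennreal (2 powr p * 2 powr (M * p)) * (ennreal (\<bar>F (s \<theta>)\<bar> powr p) * indicator {0..pi} \<theta>)) \<in>
          borel_measurable lborel"
        by measurable
      have "(\<lambda>\<theta>. ennreal (2 powr p * (c * E) powr p * (?V \<theta> * ?G \<theta>) powr p) * indicator {0..pi} \<theta>) \<in>
          borel_measurable borel"
        by (intro continuous_ennreal_indicator_measurable continuous_on_mult continuous_on_const cVG)
      then show "(\<lambda>\<theta>. ennreal (2 powr p * (c * E) powr p * (?V \<theta> * ?G \<theta>) powr p) * indicator {0..pi} \<theta>) \<in>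
          borel_measurable lborel"
        by (simp only: measurable_lborel1 measurable_lborel2)
    qed
    also have "(\<integral>\<^sup>+\<theta>\<in>{0..pi}. ennreal (2 powr p * (c * E) powr p * (?V \<theta> * ?G \<theta>) powr p) \<partial>lborel)
       = ennreal (2 powr p * (c * E) powr p * I)"
      unfolding I_def
      by (subst continuous_nonneg_nn_integral) (auto intro!: continuous_on_mult continuous_on_const cVG)
    also have "(\<integral>\<^sup>+\<theta>. ennreal (2 powr p * 2 powr (M * p)) * (ennreal (\<bar>F (s \<theta>)\<bar> powr p) * indicator {0..pi} \<theta>)
        \<partial>lborel)
       = ennreal (2 powr p * 2 powr (M * p)) * (\<integral>\<^sup>+\<theta>\<in>{0..pi}. ennreal (\<bar>F (s \<theta>)\<bar> powr p) \<partial>lborel)"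
      using sm by (intro nn_integral_cmult) auto
    finally show ?thesis using Is by (meson add_right_mono mult_left_mono order_trans zero_le)
  qed
  have IJ: "I \<le> 2 powr (p / q) * J"
    unfolding I_def J_def by (rule weighted_local_average_norm_le[OF q(1,3) n M cT])
  have half: "2 powr (p / q) * (2 powr p * (c * E) powr p) \<le> 1 / 2"
  proof -
    have "2 powr (p / q) * (2 powr p * (c * E) powr p) = (2 powr (1 / q) * (2 * (c * E))) powr p"
      by (simp add: powr_mult powr_powr)
    also have "2 powr (1 / q) * (2 * (c * E)) = 2 powr (- (1 / q))"
      unfolding cE using powr_mult[of 2 2 "1 / q"] by (simp add: powr_minus field_simps)
    also have "(2 powr (- (1 / q))) powr p = 2 powr (- (p / q))" by (simp add: powr_powr)
    also have "\<dots> \<le> 2 powr (-1)" using q by (intro powr_mono) auto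
    finally show ?thesis by (simp add: powr_minus)
  qed
  show ?thesis
  proof (cases "R = \<infinity>")
    case True
    then show ?thesis by (simp add: R_def[symmetric] ennreal_mult_top)
  next
    case False
    then obtain \<rho> where \<rho>: "R = ennreal \<rho>" "\<rho> \<ge> 0" by (cases R) auto
    define x1 x2 where "x1 = 2 powr p * 2 powr (M * p)" and "x2 = 2 powr p * (c * E) powr p * I"
    have x: "0 \<le> x1" "0 \<le> x2" using I0 by (simp_all add: x1_def x2_def)
    have "ennreal (x1 * (2 * \<rho>) + x2) = ennreal (x1 * (2 * \<rho>)) + ennreal x2"
      using x \<rho> by (intro ennreal_plus) auto
    also have "ennreal (x1 * (2 * \<rho>)) = ennreal x1 * (ennreal 2 * R)"
      using x \<rho> by (simp add: ennreal_mult)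
    finally have "ennreal J \<le> ennreal (x1 * (2 * \<rho>) + x2)"
      using J unfolding x1_def x2_def by simp
    then have "J \<le> x1 * (2 * \<rho>) + x2" using x \<rho> by (subst (asm) ennreal_le_iff) auto
    then have "J \<le> 2 powr p * 2 powr (M * p) * (2 * \<rho>) + 2 powr p * (c * E) powr p * I"
      unfolding x1_def x2_def .
    then have "2 powr (p / q) * J \<le> 2 powr (p / q) * (2 powr p * 2 powr (M * p) * (2 * \<rho>) + 2 powr p * (c
        * E) powr p * I)"
      by (rule mult_left_mono) simp
    also have "\<dots> = 2 powr (p / q) * (2 powr p * 2 powr (M * p) * (2 * \<rho>)) + 2 powr (p / q) * (2 powr p * (c
        * E) powr p) * I"
      by (simp add: distrib_left mult.assoc)
    also have "\<dots> \<le> 2 powr (p / q) * (2 powr p * 2 powr (M * p) * (2 * \<rho>)) + 1 / 2 * I"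
      by (intro add_left_mono mult_right_mono half I0)
    finally have "I \<le> 4 * (2 powr (p / q) * (2 powr p * 2 powr (M * p)) * \<rho>)" using IJ by (simp add: mult_ac)
    also have "\<dots> \<le> 2 powr (2 * (p / q)) * (2 powr (p / q) * (2 powr p * 2 powr (M * p)) * \<rho>)"
    proof (intro mult_right_mono)
      have "1 \<le> p / q" using q by simp
      then have "(2::real) powr 2 \<le> 2 powr (2 * (p / q))" by (intro powr_mono) auto
      then show "4 \<le> (2::real) powr (2 * (p / q))" by simp
    qed (use \<rho> in auto)
    also have "\<dots> = (2 powr (3 / q + 1 + M)) powr p * \<rho>"
      unfolding powr_powr mult.assoc[symmetric] powr_add[symmetric]
      by (simp add: field_simps)
    finally have "ennreal I \<le> ennreal ((2 powr (3 / q + 1 + M)) powr p * \<rho>)" by (rule ennreal_leI)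
    then show ?thesis using \<rho> by (simp add: I_def R_def[symmetric] ennreal_mult)
  qed
qed

section \<open>Weights near an end of the interval\<close>

lemma nn_integral_powr_singularity_le:
  fixes e \<gamma> :: real
  assumes e: "e > -1" and n: "n \<ge> 1" and \<gamma>: "\<gamma> \<ge> 0"
  shows "(\<integral>\<^sup>+\<theta>. ennreal ((n * (\<theta> - \<gamma>)) powr e) * indicator {\<gamma><..1 / real n} \<theta> \<partial>lborel) \<le> ennreal (1 / (n * (e
      + 1)))"
proof -
  let ?h = "\<lambda>\<theta>. ennreal ((n * (\<theta> - \<gamma>)) powr e) * indicator {\<gamma><..1 / real n} \<theta>"
  have "(\<integral>\<^sup>+\<theta>. ?h \<theta> \<partial>lborel) = ennreal \<bar>1 / n\<bar> * (\<integral>\<^sup>+x. ?h (\<gamma> + 1 / n * x) \<partial>lborel)"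
    using n by (intro nn_integral_real_affine) auto
  also have "(\<integral>\<^sup>+x. ?h (\<gamma> + 1 / n * x) \<partial>lborel) \<le> (\<integral>\<^sup>+x. ennreal (x powr e) * indicator {0..1} x \<partial>lborel)"
  proof (intro nn_integral_mono)
    fix x :: real
    have "x \<le> 1" if "\<gamma> + x / n \<le> 1 / n"
    proof -
      have "x / n \<le> 1 / n" using that \<gamma> by linarith
      then show ?thesis using n by (simp add: divide_le_cancel)
    qed
    moreover have "0 < x" if "\<gamma> < \<gamma> + x / n" using that n by (simp add: zero_less_divide_iff)
    ultimately show "?h (\<gamma> + 1 / n * x) \<le> ennreal (x powr e) * indicator {0..1} x"
      using n by (auto simp: indicator_def)
  qed
  also have "(\<integral>\<^sup>+x. ennreal (x powr e) * indicator {0..1} x \<partial>lborel) = ennreal (1 / (e + 1))"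
    using has_integral_powr_from_0[OF e, of 1] by (intro nn_integral_has_integral_lebesgue') auto
  finally have "(\<integral>\<^sup>+\<theta>. ?h \<theta> \<partial>lborel) \<le> ennreal \<bar>1 / n\<bar> * ennreal (1 / (e + 1))"
    by (simp add: mult_left_mono)
  also have "\<dots> = ennreal (1 / (n * (e + 1)))"
    using n e by (simp add: ennreal_mult[symmetric])
  finally show ?thesis .
qed

text \<open>
  On \<open>[0, 1/n]\<close> the function \<open>\<Phi>\<close> varies by the factor \<open>S\<close> only, so \<open>\<Phi> powr p\<close> is there at most
  \<open>S powr p\<close> times its mean, which is at most \<open>n\<close> times the whole integral; and the singular
  factor has integral at most \<open>1 / (n (e p + 1))\<close>.
\<close>
lemma endpoint_singularity_absorbed:
  fixes n :: nat and \<Phi> w :: "real \<Rightarrow> real" and p e \<gamma> K S :: real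
  assumes n: "n \<ge> 1" and p: "p > 0" and e: "e * p > -1" and \<gamma>: "\<gamma> \<ge> 0" and K: "K \<ge> 0" and S: "S \<ge> 0"
    and c: "continuous_on {0..pi} \<Phi>" and \<Phi>0: "\<And>\<theta>. \<theta> \<in> {0..pi} \<Longrightarrow> 0 \<le> \<Phi> \<theta>"
    and slow: "\<And>\<theta> \<tau>. \<theta> \<in> {0..1 / n} \<Longrightarrow> \<tau> \<in> {0..1 / n} \<Longrightarrow> \<Phi> \<theta> \<le> S * \<Phi> \<tau>"
    and w: "\<And>\<theta>. \<theta> \<in> {0..pi / 2} \<Longrightarrow> 0 \<le> w \<theta>"
    and bound: "\<And>\<theta>. \<theta> \<in> {0..pi / 2} \<Longrightarrow> w \<theta> \<le> K * \<Phi> \<theta> \<or>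
        (\<gamma> < \<theta> \<and> \<theta> \<le> 1 / n \<and> w \<theta> \<le> K * ((n * (\<theta> - \<gamma>)) powr e * \<Phi> \<theta>))"
  shows "(\<integral>\<^sup>+\<theta>\<in>{0..pi / 2}. ennreal (w \<theta> powr p) \<partial>lborel)
     \<le> ennreal (K powr p * (1 + S powr p / (e * p + 1)) * integral {0..pi} (\<lambda>\<theta>. \<Phi> \<theta> powr p))"
proof -
  define I where "I = integral {0..pi} (\<lambda>\<theta>. \<Phi> \<theta> powr p)"
  have cp: "continuous_on {0..pi} (\<lambda>\<theta>. \<Phi> \<theta> powr p)"
    using p \<Phi>0 by (intro continuous_on_powr' c continuous_on_const) auto
  have I0: "I \<ge> 0" unfolding I_def
    by (intro hk_integral_nonneg integrable_continuous_real cp) auto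
  have n1: "1 / real n \<le> pi"
  proof -
    have "1 / real n \<le> 1" using n by simp
    then show ?thesis using pi_ge_two by linarith
  qed
  have sup: "\<Phi> \<theta> powr p \<le> S powr p * (n * I)" if \<theta>: "\<theta> \<in> {0..1 / n}" for \<theta>
  proof -
    have "integral {0..1 / n} (\<lambda>\<tau>. \<Phi> \<theta> powr p) \<le> integral {0..1 / n} (\<lambda>\<tau>. S powr p * \<Phi> \<tau> powr p)"
    proof (intro integral_le integrable_continuous_real continuous_on_mult continuous_on_const)
      show "continuous_on {0..1 / n} (\<lambda>\<tau>. \<Phi> \<tau> powr p)"
        by (rule continuous_on_subset[OF cp]) (use n1 in auto)
      fix \<tau> assume \<tau>: "\<tau> \<in> {0..1 / real n}"
      have "\<Phi> \<theta> powr p \<le> (S * \<Phi> \<tau>) powr p"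
        using p slow[OF \<theta> \<tau>] \<Phi>0[of \<theta>] \<theta> n1 by (intro powr_mono2) auto
      then show "\<Phi> \<theta> powr p \<le> S powr p * \<Phi> \<tau> powr p" by (simp add: powr_mult)
    qed
    also have "\<dots> = S powr p * integral {0..1 / n} (\<lambda>\<tau>. \<Phi> \<tau> powr p)" by simp
    also have "\<dots> \<le> S powr p * I"
      unfolding I_def
      by (intro mult_left_mono integral_subset_le integrable_continuous_real cp continuous_on_subset[OF cp])
         (use n1 in auto)
    finally have "1 / n * \<Phi> \<theta> powr p \<le> S powr p * I" using n by simp
    then have "n * (1 / n * \<Phi> \<theta> powr p) \<le> n * (S powr p * I)" by (rule mult_left_mono) simp
    then show ?thesis using n by (simp add: mult_ac)
  qed
  define A where "A \<theta> = ennreal (K powr p) * (ennreal (\<Phi> \<theta> powr p) * indicator {0..pi} \<theta>)" for \<theta>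
  define B where "B \<theta> = ennreal (K powr p * (S powr p * (n * I))) * (ennreal ((n * (\<theta> - \<gamma>)) powr (e * p))
      * indicator {\<gamma><..1 / real n} \<theta>)" for \<theta>
  have mA: "(\<lambda>\<theta>. ennreal (\<Phi> \<theta> powr p) * indicator {0..pi} \<theta>) \<in> borel_measurable lborel"
    using continuous_ennreal_indicator_measurable[OF cp] by (simp only: measurable_lborel1 measurable_lborel2)
  have "(\<integral>\<^sup>+\<theta>\<in>{0..pi / 2}. ennreal (w \<theta> powr p) \<partial>lborel) \<le> (\<integral>\<^sup>+\<theta>. A \<theta> + B \<theta> \<partial>lborel)"
  proof (intro nn_integral_mono)
    fix \<theta> :: real
    show "ennreal (w \<theta> powr p) * indicator {0..pi / 2} \<theta> \<le> A \<theta> + B \<theta>"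
    proof (cases "\<theta> \<in> {0..pi / 2}")
      case True
      then have th: "\<theta> \<in> {0..pi}" using pi_gt_zero by auto
      show ?thesis
        using bound[OF True]
      proof (elim disjE conjE)
        assume "w \<theta> \<le> K * \<Phi> \<theta>"
        then have "w \<theta> powr p \<le> K powr p * \<Phi> \<theta> powr p"
          using powr_mono2[of p "w \<theta>" "K * \<Phi> \<theta>"] p w[OF True] by (simp add: powr_mult)
        then have "ennreal (w \<theta> powr p) \<le> A \<theta>"
          unfolding A_def using th by (simp add: ennreal_mult[symmetric] ennreal_leI)
        then show ?thesis using True by (simp add: add_increasing2)
      next
        assume g: "\<gamma> < \<theta>" "\<theta> \<le> 1 / n" and "w \<theta> \<le> K * ((n * (\<theta> - \<gamma>)) powr e * \<Phi> \<theta>)"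
        then have "w \<theta> powr p \<le> (K * ((n * (\<theta> - \<gamma>)) powr e * \<Phi> \<theta>)) powr p"
          using p w[OF True] by (intro powr_mono2) auto
        also have "\<dots> = K powr p * ((n * (\<theta> - \<gamma>)) powr (e * p) * \<Phi> \<theta> powr p)"
          by (simp add: powr_mult powr_powr)
        also have "\<dots> \<le> K powr p * ((n * (\<theta> - \<gamma>)) powr (e * p) * (S powr p * (n * I)))"
          using sup[of \<theta>] g True by (intro mult_left_mono) auto
        also have "\<dots> = K powr p * (S powr p * (n * I)) * (n * (\<theta> - \<gamma>)) powr (e * p)" by (simp add: mult_ac)
        finally have "ennreal (w \<theta> powr p) \<le> B \<theta>"
          unfolding B_def using g I0 by (simp add: ennreal_mult[symmetric] ennreal_leI)
        then show ?thesis using True by (simp add: add_increasing)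
      qed
    qed simp
  qed
  also have "\<dots> = (\<integral>\<^sup>+\<theta>. A \<theta> \<partial>lborel) + (\<integral>\<^sup>+\<theta>. B \<theta> \<partial>lborel)"
  proof (rule nn_integral_add)
    show "A \<in> borel_measurable lborel" unfolding A_def[abs_def]
        by (rule borel_measurable_times_ennreal[OF borel_measurable_const mA])
    show "B \<in> borel_measurable lborel" unfolding B_def[abs_def] by measurable
  qed
  also have "\<dots> \<le> ennreal (K powr p * I) + ennreal (K powr p * (S powr p / (e * p + 1)) * I)"
  proof (rule add_mono)
    have "(\<integral>\<^sup>+\<theta>. A \<theta> \<partial>lborel) = ennreal (K powr p) * ennreal I"
      unfolding A_def I_def
      by (subst nn_integral_cmult[OF mA]) (use continuous_nonneg_nn_integral[OF cp] in auto)
    then show "(\<integral>\<^sup>+\<theta>. A \<theta> \<partial>lborel) \<le> ennreal (K powr p * I)" using I0 by (simp add: ennreal_mult)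
    have "(\<integral>\<^sup>+\<theta>. B \<theta> \<partial>lborel) = ennreal (K powr p * (S powr p * (n * I))) *
        (\<integral>\<^sup>+\<theta>. ennreal ((n * (\<theta> - \<gamma>)) powr (e * p)) * indicator {\<gamma><..1 / real n} \<theta> \<partial>lborel)"
      unfolding B_def by (rule nn_integral_cmult) measurable
    also have "\<dots> \<le> ennreal (K powr p * (S powr p * (n * I))) * ennreal (1 / (n * (e * p + 1)))"
      by (intro mult_left_mono nn_integral_powr_singularity_le[OF e n \<gamma>]) auto
    also have "\<dots> = ennreal (K powr p * (S powr p / (e * p + 1)) * I)"
      using I0 n e by (simp add: ennreal_mult[symmetric])
    finally show "(\<integral>\<^sup>+\<theta>. B \<theta> \<partial>lborel) \<le> ennreal (K powr p * (S powr p / (e * p + 1)) * I)" .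
  qed
  also have "\<dots> = ennreal (K powr p * (1 + S powr p / (e * p + 1)) * I)"
    using I0 e by (subst ennreal_plus[symmetric]) (auto simp: algebra_simps)
  finally show ?thesis unfolding I_def .
qed

text \<open>
  The angle \<open>\<gamma>\<close>, with \<open>tan (\<gamma> / 2) = \<delta> / 2\<close>, is the one at which the base of the shifted weight
  vanishes.
\<close>
lemma endpoint_base_factorization:
  fixes \<delta> \<theta> :: real
  defines "\<gamma> \<equiv> 2 * arctan (\<delta> / 2)"
  shows "1 - cos \<theta> - \<delta> * sin \<theta> / 2 = 2 * sin (\<theta> / 2) * (sin ((\<theta> - \<gamma>) / 2) / cos (\<gamma> / 2))"
proof -
  have c: "cos (\<gamma> / 2) > 0" by (simp add: \<gamma>_def cos_arctan add_pos_nonneg)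
  have "sin (\<gamma> / 2) = \<delta> / 2 * cos (\<gamma> / 2)"
    by (simp add: \<gamma>_def sin_arctan cos_arctan)
  moreover have "sin ((\<theta> - \<gamma>) / 2) = sin (\<theta> / 2) * cos (\<gamma> / 2) - cos (\<theta> / 2) * sin (\<gamma> / 2)"
    by (simp add: diff_divide_distrib sin_diff)
  ultimately have "sin ((\<theta> - \<gamma>) / 2) = cos (\<gamma> / 2) * (sin (\<theta> / 2) - \<delta> / 2 * cos (\<theta> / 2))"
    by (simp add: right_diff_distrib)
  then have e1: "sin ((\<theta> - \<gamma>) / 2) / cos (\<gamma> / 2) = sin (\<theta> / 2) - \<delta> / 2 * cos (\<theta> / 2)"
    using c by simp
  have e2: "1 - cos \<theta> = 2 * sin (\<theta> / 2) ^ 2"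
    using cos_double_sin[of "\<theta> / 2"] by simp
  have e3: "sin \<theta> = 2 * sin (\<theta> / 2) * cos (\<theta> / 2)"
    using sin_double[of "\<theta> / 2"] by simp
  show ?thesis unfolding e1 e2 by (subst e3) (simp add: power2_eq_square algebra_simps)
qed

lemma sin_half_le: "0 \<le> \<theta> \<Longrightarrow> sin (\<theta> / 2) \<le> \<theta> / 2" for \<theta> :: real
  by (rule sin_x_le_x) simp

text \<open>
  Here the base may be replaced by its upper bound \<open>2 (sin (\<theta> / 2))\<^sup>2\<close>, with which it agrees if
  \<open>\<delta> = 0\<close>.
\<close>
lemma near_endpoint_regular:
  fixes e \<kappa> \<delta> \<theta> :: real
  assumes n: "n \<ge> 1" and \<theta>: "0 < \<theta>" "\<theta> \<le> pi / 2" and \<delta>: "0 \<le> \<delta>"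
    and B: "0 \<le> 1 - cos \<theta> - \<delta> * sin \<theta> / 2"
    and e: "e \<ge> 0 \<or> \<delta> = 0" and a: "2 * e + \<kappa> \<ge> 0" and \<kappa>: "\<kappa> \<ge> 0"
  shows "(1 - cos \<theta> - \<delta> * sin \<theta> / 2) powr e * sin \<theta> powr \<kappa>
     \<le> 2 powr (\<bar>e\<bar> + \<kappa>) * (sin (\<theta> / 2) + 1 / real n) powr (2 * e + \<kappa>)"
proof -
  define s where "s = sin (\<theta> / 2)"
  have s: "s > 0" unfolding s_def using \<theta> pi_gt_zero by (intro sin_gt_zero) linarith+
  have sin0: "sin \<theta> \<ge> 0" using \<theta> pi_gt_zero by (intro sin_ge_zero) linarith+
  have 1: "1 - cos \<theta> = 2 * s\<^sup>2"
    using cos_double_sin[of "\<theta> / 2"] by (simp add: s_def)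
  have "sin \<theta> = 2 * s * cos (\<theta> / 2)"
    using sin_double[of "\<theta> / 2"] by (simp add: s_def)
  also have "\<dots> \<le> 2 * s * 1" using s by (intro mult_left_mono) auto
  finally have 2: "sin \<theta> \<le> 2 * s" by simp
  have "(1 - cos \<theta> - \<delta> * sin \<theta> / 2) powr e \<le> (2 * s\<^sup>2) powr e"
  proof (cases "e \<ge> 0")
    case True
    have "1 - cos \<theta> - \<delta> * sin \<theta> / 2 \<le> 2 * s\<^sup>2" using 1 \<delta> sin0 by simp
    then show ?thesis using True B by (intro powr_mono2) auto
  qed (use e 1 in auto)
  also have "\<dots> = 2 powr e * s powr (2 * e)"
    using s by (simp add: powr_mult powr_powr flip: powr_numeral)
  also have "\<dots> \<le> 2 powr \<bar>e\<bar> * s powr (2 * e)" by (intro mult_right_mono powr_mono) auto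
  finally have "(1 - cos \<theta> - \<delta> * sin \<theta> / 2) powr e \<le> 2 powr \<bar>e\<bar> * s powr (2 * e)" .
  moreover have "sin \<theta> powr \<kappa> \<le> (2 * s) powr \<kappa>" using 2 sin0 \<kappa> by (intro powr_mono2) auto
  ultimately have "(1 - cos \<theta> - \<delta> * sin \<theta> / 2) powr e * sin \<theta> powr \<kappa> \<le> (2 powr \<bar>e\<bar> * s powr (2 * e)) * (2
      * s) powr \<kappa>"
    by (intro mult_mono) auto
  also have "\<dots> = 2 powr (\<bar>e\<bar> + \<kappa>) * s powr (2 * e + \<kappa>)"
    by (simp add: powr_mult powr_add)
  also have "\<dots> \<le> 2 powr (\<bar>e\<bar> + \<kappa>) * (s + 1 / real n) powr (2 * e + \<kappa>)"
    using s a by (intro mult_left_mono powr_mono2) auto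
  finally show ?thesis by (simp add: s_def)
qed

text \<open>
  For a negative exponent a lower bound of the base is needed: it is at least
  \<open>2 sin (\<theta> / 2) (\<theta> - \<gamma>) / \<pi>\<close>. Beyond \<open>1 / n\<close> one has \<open>\<gamma> \<le> \<theta> / 2\<close>, and the shift is invisible; closer to
  the end the factor \<open>(n (\<theta> - \<gamma>)) powr e\<close> remains.
\<close>
lemma near_endpoint_singular:
  fixes e \<kappa> \<delta> \<theta> :: real
  assumes n: "n \<ge> 1" and \<theta>: "0 < \<theta>" "\<theta> \<le> pi / 2" and \<delta>: "0 \<le> \<delta>" "\<delta> \<le> 1 / (2 * real n)"
    and B: "0 \<le> 1 - cos \<theta> - \<delta> * sin \<theta> / 2"
    and e: "e < 0" and \<kappa>: "e + \<kappa> \<ge> 0"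
  defines "\<gamma> \<equiv> 2 * arctan (\<delta> / 2)"
  defines "w \<equiv> (1 - cos \<theta> - \<delta> * sin \<theta> / 2) powr e * sin \<theta> powr \<kappa>"
    and "v \<equiv> (sin (\<theta> / 2) + 1 / real n) powr (2 * e + \<kappa>)"
    and "K \<equiv> 5 powr (\<bar>e\<bar> + \<kappa> + \<bar>2 * e + \<kappa>\<bar>)"
  shows "w \<le> K * v \<or> (\<gamma> < \<theta> \<and> \<theta> \<le> 1 / real n \<and> w \<le> K * ((n * (\<theta> - \<gamma>)) powr e * v))"
proof -
  define s where "s = sin (\<theta> / 2)"
  define B' where "B' = 1 - cos \<theta> - \<delta> * sin \<theta> / 2"
  have k0: "\<kappa> > 0" using e \<kappa> by simp
  have s: "s > 0" unfolding s_def using \<theta> pi_gt_zero by (intro sin_gt_zero) linarith+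
  have s1: "s \<le> \<theta> / 2" unfolding s_def using \<theta> by (intro sin_half_le) auto
  have s2: "\<theta> / pi \<le> s" unfolding s_def using \<theta> pi_gt_zero by (intro sin_half_ge) linarith+
  have sin0: "sin \<theta> \<ge> 0" using \<theta> pi_gt_zero by (intro sin_ge_zero) linarith+
  have "sin \<theta> = 2 * s * cos (\<theta> / 2)"
    using sin_double[of "\<theta> / 2"] by (simp add: s_def)
  also have "\<dots> \<le> 2 * s * 1" using s by (intro mult_left_mono) auto
  finally have sin2: "sin \<theta> \<le> 2 * s" by simp
  have \<gamma>0: "\<gamma> \<ge> 0" using \<delta> by (simp add: \<gamma>_def)
  have \<gamma>1: "\<gamma> \<le> \<delta>" using arctan_le_self[of "\<delta> / 2"] \<delta> by (simp add: \<gamma>_def)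
  have cg: "0 < cos (\<gamma> / 2)" "cos (\<gamma> / 2) \<le> 1" by (simp_all add: \<gamma>_def cos_arctan add_pos_nonneg)
  have fact: "B' = 2 * s * (sin ((\<theta> - \<gamma>) / 2) / cos (\<gamma> / 2))"
    unfolding B'_def \<gamma>_def s_def by (rule endpoint_base_factorization)
  have v0: "v \<ge> 0" by (simp add: v_def)
  show ?thesis
  proof (cases "\<theta> \<le> \<gamma>")
    case True
    have "sin ((\<gamma> - \<theta>) / 2) \<ge> 0" using True \<gamma>1 \<delta> \<theta> arctan_ubound[of "\<delta> / 2"]
      by (intro sin_ge_zero) (auto simp: \<gamma>_def)
    then have "sin ((\<theta> - \<gamma>) / 2) \<le> 0" using sin_minus[of "(\<gamma> - \<theta>) / 2"] by (simp add: minus_divide_left)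
    then have "B' \<le> 0" unfolding fact using s cg by (intro mult_nonneg_nonpos divide_nonpos_pos) auto
    then have "B' = 0" using B by (simp add: B'_def)
    then have "w = 0" by (simp add: w_def B'_def)
    then show ?thesis using v0 by (simp add: K_def)
  next
    case False
    have h: "(\<theta> - \<gamma>) / pi \<le> sin ((\<theta> - \<gamma>) / 2)" using False \<theta> \<gamma>0 pi_gt_zero by (intro sin_half_ge) linarith+
    have h0: "0 < (\<theta> - \<gamma>) / pi" using False by simp
    have "sin ((\<theta> - \<gamma>) / 2) / cos (\<gamma> / 2) \<ge> sin ((\<theta> - \<gamma>) / 2) / 1"
      using h h0 cg by (intro divide_left_mono) auto
    then have "B' \<ge> 2 * s * ((\<theta> - \<gamma>) / pi)" unfolding fact using s h by (intro mult_left_mono) auto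
    then have Be: "B' powr e \<le> (2 * s * ((\<theta> - \<gamma>) / pi)) powr e"
      by (rule powr_mono2'[OF less_imp_le[OF e] mult_pos_pos[OF mult_pos_pos[OF zero_less_numeral s] h0]])
    have w1: "w \<le> (2 * s * ((\<theta> - \<gamma>) / pi)) powr e * sin \<theta> powr \<kappa>"
      unfolding w_def B'_def[symmetric] using Be by (rule mult_right_mono) simp
    show ?thesis
    proof (cases "\<theta> \<ge> 1 / n")
      case True
      have "\<gamma> \<le> \<theta> / 2" using \<gamma>1 \<delta>(2) True by (simp add: field_simps)
      then have "s \<le> \<theta> - \<gamma>" using s1 by linarith
      then have "2 * s * (s / pi) \<le> 2 * s * ((\<theta> - \<gamma>) / pi)"
        using s by (intro mult_left_mono divide_right_mono) auto
      then have "(2 * s * ((\<theta> - \<gamma>) / pi)) powr e \<le> (2 * s * (s / pi)) powr e"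
        using e s by (intro powr_mono2') auto
      also have "2 * s * (s / pi) = (2 / pi) * s powr 2" using s by (simp add: power2_eq_square)
      also have "((2 / pi) * s powr 2) powr e = (2 / pi) powr e * s powr (2 * e)"
          by (simp only: powr_mult powr_powr)
      finally have "w \<le> ((2 / pi) powr e * s powr (2 * e)) * (2 * s) powr \<kappa>"
        using w1 sin2 sin0 k0
        by (meson mult_mono order_trans powr_ge_zero powr_mono2 less_imp_le mult_nonneg_nonneg)
      also have "\<dots> = ((2 / pi) powr e * 2 powr \<kappa>) * s powr (2 * e + \<kappa>)"
        by (simp add: powr_mult powr_add)
      also have "\<dots> \<le> (5 powr \<bar>e\<bar> * 5 powr \<kappa>) * (5 powr \<bar>2 * e + \<kappa>\<bar> * (s + 1 / real n) powr (2 * e + \<kappa>))"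
      proof (intro mult_mono)
        have "(2 / pi) powr e = (pi / 2) powr \<bar>e\<bar>"
          using e by (simp add: powr_divide powr_minus abs_if)
        also have "\<dots> \<le> 5 powr \<bar>e\<bar>" using pi_less_4 by (intro powr_mono2) auto
        finally show "(2 / pi) powr e \<le> 5 powr \<bar>e\<bar>" .
        show "(2::real) powr \<kappa> \<le> 5 powr \<kappa>" using k0 by (intro powr_mono2) auto
        have "1 / n \<le> pi * s"
        proof -
          have "1 / n \<le> pi * (\<theta> / pi)" using True by simp
          also have "\<dots> \<le> pi * s" using s2 by (intro mult_left_mono) auto
          finally show ?thesis .
        qed
        also have "\<dots> \<le> 4 * s" using pi_less_4 s by (intro mult_right_mono) auto
        finally show "s powr (2 * e + \<kappa>) \<le> 5 powr \<bar>2 * e + \<kappa>\<bar> * (s + 1 / real n) powr (2 * e + \<kappa>)"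
          using s n by (intro powr_le_of_comparable) (auto simp: add_pos_nonneg)
      qed auto
      also have "\<dots> = K * v" by (simp add: K_def v_def s_def powr_add)
      finally show ?thesis by simp
    next
      case small: False
      have "(2 * s * ((\<theta> - \<gamma>) / pi)) powr e \<le> (2 * (\<theta> / pi) * ((\<theta> - \<gamma>) / pi)) powr e"
      proof (rule powr_mono2'[OF less_imp_le[OF e]])
        show "0 < 2 * (\<theta> / pi) * ((\<theta> - \<gamma>) / pi)" using \<theta> by (intro mult_pos_pos h0) auto
        show "2 * (\<theta> / pi) * ((\<theta> - \<gamma>) / pi) \<le> 2 * s * ((\<theta> - \<gamma>) / pi)"
          using s2 h0 by (intro mult_right_mono mult_left_mono) auto
      qed
      also have "2 * (\<theta> / pi) * ((\<theta> - \<gamma>) / pi) = (2 / pi\<^sup>2) * (\<theta> * (\<theta> - \<gamma>))" by (simp add: power2_eq_square)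
      also have "((2 / pi\<^sup>2) * (\<theta> * (\<theta> - \<gamma>))) powr e = (2 / pi\<^sup>2) powr e * (\<theta> powr e * (\<theta> - \<gamma>) powr e)"
        by (simp only: powr_mult)
      finally have "w \<le> ((2 / pi\<^sup>2) powr e * (\<theta> powr e * (\<theta> - \<gamma>) powr e)) * \<theta> powr \<kappa>"
      proof -
        assume a: "(2 * s * ((\<theta> - \<gamma>) / pi)) powr e \<le> (2 / pi\<^sup>2) powr e * (\<theta> powr e * (\<theta> - \<gamma>) powr e)"
        have "sin \<theta> powr \<kappa> \<le> \<theta> powr \<kappa>" using sin0 k0 \<theta> by (intro powr_mono2 sin_x_le_x) auto
        with a w1 show ?thesis by (meson mult_mono order_trans powr_ge_zero mult_nonneg_nonneg)
      qed
      also have "\<dots> = (2 / pi\<^sup>2) powr e * ((\<theta> - \<gamma>) powr e * \<theta> powr (e + \<kappa>))" by (simp add: powr_add)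
      also have "\<dots> \<le> 5 powr \<bar>e\<bar> * ((\<theta> - \<gamma>) powr e * (1 / n) powr (e + \<kappa>))"
      proof (intro mult_mono mult_left_mono)
        have "pi\<^sup>2 \<le> 3.15\<^sup>2" using pi_approx by (intro power_mono) auto
        then have p2: "pi\<^sup>2 / 2 \<le> 5" by (simp add: power2_eq_square)
        have "(2 / pi\<^sup>2) powr e = (pi\<^sup>2 / 2) powr \<bar>e\<bar>"
          using e by (simp add: powr_divide powr_minus abs_if)
        also have "\<dots> \<le> 5 powr \<bar>e\<bar>" using p2 by (intro powr_mono2) auto
        finally show "(2 / pi\<^sup>2) powr e \<le> 5 powr \<bar>e\<bar>" .
        show "\<theta> powr (e + \<kappa>) \<le> (1 / n) powr (e + \<kappa>)" using small \<theta> \<kappa> by (intro powr_mono2) auto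
      qed auto
      also have "(\<theta> - \<gamma>) powr e * (1 / n) powr (e + \<kappa>) = (n * (\<theta> - \<gamma>)) powr e * (1 / n) powr (2 * e + \<kappa>)"
      proof -
        have "(1 / real n) powr (2 * e + \<kappa>) = (1 / n) powr e * (1 / n) powr (e + \<kappa>)"
          by (simp only: powr_add[symmetric]) (simp add: algebra_simps)
        moreover have "real n powr e * (1 / n) powr e = 1"
          using n by (simp only: powr_mult[symmetric]) simp
        moreover have "(n * (\<theta> - \<gamma>)) powr e * ((1 / n) powr e * (1 / n) powr (e + \<kappa>))
            = (real n powr e * (1 / n) powr e) * ((\<theta> - \<gamma>) powr e * (1 / n) powr (e + \<kappa>))"
          by (simp only: powr_mult mult_ac)
        ultimately have "(n * (\<theta> - \<gamma>)) powr e * (1 / n) powr (2 * e + \<kappa>)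
            = 1 * ((\<theta> - \<gamma>) powr e * (1 / n) powr (e + \<kappa>))" by (simp only:)
        then show ?thesis by simp
      qed
      also have "5 powr \<bar>e\<bar> * ((n * (\<theta> - \<gamma>)) powr e * (1 / n) powr (2 * e + \<kappa>))
        \<le> (5 powr \<bar>e\<bar> * 5 powr \<kappa>) * ((n * (\<theta> - \<gamma>)) powr e * (5 powr \<bar>2 * e + \<kappa>\<bar> * (s + 1 / real n) powr (2 * e
            + \<kappa>)))"
      proof (intro mult_mono mult_left_mono)
        have "(1::real) \<le> 5 powr \<kappa>" using k0 by (intro ge_one_powr_ge_zero) auto
        then show "(5::real) powr \<bar>e\<bar> \<le> 5 powr \<bar>e\<bar> * 5 powr \<kappa>" by simp
        have "s \<le> 4 * (1 / n)" using small s1 \<theta> by linarith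
        then show "(1 / n) powr (2 * e + \<kappa>) \<le> 5 powr \<bar>2 * e + \<kappa>\<bar> * (s + 1 / real n) powr (2 * e + \<kappa>)"
          using s n by (intro powr_le_of_comparable) (auto simp: add_pos_nonneg)
      qed auto
      also have "\<dots> = K * ((n * (\<theta> - \<gamma>)) powr e * v)" by (simp add: K_def v_def s_def powr_add)
      finally show ?thesis using False small by simp
    qed
  qed
qed

text \<open>
  The two ways in which a weight with exponent \<open>e\<close> at an end, and angular exponent \<open>a\<close>, is
  controlled: it is bounded by the endpoint weight, or its singularity is integrable. In both
  cases \<open>L\<close> bounds the constant \<open>1 + 1 / (e' p + 1)\<close> of \<open>endpoint_singularity_absorbed\<close>, where
  \<open>e'\<close> is the exponent that is left after division by the endpoint weight; it is \<open>0\<close> in the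
  first case.
\<close>
definition endpoint_admissible :: "real \<Rightarrow> real \<Rightarrow> real \<Rightarrow> real \<Rightarrow> real \<Rightarrow> bool" where
  "endpoint_admissible p \<delta> e a L \<longleftrightarrow>
     ((e \<ge> 0 \<or> \<delta> = 0) \<and> a \<ge> 0 \<and> 2 \<le> L) \<or> (e < 0 \<and> - (1 / p) < e \<and> 1 + 1 / (e * p + 1) \<le> L)"

definition singular_exponent :: "real \<Rightarrow> real \<Rightarrow> real \<Rightarrow> real" where
  "singular_exponent \<delta> e a = (if (e \<ge> 0 \<or> \<delta> = 0) \<and> a \<ge> 0 then 0 else e)"

lemma singular_exponent_bounds:
  assumes p: "p > 0" and ad: "endpoint_admissible p \<delta> e a L"
  shows "singular_exponent \<delta> e a * p > -1" "1 + 1 / (singular_exponent \<delta> e a * p + 1) \<le> L"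
proof -
  have sing: "-1 < e * p \<and> 2 \<le> L" if e: "e < 0" "- (1 / p) < e" "1 + 1 / (e * p + 1) \<le> L"
  proof -
    have 1: "-1 < e * p" using e(2) p by (simp add: field_simps)
    have "e * p < 0" using e(1) p by (rule mult_neg_pos)
    then have "1 / 1 \<le> 1 / (e * p + 1)" using 1 by (intro divide_left_mono) auto
    then have "2 \<le> L" using e(3) by linarith
    then show ?thesis using 1 by simp
  qed
  show "singular_exponent \<delta> e a * p > -1" "1 + 1 / (singular_exponent \<delta> e a * p + 1) \<le> L"
    using ad sing by (auto simp: endpoint_admissible_def singular_exponent_def)
qed

lemma phi_minus_cos: "\<theta> \<in> {0..pi} \<Longrightarrow> phi (- cos \<theta>) = sin \<theta>"
  using sin_ge_zero[of \<theta>] sin_cos_squared_add[of \<theta>] unfolding phi_def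
  by (auto intro!: real_sqrt_unique simp: algebra_simps)

text \<open>
  On the left half of the interval the base that belongs to the right end lies between \<open>1 / 2\<close> and
  \<open>2\<close>, so only the left base matters.
\<close>
lemma shifted_weight_near_left_end:
  fixes e e' \<kappa> \<delta> \<theta> a b p L :: real
  assumes n: "n \<ge> 1" and \<theta>: "0 < \<theta>" "\<theta> \<le> pi / 2" and \<delta>: "0 \<le> \<delta>" "\<delta> \<le> 1 / (2 * real n)"
    and B: "\<delta> * sin \<theta> / 2 \<le> 1 - cos \<theta>"
    and \<kappa>: "1 / p \<le> \<kappa>" "0 < p" and a: "a = 2 * e + \<kappa>"
    and adm: "endpoint_admissible p \<delta> e a L"
  defines "\<gamma> \<equiv> 2 * arctan (\<delta> / 2)"
  defines "w \<equiv> shifted_weight \<delta> e' e (- cos \<theta>) * sin \<theta> powr \<kappa>"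
    and "K \<equiv> 2 powr (\<bar>e'\<bar> + \<bar>b\<bar>) * 5 powr (\<bar>e\<bar> + \<kappa> + \<bar>a\<bar>)"
  shows "w \<le> K * endpoint_weight n a b \<theta> \<or>
    (\<gamma> < \<theta> \<and> \<theta> \<le> 1 / real n \<and> w \<le> K * ((n * (\<theta> - \<gamma>)) powr singular_exponent \<delta> e a * endpoint_weight n a b \<theta>))"
proof -
  define A where "A = 1 - cos \<theta> - \<delta> * sin \<theta> / 2"
  define A' where "A' = 1 + cos \<theta> - \<delta> * sin \<theta> / 2"
  define v where "v = (sin (\<theta> / 2) + 1 / real n) powr a"
  define v' where "v' = (cos (\<theta> / 2) + 1 / real n) powr b"
  define K1 where "K1 = (5::real) powr (\<bar>e\<bar> + \<kappa> + \<bar>a\<bar>)"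
  have k0: "\<kappa> > 0" using \<kappa> by (meson divide_pos_pos less_le_trans zero_less_one)
  have sin: "0 \<le> sin \<theta>" "sin \<theta> \<le> 1" using \<theta> pi_gt_zero by (auto intro!: sin_ge_zero)
  have phi: "phi (- cos \<theta>) = sin \<theta>" using \<theta> pi_gt_zero by (intro phi_minus_cos) auto
  have W: "w = (A' powr e' * A powr e) * sin \<theta> powr \<kappa>"
    by (simp add: w_def shifted_weight_def phi A_def A'_def)
  have V: "endpoint_weight n a b \<theta> = v * v'" by (simp add: endpoint_weight_def v_def v'_def)
  have d1: "\<delta> \<le> 1 / 2"
  proof -
    have "1 / (2 * real n) \<le> 1 / 2" using n by (intro divide_left_mono) auto
    then show ?thesis using \<delta> by linarith
  qed
  have "\<delta> * sin \<theta> \<le> 1 / 2 * 1" using \<delta> d1 sin by (intro mult_mono) auto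
  moreover have "0 \<le> cos \<theta>" using \<theta> by (intro cos_ge_zero) auto
  moreover have "0 \<le> \<delta> * sin \<theta>" using \<delta> sin by simp
  ultimately have A': "1 / 2 \<le> A'" "A' \<le> 2" unfolding A'_def using cos_le_one[of \<theta>] by linarith+
  have w': "A' powr e' \<le> 2 powr \<bar>e'\<bar> * 1 powr e'"
    using A' by (intro powr_le_of_comparable) auto
  have "cos (pi / 3) \<le> cos (\<theta> / 2)" using \<theta> pi_gt_zero by (intro cos_monotone_0_pi_le) auto
  then have c: "1 / 2 \<le> cos (\<theta> / 2)" by (simp add: cos_60)
  have n1: "1 / real n \<le> 1" "0 < 1 / real n" using n by auto
  have "1 powr b \<le> 2 powr \<bar>b\<bar> * v'"
  proof -
    define x where "x = 1 / real n"
    have "cos (\<theta> / 2) + x \<le> 2" using n1(1)[folded x_def] cos_le_one[of "\<theta> / 2"] by linarith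
    then show ?thesis
      unfolding v'_def x_def[symmetric] using c n1[folded x_def]
      by (intro powr_le_of_comparable) (auto simp: distrib_left)
  qed
  then have one: "1 \<le> 2 powr \<bar>b\<bar> * v'" by simp
  have v0: "v \<ge> 0" "v' \<ge> 0" by (simp_all add: v_def v'_def)
  have combine: "w \<le> K * (r * endpoint_weight n a b \<theta>)" if "A powr e * sin \<theta> powr \<kappa> \<le> K1 * (r * v)" "r \<ge> 0" for r
  proof -
    have "w = A' powr e' * (A powr e * sin \<theta> powr \<kappa>)" by (simp add: W)
    also have "\<dots> \<le> 2 powr \<bar>e'\<bar> * (K1 * (r * v))"
    proof (rule mult_mono[OF _ that(1)])
      show "A' powr e' \<le> 2 powr \<bar>e'\<bar>" using w' by simp
    qed auto
    also have "\<dots> \<le> 2 powr \<bar>e'\<bar> * (K1 * (r * v)) * (2 powr \<bar>b\<bar> * v')"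
      using mult_left_mono[OF one, of "2 powr \<bar>e'\<bar> * (K1 * (r * v))"] that(2) v0 by (simp add: K1_def)
    also have "\<dots> = K * (r * endpoint_weight n a b \<theta>)"
      by (simp add: K_def K1_def V powr_add mult_ac)
    finally show ?thesis .
  qed
  have A0: "0 \<le> A" using B by (simp add: A_def)
  show ?thesis
  proof (cases "(e \<ge> 0 \<or> \<delta> = 0) \<and> a \<ge> 0")
    case True
    have "A powr e * sin \<theta> powr \<kappa> \<le> 2 powr (\<bar>e\<bar> + \<kappa>) * v"
      using near_endpoint_regular[OF n \<theta> \<delta>(1), of e \<kappa>] A0 True k0 unfolding A_def v_def a by simp
    also have "\<dots> \<le> K1 * v"
    proof (intro mult_right_mono v0)
      have "(2::real) powr (\<bar>e\<bar> + \<kappa>) \<le> 5 powr (\<bar>e\<bar> + \<kappa>)" using k0 by (intro powr_mono2) auto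
      also have "\<dots> \<le> K1" unfolding K1_def by (intro powr_mono) auto
      finally show "2 powr (\<bar>e\<bar> + \<kappa>) \<le> K1" .
    qed
    finally show ?thesis using combine[of 1] by simp
  next
    case False
    then have e: "e < 0" "e + \<kappa> \<ge> 0" using adm \<kappa> by (auto simp: endpoint_admissible_def)
    have se: "singular_exponent \<delta> e a = e" using False by (auto simp: singular_exponent_def)
    have "A powr e * sin \<theta> powr \<kappa> \<le> K1 * v \<or>
       (\<gamma> < \<theta> \<and> \<theta> \<le> 1 / real n \<and> A powr e * sin \<theta> powr \<kappa> \<le> K1 * ((n * (\<theta> - \<gamma>)) powr e * v))"
      using near_endpoint_singular[OF n \<theta> \<delta> _ e] A0 unfolding A_def v_def a K1_def \<gamma>_def by simp
    then show ?thesis using combine[of 1] combine[of "(n * (\<theta> - \<gamma>)) powr e"] unfolding se by auto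
  qed
qed

section \<open>Quasi-norms in the angular variable\<close>

lemma nn_integral_cos_substitution:
  fixes f :: "real \<Rightarrow> ennreal"
  assumes "f \<in> borel_measurable borel"
  shows "(\<integral>\<^sup>+x\<in>{-1..1}. f x \<partial>lborel) = (\<integral>\<^sup>+\<theta>\<in>{0..pi}. f (- cos \<theta>) * ennreal (sin \<theta>) \<partial>lborel)"
proof -
  have "(\<integral>\<^sup>+x. f x * indicator {- cos 0..- cos pi} x \<partial>lborel)
      = (\<integral>\<^sup>+\<theta>. f (- cos \<theta>) * ennreal (sin \<theta>) * indicator {0..pi} \<theta> \<partial>lborel)"
    by (rule nn_integral_substitution_aux[OF assms])
       (auto intro!: derivative_eq_intros continuous_intros sin_ge_zero)
  then show ?thesis by simp
qed

lemma Lp_integral_cos_substitution: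
  fixes f :: "real \<Rightarrow> real"
  assumes f: "f \<in> borel_measurable borel" and p: "p > 0"
  shows "(\<integral>\<^sup>+x. ennreal (\<bar>f x\<bar> powr p) \<partial>lebesgue_on {-1..1})
     = (\<integral>\<^sup>+\<theta>\<in>{0..pi}. ennreal ((\<bar>f (- cos \<theta>)\<bar> * sin \<theta> powr (1 / p)) powr p) \<partial>lborel)"
proof -
  have "(\<integral>\<^sup>+x. ennreal (\<bar>f x\<bar> powr p) \<partial>lebesgue_on {-1..1}) = (\<integral>\<^sup>+x\<in>{-1..1}. ennreal (\<bar>f x\<bar> powr p) \<partial>lborel)"
    by (subst nn_integral_restrict_space) (auto simp: nn_integral_completion)
  also have "\<dots> = (\<integral>\<^sup>+\<theta>\<in>{0..pi}. ennreal (\<bar>f (- cos \<theta>)\<bar> powr p) * ennreal (sin \<theta>) \<partial>lborel)"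
    using f by (intro nn_integral_cos_substitution) measurable
  also have "\<dots> = (\<integral>\<^sup>+\<theta>\<in>{0..pi}. ennreal ((\<bar>f (- cos \<theta>)\<bar> * sin \<theta> powr (1 / p)) powr p) \<partial>lborel)"
  proof (intro nn_integral_cong)
    fix \<theta> :: real
    show "ennreal (\<bar>f (- cos \<theta>)\<bar> powr p) * ennreal (sin \<theta>) * indicator {0..pi} \<theta>
      = ennreal ((\<bar>f (- cos \<theta>)\<bar> * sin \<theta> powr (1 / p)) powr p) * indicator {0..pi} \<theta>"
      using p by (auto simp: indicator_def powr_mult powr_powr ennreal_mult[symmetric] sin_ge_zero)
  qed
  finally show ?thesis .
qed

lemma Lp_norm_leI:
  assumes p: "p > 0" and c: "c \<ge> 0"
    and "(\<integral>\<^sup>+x. ennreal (\<bar>f x\<bar> powr p) \<partial>lebesgue_on S) \<le> ennreal (c powr p)"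
  shows "Lp_norm (ennreal p) S f \<le> ennreal c"
proof -
  define I where "I = (\<integral>\<^sup>+x. ennreal (\<bar>f x\<bar> powr p) \<partial>lebesgue_on S)"
  have I: "I \<le> ennreal (c powr p)" using assms by (simp add: I_def)
  then have fin: "I \<noteq> \<infinity>" by (metis ennreal_less_top infinity_ennreal_def leD)
  then have "enn2real I \<le> c powr p" using I by (simp add: enn2real_leI)
  then have "enn2real I powr (1 / p) \<le> (c powr p) powr (1 / p)" using p by (intro powr_mono2) auto
  also have "\<dots> = c" using p c by (simp add: powr_powr)
  finally show ?thesis
    using p fin by (simp add: Lp_norm_def I_def[symmetric] Let_def ennreal_leI)
qed

lemma Lp_norm_geI:
  assumes p: "p > 0" and x: "x \<ge> 0" and C: "C > 0"
    and "ennreal (x powr p) \<le> ennreal (C powr p) * (\<integral>\<^sup>+x. ennreal (\<bar>f x\<bar> powr p) \<partial>lebesgue_on S)"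
  shows "ennreal x \<le> ennreal C * Lp_norm (ennreal p) S f"
proof -
  define I where "I = (\<integral>\<^sup>+x. ennreal (\<bar>f x\<bar> powr p) \<partial>lebesgue_on S)"
  have I: "ennreal (x powr p) \<le> ennreal (C powr p) * I" using assms by (simp add: I_def)
  show ?thesis
  proof (cases "I = \<infinity>")
    case True
    then show ?thesis using C p by (simp add: Lp_norm_def I_def[symmetric] Let_def ennreal_mult_top)
  next
    case False
    then obtain r where r: "I = ennreal r" "r \<ge> 0" by (cases I) auto
    then have "x powr p \<le> C powr p * r" using I by (simp add: ennreal_mult[symmetric])
    then have "(x powr p) powr (1 / p) \<le> (C powr p * r) powr (1 / p)" using p by (intro powr_mono2) auto
    also have "\<dots> = C * r powr (1 / p)" using p C by (simp add: powr_mult powr_powr)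
    finally have "x \<le> C * r powr (1 / p)" using p x by (simp add: powr_powr)
    then have "ennreal x \<le> ennreal C * ennreal (r powr (1 / p))"
      using C by (simp add: ennreal_mult[symmetric] ennreal_leI)
    then show ?thesis using p r by (simp add: Lp_norm_def I_def[symmetric] Let_def)
  qed
qed

lemma Lp_norm_leD:
  assumes p: "p > 0" and c: "c \<ge> 0" and le: "Lp_norm (ennreal p) S f \<le> ennreal c"
  shows "(\<integral>\<^sup>+x. ennreal (\<bar>f x\<bar> powr p) \<partial>lebesgue_on S) \<le> ennreal (c powr p)"
proof -
  define I where "I = (\<integral>\<^sup>+x. ennreal (\<bar>f x\<bar> powr p) \<partial>lebesgue_on S)"
  have fin: "I \<noteq> \<infinity>"
    using le p by (auto simp: Lp_norm_def I_def[symmetric] Let_def top_unique split: if_splits)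
  then obtain r where r: "I = ennreal r" "r \<ge> 0" by (cases I) auto
  have "ennreal (r powr (1 / p)) \<le> ennreal c"
    using le p r by (simp add: Lp_norm_def I_def[symmetric] Let_def)
  then have "r powr (1 / p) \<le> c" using c by simp
  then have "(r powr (1 / p)) powr p \<le> c powr p" using p by (intro powr_mono2) auto
  then have "r \<le> c powr p" using p r by (simp add: powr_powr)
  then show ?thesis using r by (simp add: I_def[symmetric] ennreal_leI)
qed

lemma Lp_norm_le_of_integral_le:
  assumes p: "p > 0"
    and le: "(\<integral>\<^sup>+x. ennreal (\<bar>f x\<bar> powr p) \<partial>lebesgue_on S) \<le> (\<integral>\<^sup>+x. ennreal (\<bar>g x\<bar> powr p) \<partial>lebesgue_on T)"
  shows "Lp_norm (ennreal p) S f \<le> Lp_norm (ennreal p) T g"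
proof (cases "(\<integral>\<^sup>+x. ennreal (\<bar>g x\<bar> powr p) \<partial>lebesgue_on T) = \<infinity>")
  case True
  then show ?thesis using p by (simp add: Lp_norm_def)
next
  case False
  then obtain r where r: "(\<integral>\<^sup>+x. ennreal (\<bar>g x\<bar> powr p) \<partial>lebesgue_on T) = ennreal r" "r \<ge> 0"
    by (cases "\<integral>\<^sup>+x. ennreal (\<bar>g x\<bar> powr p) \<partial>lebesgue_on T") auto
  have "Lp_norm (ennreal p) T g = ennreal (r powr (1 / p))" using p r by (simp add: Lp_norm_def)
  moreover have "Lp_norm (ennreal p) S f \<le> ennreal (r powr (1 / p))"
    using le p unfolding r by (intro Lp_norm_leI) (auto simp: powr_powr r(2))
  ultimately show ?thesis by simp
qed

lemma Lp_norm_mono_supported: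
  assumes p: "p > 0" and S: "S \<in> sets borel" and T: "T \<in> sets borel"
    and le: "\<And>x. x \<in> S \<Longrightarrow> f x \<noteq> 0 \<Longrightarrow> x \<in> T \<and> \<bar>f x\<bar> \<le> \<bar>g x\<bar>"
  shows "Lp_norm (ennreal p) S f \<le> Lp_norm (ennreal p) T g"
proof (rule Lp_norm_le_of_integral_le[OF p])
  have "(\<integral>\<^sup>+x. ennreal (\<bar>f x\<bar> powr p) * indicator S x \<partial>lebesgue) \<le> (\<integral>\<^sup>+x. ennreal (\<bar>g x\<bar> powr p) * indicator T
      x \<partial>lebesgue)"
  proof (intro nn_integral_mono)
    fix x
    show "ennreal (\<bar>f x\<bar> powr p) * indicator S x \<le> ennreal (\<bar>g x\<bar> powr p) * indicator T x"
    proof (cases "x \<in> S \<and> f x \<noteq> 0")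
      case True
      then show ?thesis using le[of x] p by (auto intro!: ennreal_leI powr_mono2)
    qed (auto simp: indicator_def)
  qed
  then show "(\<integral>\<^sup>+x. ennreal (\<bar>f x\<bar> powr p) \<partial>lebesgue_on S) \<le> (\<integral>\<^sup>+x. ennreal (\<bar>g x\<bar> powr p) \<partial>lebesgue_on T)"
    using S T by (subst (1 2) nn_integral_restrict_space) auto
qed

text \<open>
  Otherwise there is a level strictly between the two sides that \<open>|f|\<close> exceeds on a set of
  positive measure \<open>\<mu>\<close>. Bounding the integral of \<open>|f| powr N\<close> from below by this set makes the
  \<open>N\<close>-th power of a fixed number below \<open>1\<close> at least \<open>\<mu> / 2\<close>, for every \<open>N\<close>.
\<close>
lemma Lp_norm_infinity_le_of_all_finite:
  fixes f g :: "real \<Rightarrow> real"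
  assumes c: "c > 0" and f: "f \<in> borel_measurable borel" and g: "g \<in> borel_measurable borel"
    and S: "S \<in> sets borel" "S \<subseteq> {-1..1}" and S': "S' \<in> sets borel" "S' \<subseteq> {-1..1}"
    and le: "\<And>p. p \<ge> 1 \<Longrightarrow> Lp_norm (ennreal p) S f \<le> ennreal c * Lp_norm (ennreal p) S' g"
  shows "Lp_norm \<infinity> S f \<le> ennreal c * Lp_norm \<infinity> S' g"
proof (rule ccontr)
  assume "\<not> ?thesis"
  then obtain z where z: "ennreal c * Lp_norm \<infinity> S' g < z" "z < Lp_norm \<infinity> S f"
    using dense by (metis not_le)
  have Lf: "Lp_norm \<infinity> S f = esssup (lebesgue_on S) (\<lambda>x. ennreal \<bar>f x\<bar>)" by (simp add: Lp_norm_def)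
  have Lg: "Lp_norm \<infinity> S' g = esssup (lebesgue_on S') (\<lambda>x. ennreal \<bar>g x\<bar>)" by (simp add: Lp_norm_def)
  have mf: "(\<lambda>x. \<bar>f x\<bar>) \<in> borel_measurable (lebesgue_on A)" "(\<lambda>x. \<bar>g x\<bar>) \<in> borel_measurable (lebesgue_on A)" for A
    using f g by (auto intro!: measurable_restrict_space1 borel_measurable_abs measurable_completion)
  have "Lp_norm \<infinity> S' g \<noteq> \<infinity>" using z c by (auto simp: ennreal_mult_top top_unique)
  then obtain Y where Y: "Lp_norm \<infinity> S' g = ennreal Y" "Y \<ge> 0" by (cases "Lp_norm \<infinity> S' g") auto
  have "z < top" using z(2) by (meson less_le_trans top_greatest)
  then obtain ell where ell: "z = ennreal ell" "ell \<ge> 0" by (cases z) auto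
  have l: "c * Y < ell"
    using z(1) Y ell c by (simp add: ennreal_mult[symmetric] ennreal_less_iff)
  define E where "E = {x \<in> space (lebesgue_on S). ennreal \<bar>f x\<bar> > z}"
  have mE: "E \<in> sets (lebesgue_on S)" unfolding E_def using mf(1)[of S] by measurable
  have Epos: "emeasure (lebesgue_on S) E > 0"
    unfolding E_def using z(2) mf(1)[of S] unfolding Lf by (intro esssup_pos_measure) auto
  have two: "emeasure (lebesgue_on A) B \<le> 2" if "A \<in> sets borel" "A \<subseteq> {-1..1}" for A B :: "real set"
  proof -
    have "emeasure (lebesgue_on A) B \<le> emeasure (lebesgue_on A) (space (lebesgue_on A))"
      by (rule emeasure_space)
    also have "\<dots> = emeasure lebesgue A" using that by (subst emeasure_restrict_space) auto
    also have "\<dots> \<le> emeasure lebesgue {-1..1::real}" using that by (intro emeasure_mono) auto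
    also have "\<dots> = 2" by simp
    finally show ?thesis .
  qed
  have "emeasure (lebesgue_on S) E \<noteq> \<infinity>" using two[OF S, of E] by (auto simp: top_unique)
  then obtain \<mu> where \<mu>: "emeasure (lebesgue_on S) E = ennreal \<mu>" "\<mu> \<ge> 0"
      by (cases "emeasure (lebesgue_on S) E") auto
  have \<mu>0: "\<mu> > 0" using Epos \<mu> by (simp add: ennreal_less_zero_iff)
  have key: "ell ^ N * \<mu> \<le> 2 * (c * Y) ^ N" if N: "N \<ge> 1" for N :: nat
  proof -
    let ?p = "real N"
    have p: "?p > 0" "?p \<ge> 1" using N by auto
    have "Lp_norm (ennreal ?p) S' g \<le> ennreal (Y * 2 powr (1 / ?p))"
    proof (rule Lp_norm_leI[OF p(1)])
      have "AE x in lebesgue_on S'. ennreal \<bar>g x\<bar> \<le> ennreal Y"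
        using esssup_AE[where M = "lebesgue_on S'" and f = "\<lambda>x. ennreal \<bar>g x\<bar>"] unfolding Lg[symmetric] Y .
      then have "(\<integral>\<^sup>+x. ennreal (\<bar>g x\<bar> powr ?p) \<partial>lebesgue_on S') \<le> (\<integral>\<^sup>+x. ennreal (Y powr ?p) \<partial>lebesgue_on S')"
        using p Y by (intro nn_integral_mono_AE) (auto intro!: ennreal_leI powr_mono2 elim: eventually_mono)
      also have "\<dots> = ennreal (Y powr ?p) * emeasure (lebesgue_on S') (space (lebesgue_on S'))" by simp
      also have "\<dots> \<le> ennreal (Y powr ?p) * 2" by (intro mult_left_mono two S') auto
      also have "\<dots> = ennreal ((Y * 2 powr (1 / ?p)) powr ?p)"
        using p by (simp add: powr_mult powr_powr ennreal_mult)
      finally show "(\<integral>\<^sup>+x. ennreal (\<bar>g x\<bar> powr ?p) \<partial>lebesgue_on S') \<le> ennreal ((Y * 2 powr (1 / ?p)) powr ?p)" .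
    qed (use Y in auto)
    then have "ennreal c * Lp_norm (ennreal ?p) S' g \<le> ennreal c * ennreal (Y * 2 powr (1 / ?p))"
      by (intro mult_left_mono) auto
    also have "\<dots> = ennreal (c * Y * 2 powr (1 / ?p))" using c Y by (simp add: ennreal_mult[symmetric] mult.assoc)
    finally have "Lp_norm (ennreal ?p) S f \<le> ennreal (c * Y * 2 powr (1 / ?p))" using le[OF p(2)] by simp
    then have 1: "(\<integral>\<^sup>+x. ennreal (\<bar>f x\<bar> powr ?p) \<partial>lebesgue_on S) \<le> ennreal ((c * Y * 2 powr (1 / ?p)) powr ?p)"
      using c Y by (intro Lp_norm_leD p) auto
    have "ennreal (ell powr ?p) * ennreal \<mu> = (\<integral>\<^sup>+x. ennreal (ell powr ?p) * indicator E x \<partial>lebesgue_on S)"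
      using mE \<mu> by (simp add: nn_integral_cmult_indicator)
    also have "\<dots> \<le> (\<integral>\<^sup>+x. ennreal (\<bar>f x\<bar> powr ?p) \<partial>lebesgue_on S)"
    proof (intro nn_integral_mono)
      fix x
      show "ennreal (ell powr ?p) * indicator E x \<le> ennreal (\<bar>f x\<bar> powr ?p)"
      proof (cases "x \<in> E")
        case True
        then have "ell \<le> \<bar>f x\<bar>" using ell by (auto simp: E_def ennreal_less_iff)
        then show ?thesis using True ell by (auto intro!: ennreal_leI powr_mono2)
      qed simp
    qed
    also note 1
    also have "(c * Y * 2 powr (1 / ?p)) powr ?p = 2 * (c * Y) powr ?p"
      using p by (simp add: powr_mult powr_powr)
    finally have "ell powr ?p * \<mu> \<le> 2 * (c * Y) powr ?p"
      using \<mu> by (simp add: ennreal_mult[symmetric] ennreal_le_iff)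
    then show ?thesis using N ell c Y by (simp add: powr_realpow')
  qed
  have ell0: "ell > 0" using l c Y by (metis le_less_trans mult_nonneg_nonneg less_imp_le)
  have r: "0 \<le> c * Y / ell" "c * Y / ell < 1" using l ell0 c Y by auto
  obtain N where N: "(c * Y / ell) ^ N < \<mu> / 2"
    using real_arch_pow_inv[of "\<mu> / 2" "c * Y / ell"] r \<mu>0 by auto
  have "(c * Y / ell) ^ Suc N \<le> (c * Y / ell) ^ N" using r by (intro power_decreasing) auto
  then have "(c * Y / ell) ^ Suc N < \<mu> / 2" using N by linarith
  moreover have "\<mu> / 2 \<le> (c * Y / ell) ^ Suc N"
    using key[of "Suc N"] ell0 by (simp add: power_divide field_simps del: power_Suc)
  ultimately show False by simp
qed

section \<open>Comparison with the norm of the local average\<close>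

text \<open>
  The quantity \<open>R\<close> with which the derivative and all moduli are compared.
\<close>
definition averaged_norm :: "real \<Rightarrow> real \<Rightarrow> nat \<Rightarrow> nat \<Rightarrow> real \<Rightarrow> real \<Rightarrow> real poly \<Rightarrow> real" where
  "averaged_norm p q M n a b Q =
     (integral {0..pi} (\<lambda>\<theta>. (endpoint_weight n a b \<theta> * local_average q M n (\<lambda>\<tau>. poly Q (- cos \<tau>)) \<theta>) powr p))
         powr (1 / p)"

lemma shifted_weight_reflect: "shifted_weight \<delta> \<xi> \<zeta> (- x) = shifted_weight \<delta> \<zeta> \<xi> x"
  by (simp add: shifted_weight_def phi_def mult.commute)

lemma endpoint_weight_reflect: "endpoint_weight n a b (pi - \<theta>) = endpoint_weight n b a \<theta>"
proof -
  have "sin ((pi - \<theta>) / 2) = cos (\<theta> / 2)" "cos ((pi - \<theta>) / 2) = sin (\<theta> / 2)"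
    by (simp_all add: diff_divide_distrib sin_diff cos_diff)
  then show ?thesis by (simp add: endpoint_weight_def mult.commute)
qed

lemma nn_integral_reflect_pi:
  fixes f :: "real \<Rightarrow> ennreal"
  assumes "f \<in> borel_measurable borel"
  shows "(\<integral>\<^sup>+\<theta>. f \<theta> \<partial>lborel) = (\<integral>\<^sup>+\<theta>. f (pi - \<theta>) \<partial>lborel)"
  using nn_integral_real_affine[OF assms, of "-1" pi] by simp

lemma integral_reflect_pi:
  fixes g :: "real \<Rightarrow> real"
  assumes "continuous_on {0..pi} g" "\<And>\<theta>. \<theta> \<in> {0..pi} \<Longrightarrow> 0 \<le> g \<theta>"
  shows "integral {0..pi} (\<lambda>\<theta>. g (pi - \<theta>)) = integral {0..pi} g"
proof -
  have c: "continuous_on {0..pi} (\<lambda>\<theta>. g (pi - \<theta>))"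
    by (rule continuous_on_compose2[OF assms(1)]) (auto intro!: continuous_intros)
  have "ennreal (integral {0..pi} g) = (\<integral>\<^sup>+x. ennreal (g x) * indicator {0..pi} x \<partial>lborel)"
    by (rule continuous_nonneg_nn_integral[symmetric]) (use assms in auto)
  also have "\<dots> = (\<integral>\<^sup>+x. ennreal (g (pi - x)) * indicator {0..pi} (pi - x) \<partial>lborel)"
    by (rule nn_integral_reflect_pi[OF continuous_ennreal_indicator_measurable[OF assms(1)]])
  also have "\<dots> = (\<integral>\<^sup>+x. ennreal (g (pi - x)) * indicator {0..pi} x \<partial>lborel)"
    by (intro nn_integral_cong) (auto simp: indicator_def)
  also have "\<dots> = ennreal (integral {0..pi} (\<lambda>\<theta>. g (pi - \<theta>)))"
    by (rule continuous_nonneg_nn_integral[OF c]) (use assms(2) in auto)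
  finally have "ennreal (integral {0..pi} g) = ennreal (integral {0..pi} (\<lambda>\<theta>. g (pi - \<theta>)))" .
  moreover have "0 \<le> integral {0..pi} g" "0 \<le> integral {0..pi} (\<lambda>\<theta>. g (pi - \<theta>))"
    by (intro hk_integral_nonneg integrable_continuous_real assms c; use assms(2) in auto)+
  ultimately show ?thesis by simp
qed

text \<open>
  Of the base \<open>800\<close>, a factor \<open>2\<close> comes from the displacement of the sample, \<open>100\<close> from the
  comparison of the weights, and \<open>4\<close> from the variation of weight times local average.
\<close>
definition upper_const :: "real \<Rightarrow> nat \<Rightarrow> real" where
  "upper_const q M = local_bound_const q M * 800 ^ M"

text \<open>
  The sample point is within \<open>1 / n\<close> of \<open>\<theta>\<close>, so \<open>Q\<close> there is bounded by the local average at
  \<open>\<theta>\<close>. What is left is the weight, which is compared with the endpoint weight on each half of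
  the interval; the right half is reflected to the left one.
\<close>
lemma Lp_norm_le_averaged_norm:
  fixes Q :: "real poly" and f :: "real \<Rightarrow> real" and q p a b e1 e2 \<delta> H L \<kappa> :: real and k M n :: nat
  assumes q: "0 < q" "q \<le> 1" "q \<le> p" and n: "n \<ge> 1" and Q: "degree Q \<le> n"
    and \<kappa>: "\<kappa> = k + 1 / p" and a: "a = 2 * e2 + \<kappa>" and b: "b = 2 * e1 + \<kappa>"
    and M: "\<bar>a\<bar> + \<bar>b\<bar> + 2 / q \<le> M" "\<bar>e1\<bar> + \<bar>e2\<bar> + \<kappa> \<le> M"
    and \<delta>: "0 \<le> \<delta>" "\<delta> \<le> 1 / (2 * real n)"
    and adm: "endpoint_admissible p \<delta> e2 a L" "endpoint_admissible p \<delta> e1 b L"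
    and f: "f \<in> borel_measurable borel" and H: "H \<ge> 0"
    and bound: "\<And>\<theta>. \<theta> \<in> {0<..<pi} \<Longrightarrow> f (- cos \<theta>) = 0 \<or>
       (\<delta> * sin \<theta> / 2 \<le> 1 - cos \<theta> \<and> \<delta> * sin \<theta> / 2 \<le> 1 + cos \<theta> \<and>
         (\<exists>\<tau>\<in>{0..pi}. \<bar>\<tau> - \<theta>\<bar> \<le> 1 / n \<and>
            \<bar>f (- cos \<theta>)\<bar> \<le> shifted_weight \<delta> e1 e2 (- cos \<theta>) * (H * sin \<theta> ^ k * \<bar>poly Q (- cos \<tau>)\<bar>)))"
  shows "Lp_norm (ennreal p) {-1..1} f \<le> ennreal (H * (upper_const q M * (2 * L) powr (1 / q)) * averaged_norm
      p q M n a b Q)"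
proof -
  let ?T = "\<lambda>\<tau>. poly Q (- cos \<tau>)"
  let ?G = "local_average q M n ?T"
  define \<Phi> where "\<Phi> \<theta> = endpoint_weight n a b \<theta> * ?G \<theta>" for \<theta>
  define I where "I = integral {0..pi} (\<lambda>\<theta>. \<Phi> \<theta> powr p)"
  define v where "v \<theta> = \<bar>f (- cos \<theta>)\<bar> * sin \<theta> powr (1 / p)" for \<theta>
  define \<gamma> where "\<gamma> = 2 * arctan (\<delta> / 2)"
  define C where "C = local_bound_const q M"
  define K where "K = H * (C * 2 ^ M * 100 ^ M)"
  define S where "S = (4::real) ^ M"
  have p: "p > 0" using q by simp
  have k\<kappa>: "1 / p \<le> \<kappa>" "\<kappa> > 0" using p by (auto simp: \<kappa> add_nonneg_pos)
  have C1: "C \<ge> 1" unfolding C_def by (rule local_bound_const_ge_one[OF q(1)])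
  have K0: "K \<ge> 0" using H C1 by (simp add: K_def)
  have cT: "continuous_on {0..pi} ?T" by (intro continuous_intros)
  have V0: "endpoint_weight n a b \<theta> > 0" if "\<theta> \<in> {0..pi}" for \<theta> by (rule endpoint_weight_pos[OF n that])
  have c\<Phi>: "continuous_on {0..pi} \<Phi>"
    unfolding \<Phi>_def by (intro continuous_on_mult continuous_on_endpoint_weight[OF n]
        continuous_on_local_average[OF q(1) cT])
  have \<Phi>0: "0 \<le> \<Phi> \<theta>" if "\<theta> \<in> {0..pi}" for \<theta>
    using V0[OF that] local_average_nonneg by (simp add: \<Phi>_def)
  have cp: "continuous_on {0..pi} (\<lambda>\<theta>. \<Phi> \<theta> powr p)"
    using p \<Phi>0 by (intro continuous_on_powr' c\<Phi> continuous_on_const) auto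
  have I0: "I \<ge> 0" unfolding I_def
    by (intro hk_integral_nonneg integrable_continuous_real cp) auto
  have n1: "1 / real n \<le> pi"
  proof -
    have "1 / real n \<le> 1" using n by simp
    then show ?thesis using pi_ge_two by linarith
  qed
  have abM: "\<bar>a\<bar> + \<bar>b\<bar> \<le> M"
  proof -
    have "0 \<le> 2 / q" using q by simp
    then show ?thesis using M by linarith
  qed
  have slow: "\<Phi> \<theta> \<le> S * \<Phi> \<tau>" if "\<theta> \<in> {0..pi}" "\<tau> \<in> {0..pi}" "\<bar>\<theta> - \<tau>\<bar> \<le> 1 / n" for \<theta> \<tau>
  proof -
    have "n * \<bar>\<theta> - \<tau>\<bar> \<le> n * (1 / n)" using that by (intro mult_left_mono) auto
    then have d: "1 + n * \<bar>\<theta> - \<tau>\<bar> \<le> 2" using n by simp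
    have "(1 + n * \<bar>\<theta> - \<tau>\<bar>) powr (\<bar>a\<bar> + \<bar>b\<bar>) \<le> 2 powr (\<bar>a\<bar> + \<bar>b\<bar>)" using d by (intro powr_mono2) auto
    also have "\<dots> \<le> 2 powr M" using abM by (intro powr_mono) auto
    finally have 1: "(1 + n * \<bar>\<theta> - \<tau>\<bar>) powr (\<bar>a\<bar> + \<bar>b\<bar>) \<le> 2 ^ M" by (simp add: powr_realpow)
    have 2: "(1 + n * \<bar>\<theta> - \<tau>\<bar>) ^ M \<le> 2 ^ M" using d by (intro power_mono) auto
    have "endpoint_weight n a b \<theta> \<le> (1 + n * \<bar>\<theta> - \<tau>\<bar>) powr (\<bar>a\<bar> + \<bar>b\<bar>) * endpoint_weight n a b \<tau>"
      by (rule endpoint_weight_slowly_varying[OF n that(1,2)])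
    also have "\<dots> \<le> 2 ^ M * endpoint_weight n a b \<tau>" using 1 V0[OF that(2)] by (intro mult_right_mono) auto
    finally have A: "endpoint_weight n a b \<theta> \<le> 2 ^ M * endpoint_weight n a b \<tau>" .
    have "?G \<theta> \<le> (1 + n * \<bar>\<theta> - \<tau>\<bar>) ^ M * ?G \<tau>" by (rule local_average_slowly_varying[OF q(1) cT])
    also have "\<dots> \<le> 2 ^ M * ?G \<tau>" using 2 local_average_nonneg by (intro mult_right_mono) auto
    finally have B: "?G \<theta> \<le> 2 ^ M * ?G \<tau>" .
    have "\<Phi> \<theta> \<le> (2 ^ M * endpoint_weight n a b \<tau>) * (2 ^ M * ?G \<tau>)"
      unfolding \<Phi>_def using A B V0[OF that(1)] V0[OF that(2)] local_average_nonneg by (intro mult_mono) auto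
    also have "\<dots> = S * \<Phi> \<tau>"
      using power_mult_distrib[of "2::real" 2 M] by (simp add: S_def \<Phi>_def mult_ac)
    finally show ?thesis .
  qed
  have sample: "\<bar>?T \<tau>\<bar> \<le> C * (2 ^ M * ?G \<theta>)" if "\<theta> \<in> {0..pi}" "\<tau> \<in> {0..pi}" "\<bar>\<tau> - \<theta>\<bar> \<le> 1 / n" for \<theta> \<tau>
  proof -
    have "n * \<bar>\<tau> - \<theta>\<bar> \<le> n * (1 / n)" using that by (intro mult_left_mono) auto
    then have d: "1 + n * \<bar>\<tau> - \<theta>\<bar> \<le> 2" using n by simp
    have "\<bar>?T \<tau>\<bar> \<le> C * ?G \<tau>" unfolding C_def using local_average_bound(1)[OF q(1,2) n Q] that(2) by auto
    also have "\<dots> \<le> C * ((1 + n * \<bar>\<tau> - \<theta>\<bar>) ^ M * ?G \<theta>)"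
      using C1 by (intro mult_left_mono local_average_slowly_varying[OF q(1) cT]) auto
    also have "\<dots> \<le> C * (2 ^ M * ?G \<theta>)"
      using C1 d local_average_nonneg by (intro mult_left_mono mult_right_mono power_mono) auto
    finally show ?thesis .
  qed
  have sinpow: "sin \<theta> powr (1 / p) * sin \<theta> ^ k = sin \<theta> powr \<kappa>" if "\<theta> \<in> {0<..<pi}" for \<theta>
    using sin_gt_zero[of \<theta>] that by (simp add: \<kappa> powr_add powr_realpow)
  have v0: "0 \<le> v \<theta>" for \<theta> by (simp add: v_def)
  have vb: "v \<theta> = 0 \<or> (\<delta> * sin \<theta> / 2 \<le> 1 - cos \<theta> \<and> \<delta> * sin \<theta> / 2 \<le> 1 + cos \<theta> \<and>
       v \<theta> \<le> (shifted_weight \<delta> e1 e2 (- cos \<theta>) * sin \<theta> powr \<kappa>) * (H * (C * 2 ^ M) * ?G \<theta>))"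
    if \<theta>: "\<theta> \<in> {0<..<pi}" for \<theta>
    using bound[OF \<theta>]
  proof (elim disjE conjE bexE)
    assume "f (- cos \<theta>) = 0"
    then show ?thesis by (simp add: v_def)
  next
    fix \<tau> assume cond: "\<delta> * sin \<theta> / 2 \<le> 1 - cos \<theta>" "\<delta> * sin \<theta> / 2 \<le> 1 + cos \<theta>"
      and \<tau>: "\<tau> \<in> {0..pi}" "\<bar>\<tau> - \<theta>\<bar> \<le> 1 / n"
      and le: "\<bar>f (- cos \<theta>)\<bar> \<le> shifted_weight \<delta> e1 e2 (- cos \<theta>) * (H * sin \<theta> ^ k * \<bar>?T \<tau>\<bar>)"
    have s0: "sin \<theta> > 0" using \<theta> by (intro sin_gt_zero) auto
    have W0: "shifted_weight \<delta> e1 e2 (- cos \<theta>) \<ge> 0" by (simp add: shifted_weight_def)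
    have "v \<theta> \<le> shifted_weight \<delta> e1 e2 (- cos \<theta>) * (H * sin \<theta> ^ k * \<bar>?T \<tau>\<bar>) * sin \<theta> powr (1 / p)"
      unfolding v_def using le by (intro mult_right_mono) auto
    also have "\<dots> = (shifted_weight \<delta> e1 e2 (- cos \<theta>) * sin \<theta> powr \<kappa>) * (H * \<bar>?T \<tau>\<bar>)"
      unfolding sinpow[OF \<theta>, symmetric] by (simp add: mult_ac)
    also have "\<dots> \<le> (shifted_weight \<delta> e1 e2 (- cos \<theta>) * sin \<theta> powr \<kappa>) * (H * (C * (2 ^ M * ?G \<theta>)))"
      using sample[of \<theta> \<tau>] \<tau> \<theta> H W0 by (intro mult_left_mono mult_nonneg_nonneg) auto
    finally show ?thesis using cond by (simp add: mult_ac)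
  qed
  have const: "2 powr (\<bar>e\<bar> + \<bar>c\<bar>) * 5 powr (\<bar>e'\<bar> + \<kappa> + \<bar>c'\<bar>) \<le> 100 ^ M"
    if "\<bar>e\<bar> + \<bar>e'\<bar> + \<kappa> \<le> M" "\<bar>c\<bar> + \<bar>c'\<bar> \<le> M" for e e' c c' :: real
  proof -
    have "2 powr (\<bar>e\<bar> + \<bar>c\<bar>) \<le> 2 powr real (2 * M)" using that k\<kappa> by (intro powr_mono) auto
    moreover have "(5::real) powr (\<bar>e'\<bar> + \<kappa> + \<bar>c'\<bar>) \<le> 5 powr real (2 * M)" using that k\<kappa> by (intro powr_mono) auto
    ultimately have "2 powr (\<bar>e\<bar> + \<bar>c\<bar>) * 5 powr (\<bar>e'\<bar> + \<kappa> + \<bar>c'\<bar>) \<le> 2 powr real (2 * M) * 5 powr real (2 * M)"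
      by (intro mult_mono) auto
    also have "\<dots> = 2 ^ (2 * M) * 5 ^ (2 * M)" by (subst (1 2) powr_realpow) auto
    also have "\<dots> = 100 ^ M" by (simp add: power_mult power_mult_distrib[symmetric])
    finally show ?thesis .
  qed
  have half: "(\<integral>\<^sup>+\<theta>\<in>{0..pi / 2}. ennreal (v' \<theta> powr p) \<partial>lborel) \<le> ennreal (K powr p * (S powr p * L) * I)"
    if v'0: "\<And>\<theta>. 0 \<le> v' \<theta>" "v' 0 = 0"
      and \<Phi>': "continuous_on {0..pi} \<Phi>'"
        "\<And>\<theta> \<tau>. \<theta> \<in> {0..pi} \<Longrightarrow> \<tau> \<in> {0..pi} \<Longrightarrow> \<bar>\<theta> - \<tau>\<bar> \<le> 1 / n \<Longrightarrow> \<Phi>' \<theta> \<le> S * \<Phi>' \<tau>"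
        "integral {0..pi} (\<lambda>\<theta>. \<Phi>' \<theta> powr p) = I"
      and split: "\<And>\<theta>. \<Phi>' \<theta> = endpoint_weight n c c' \<theta> * g \<theta>" and g: "\<And>\<theta>. 0 \<le> g \<theta>"
      and ad: "endpoint_admissible p \<delta> e c L" and ce: "c = 2 * e + \<kappa>"
      and eM: "\<bar>e'\<bar> + \<bar>e\<bar> + \<kappa> \<le> M" "\<bar>c'\<bar> + \<bar>c\<bar> \<le> M"
      and bd: "\<And>\<theta>. \<theta> \<in> {0<..pi / 2} \<Longrightarrow> v' \<theta> = 0 \<or> (\<delta> * sin \<theta> / 2 \<le> 1 - cos \<theta> \<and>
        v' \<theta> \<le> (shifted_weight \<delta> e' e (- cos \<theta>) * sin \<theta> powr \<kappa>) * (H * (C * 2 ^ M) * g \<theta>))"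
    for v' \<Phi>' g :: "real \<Rightarrow> real" and e e' c c' :: real
  proof -
    let ?s = "singular_exponent \<delta> e c"
    let ?K = "2 powr (\<bar>e'\<bar> + \<bar>c'\<bar>) * 5 powr (\<bar>e\<bar> + \<kappa> + \<bar>c\<bar>)"
    have s: "?s * p > -1" "1 + 1 / (?s * p + 1) \<le> L"
      using singular_exponent_bounds[OF p ad] by auto
    have S1: "S powr p \<ge> 1" unfolding S_def using p by (intro ge_one_powr_ge_zero) auto
    have V: "0 < endpoint_weight n c c' \<theta>" if "\<theta> \<in> {0..pi}" for \<theta> by (rule endpoint_weight_pos[OF n that])
    have \<Phi>'0: "0 \<le> \<Phi>' \<theta>" if "\<theta> \<in> {0..pi}" for \<theta> unfolding split using V[OF that] g by simp
    have "(\<integral>\<^sup>+\<theta>\<in>{0..pi / 2}. ennreal (v' \<theta> powr p) \<partial>lborel)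
       \<le> ennreal (K powr p * (1 + S powr p / (?s * p + 1)) * integral {0..pi} (\<lambda>\<theta>. \<Phi>' \<theta> powr p))"
    proof (rule endpoint_singularity_absorbed[OF n p s(1)])
      show "\<gamma> \<ge> 0" using \<delta> by (simp add: \<gamma>_def)
      show "\<Phi>' \<theta> \<le> S * \<Phi>' \<tau>" if "\<theta> \<in> {0..1 / real n}" "\<tau> \<in> {0..1 / real n}" for \<theta> \<tau>
        using that n1 by (intro \<Phi>'(2)) auto
      show "v' \<theta> \<le> K * \<Phi>' \<theta> \<or> (\<gamma> < \<theta> \<and> \<theta> \<le> 1 / real n \<and> v' \<theta> \<le> K * ((n * (\<theta> - \<gamma>)) powr ?s * \<Phi>' \<theta>))"
        if \<theta>: "\<theta> \<in> {0..pi / 2}" for \<theta>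
      proof (cases "v' \<theta> = 0")
        case True
        then show ?thesis using K0 \<Phi>'0[of \<theta>] \<theta> pi_gt_zero by simp
      next
        case False
        then have th: "0 < \<theta>" "\<theta> \<le> pi / 2" "\<theta> \<in> {0..pi}" using v'0(2) \<theta> pi_gt_zero by (auto simp: less_le)
        then have c1: "\<delta> * sin \<theta> / 2 \<le> 1 - cos \<theta>"
          and le: "v' \<theta> \<le> (shifted_weight \<delta> e' e (- cos \<theta>) * sin \<theta> powr \<kappa>) * (H * (C * 2 ^ M) * g \<theta>)"
          using bd[of \<theta>] False by auto
        have K: "v' \<theta> \<le> K * (r * (endpoint_weight n c c' \<theta> * g \<theta>))"
          if w: "shifted_weight \<delta> e' e (- cos \<theta>) * sin \<theta> powr \<kappa> \<le> ?K * (r * endpoint_weight n c c' \<theta>)" and r: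
              "0 \<le> r" for r
        proof -
          have "?K * (r * endpoint_weight n c c' \<theta>) \<le> 100 ^ M * (r * endpoint_weight n c c' \<theta>)"
            using r V[OF th(3)] by (intro mult_right_mono const eM) auto
          then have "(shifted_weight \<delta> e' e (- cos \<theta>) * sin \<theta> powr \<kappa>) * (H * (C * 2 ^ M) * g \<theta>)
              \<le> 100 ^ M * (r * endpoint_weight n c c' \<theta>) * (H * (C * 2 ^ M) * g \<theta>)"
            using w H C1 g[of \<theta>] by (intro mult_right_mono) auto
          then show ?thesis using le by (simp add: K_def mult_ac)
        qed
        show ?thesis
          using shifted_weight_near_left_end[OF n th(1,2) \<delta> c1 k\<kappa>(1) p ce ad, of e' c'] K[of 1] K[of
              "(n * (\<theta> - \<gamma>)) powr ?s"]
          unfolding split \<gamma>_def by auto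
      qed
    qed (use K0 v'0 \<Phi>' \<Phi>'0 in \<open>auto simp: S_def\<close>)
    also have "\<dots> \<le> ennreal (K powr p * (S powr p * L) * I)"
      unfolding \<Phi>'(3)
    proof (intro ennreal_leI mult_right_mono mult_left_mono I0)
      have "1 + S powr p / (?s * p + 1) \<le> S powr p + S powr p * (1 / (?s * p + 1))" using S1 by simp
      also have "\<dots> = S powr p * (1 + 1 / (?s * p + 1))" by (simp add: distrib_left)
      also have "\<dots> \<le> S powr p * L" using s(2) by (intro mult_left_mono) auto
      finally show "1 + S powr p / (?s * p + 1) \<le> S powr p * L" .
    qed auto
    finally show ?thesis .
  qed
  have [measurable]: "f \<in> borel_measurable borel" by (rule f)
  have mv: "(\<lambda>\<theta>. ennreal (v \<theta> powr p) * indicator {pi / 2..pi} \<theta>) \<in> borel_measurable borel"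
    unfolding v_def by measurable
  have L: "(\<integral>\<^sup>+\<theta>\<in>{0..pi / 2}. ennreal (v \<theta> powr p) \<partial>lborel) \<le> ennreal (K powr p * (S powr p * L) * I)"
  proof (rule half[OF v0 _ c\<Phi> slow I_def[symmetric] \<Phi>_def local_average_nonneg adm(1) a])
    fix \<theta> assume "\<theta> \<in> {0<..pi / 2}"
    then have "\<theta> \<in> {0<..<pi}" using pi_gt_zero by auto
    from vb[OF this] show "v \<theta> = 0 \<or> (\<delta> * sin \<theta> / 2 \<le> 1 - cos \<theta> \<and>
        v \<theta> \<le> (shifted_weight \<delta> e1 e2 (- cos \<theta>) * sin \<theta> powr \<kappa>) * (H * (C * 2 ^ M) * ?G \<theta>))" by blast
  qed (use M abM in \<open>auto simp: v_def\<close>)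
  have R: "(\<integral>\<^sup>+\<theta>\<in>{0..pi / 2}. ennreal (v (pi - \<theta>) powr p) \<partial>lborel) \<le> ennreal (K powr p * (S powr p * L) * I)"
  proof (rule half[OF v0 _ _ _ _ _ local_average_nonneg adm(2) b])
    show "continuous_on {0..pi} (\<lambda>\<theta>. \<Phi> (pi - \<theta>))"
      by (rule continuous_on_compose2[OF c\<Phi>]) (auto intro!: continuous_intros)
    show "\<Phi> (pi - \<theta>) \<le> S * \<Phi> (pi - \<tau>)" if "\<theta> \<in> {0..pi}" "\<tau> \<in> {0..pi}" "\<bar>\<theta> - \<tau>\<bar> \<le> 1 / real n" for \<theta> \<tau>
      using that by (intro slow) (auto simp: abs_minus_commute)
    show "integral {0..pi} (\<lambda>\<theta>. \<Phi> (pi - \<theta>) powr p) = I"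
      unfolding I_def using integral_reflect_pi[OF cp] by simp
    show "\<Phi> (pi - \<theta>) = endpoint_weight n b a \<theta> * ?G (pi - \<theta>)" for \<theta>
      by (simp add: \<Phi>_def endpoint_weight_reflect)
    fix \<theta> assume "\<theta> \<in> {0<..pi / 2}"
    then have th: "pi - \<theta> \<in> {0<..<pi}" using pi_gt_zero by auto
    have refl: "cos (pi - \<theta>) = - cos \<theta>" "sin (pi - \<theta>) = sin \<theta>" by (simp_all add: cos_diff sin_diff)
    have sw: "shifted_weight \<delta> e1 e2 (- cos (pi - \<theta>)) = shifted_weight \<delta> e2 e1 (- cos \<theta>)"
      using shifted_weight_reflect[of \<delta> e1 e2 "- cos \<theta>"] refl by simp
    from vb[OF th, unfolded sw, unfolded refl] show "v (pi - \<theta>) = 0 \<or> (\<delta> * sin \<theta> / 2 \<le> 1 - cos \<theta> \<and>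
        v (pi - \<theta>) \<le> (shifted_weight \<delta> e2 e1 (- cos \<theta>) * sin \<theta> powr \<kappa>) * (H * (C * 2 ^ M) * ?G (pi - \<theta>)))"
      by auto
  qed (use M abM in \<open>auto simp: v_def\<close>)
  have L2: "L \<ge> 1"
    using singular_exponent_bounds[OF p adm(1)] by (smt (verit) divide_pos_pos)
  show ?thesis
  proof (rule Lp_norm_leI[OF p])
    let ?c = "H * (upper_const q M * (2 * L) powr (1 / q)) * averaged_norm p q M n a b Q"
    have uc: "H * upper_const q M = K * S"
      using power_mult_distrib[of "2::real" 100 M] power_mult_distrib[of "200::real" 4 M]
      by (simp add: upper_const_def K_def S_def C_def)
    have av: "averaged_norm p q M n a b Q = I powr (1 / p)"
      by (simp add: averaged_norm_def I_def \<Phi>_def)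
    show "0 \<le> ?c" using H C1 by (simp add: upper_const_def C_def averaged_norm_def)
    have "(\<integral>\<^sup>+x. ennreal (\<bar>f x\<bar> powr p) \<partial>lebesgue_on {-1..1}) = (\<integral>\<^sup>+\<theta>\<in>{0..pi}. ennreal (v \<theta> powr p) \<partial>lborel)"
      unfolding v_def by (rule Lp_integral_cos_substitution[OF f p])
    also have "\<dots> \<le> (\<integral>\<^sup>+\<theta>. ennreal (v \<theta> powr p) * indicator {0..pi / 2} \<theta> + ennreal (v \<theta> powr p) * indicator
        {pi / 2..pi} \<theta> \<partial>lborel)"
      by (intro nn_integral_mono) (auto simp: indicator_def)
    also have "\<dots> = (\<integral>\<^sup>+\<theta>\<in>{0..pi / 2}. ennreal (v \<theta> powr p) \<partial>lborel) + (\<integral>\<^sup>+\<theta>\<in>{pi / 2..pi}. ennreal (v \<theta> powr p)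
        \<partial>lborel)"
      unfolding v_def by (intro nn_integral_add) measurable
    also have "(\<integral>\<^sup>+\<theta>\<in>{pi / 2..pi}. ennreal (v \<theta> powr p) \<partial>lborel) = (\<integral>\<^sup>+\<theta>\<in>{0..pi / 2}. ennreal (v (pi - \<theta>) powr
        p) \<partial>lborel)"
      by (subst nn_integral_reflect_pi[OF mv], intro nn_integral_cong) (auto simp: indicator_def)
    also have "(\<integral>\<^sup>+\<theta>\<in>{0..pi / 2}. ennreal (v \<theta> powr p) \<partial>lborel) + \<dots>
       \<le> ennreal (K powr p * (S powr p * L) * I) + ennreal (K powr p * (S powr p * L) * I)"
      by (rule add_mono[OF L R])
    also have "\<dots> = ennreal ((K * S) powr p * (2 * L) * I)"
      using L2 I0 by (subst ennreal_plus[symmetric]) (auto simp: powr_mult mult_ac)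
    also have "\<dots> \<le> ennreal (?c powr p)"
    proof (rule ennreal_leI)
      have "(2 * L) powr 1 \<le> (2 * L) powr (p / q)" using L2 q by (intro powr_mono) auto
      then have "(K * S) powr p * (2 * L) * I \<le> (K * S) powr p * (2 * L) powr (p / q) * I"
        using L2 I0 by (intro mult_right_mono mult_left_mono) auto
      also have "\<dots> = ((K * S) * (2 * L) powr (1 / q) * I powr (1 / p)) powr p"
        using p I0 by (simp add: powr_mult powr_powr)
      also have "(K * S) * (2 * L) powr (1 / q) * I powr (1 / p) = ?c"
        unfolding av uc[symmetric] by (simp add: mult_ac)
      finally show "(K * S) powr p * (2 * L) * I \<le> ?c powr p" .
    qed
    finally show "(\<integral>\<^sup>+x. ennreal (\<bar>f x\<bar> powr p) \<partial>lebesgue_on {-1..1}) \<le> ennreal (?c powr p)" .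
  qed
qed

definition lower_const :: "real \<Rightarrow> nat \<Rightarrow> real" where
  "lower_const q M = 2 powr (3 / q + 1 + M) * (2 * (1 + pi / inner_margin q M)) ^ M"

text \<open>
  At least \<open>c / n\<close> away from the ends the truncation of the endpoint weight is only a constant
  factor, so the bound by inner samples applies to the Jacobi weight.
\<close>
lemma averaged_norm_le_Lp_norm:
  fixes Q :: "real poly" and f :: "real \<Rightarrow> real" and q p a b \<alpha> \<beta> \<eta> :: real and m M n :: nat
  assumes q: "0 < q" "q \<le> 1" "q \<le> p" and n: "n \<ge> 1" and Q: "degree Q \<le> n"
    and a: "a = 2 * \<beta> + m + 1 / p" and b: "b = 2 * \<alpha> + m + 1 / p"
    and M: "\<bar>a\<bar> + \<bar>b\<bar> + 2 / q \<le> M" "\<bar>\<alpha> + \<beta> + m + 1 / p\<bar> \<le> M"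
    and f: "f \<in> borel_measurable borel" and \<eta>: "\<eta> > 0"
  defines "c \<equiv> inner_margin q M"
  assumes sample: "\<And>\<theta>. \<theta> \<in> {c / n..pi - c / n} \<Longrightarrow> \<exists>\<tau>\<in>{0..pi}. \<bar>\<tau> - \<theta>\<bar> \<le> pi * c / n \<and>
            jacobi_weight \<alpha> \<beta> (- cos \<theta>) * sin \<theta> ^ m * \<bar>poly Q (- cos \<tau>)\<bar> \<le> \<eta> * \<bar>f (- cos \<theta>)\<bar>"
  shows "ennreal (averaged_norm p q M n a b Q) \<le> ennreal (\<eta> * lower_const q M) * Lp_norm (ennreal p) {-1..1} f"
proof -
  define I where "I = integral {0..pi} (\<lambda>\<theta>. (endpoint_weight n a b \<theta> * local_average q M n (\<lambda>\<tau>. poly Q (- cos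
      \<tau>)) \<theta>) powr p)"
  define D where "D = 1 + pi / c"
  define K where "K = (2 * D) ^ M"
  define F where "F \<theta> = K * \<eta> * (\<bar>f (- cos \<theta>)\<bar> * sin \<theta> powr (1 / p))" for \<theta>
  have p: "p > 0" using q by simp
  have c0: "c > 0" "c \<le> 1 / 2" unfolding c_def using inner_margin_bounds[OF q(1)] by auto
  have D1: "D \<ge> 1" using c0 by (simp add: D_def)
  have K0: "K > 0" using D1 by (simp add: K_def)
  have [measurable]: "f \<in> borel_measurable borel" by (rule f)
  have F: "F \<in> borel_measurable borel" unfolding F_def[abs_def] by measurable
  have V: "endpoint_weight n a b \<theta> \<le> K * (jacobi_weight \<alpha> \<beta> (- cos \<theta>) * sin \<theta> ^ m * sin \<theta> powr (1 / p))"
    if \<theta>: "\<theta> \<in> {c / n..pi - c / n}" for \<theta>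
  proof -
    have cn: "0 < c / n" using c0 n by simp
    have th: "\<theta> \<in> {0..pi}" "0 < \<theta>" "\<theta> < pi" using \<theta> cn by auto
    define s where "s = sin (\<theta> / 2)"
    define u where "u = cos (\<theta> / 2)"
    have "\<theta> / pi \<le> s" unfolding s_def using th by (intro sin_half_ge) auto
    moreover have "c / n / pi \<le> \<theta> / pi" using \<theta> by (intro divide_right_mono) auto
    ultimately have s1: "c / n / pi \<le> s" by linarith
    have "(pi - \<theta>) / pi \<le> sin ((pi - \<theta>) / 2)" using th by (intro sin_half_ge) auto
    also have "sin ((pi - \<theta>) / 2) = u" by (simp add: u_def diff_divide_distrib sin_diff)
    finally have "(pi - \<theta>) / pi \<le> u" .
    moreover have "c / n / pi \<le> (pi - \<theta>) / pi" using \<theta> by (intro divide_right_mono) auto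
    ultimately have u1: "c / n / pi \<le> u" by linarith
    have cmp: "x + 1 / n \<le> D * x \<and> x \<le> D * (x + 1 / n) \<and> x > 0" if "c / n / pi \<le> x" for x
    proof -
      have x: "x > 0" using that cn by (meson divide_pos_pos less_le_trans pi_gt_zero)
      have "1 / n = pi / c * (c / n / pi)" using c0 by simp
      also have "\<dots> \<le> pi / c * x" using that c0 by (intro mult_left_mono) auto
      finally have "x + 1 / n \<le> D * x" by (simp add: D_def distrib_right)
      moreover have "1 * x \<le> D * (x + 1 / n)" using D1 x by (intro mult_mono) auto
      ultimately show ?thesis using x by simp
    qed
    have s: "s > 0" "(s + 1 / n) powr a \<le> D powr \<bar>a\<bar> * s powr a"
      using cmp[OF s1] by (auto intro!: powr_le_of_comparable add_pos_nonneg)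
    have u: "u > 0" "(u + 1 / n) powr b \<le> D powr \<bar>b\<bar> * u powr b"
      using cmp[OF u1] by (auto intro!: powr_le_of_comparable add_pos_nonneg)
    have "endpoint_weight n a b \<theta> \<le> (D powr \<bar>a\<bar> * s powr a) * (D powr \<bar>b\<bar> * u powr b)"
      unfolding endpoint_weight_def s_def[symmetric] u_def[symmetric] using s u by (intro mult_mono) auto
    also have "\<dots> = D powr (\<bar>a\<bar> + \<bar>b\<bar>) * (s powr a * u powr b)" by (simp add: powr_add)
    also have "\<dots> \<le> D powr M * (s powr a * u powr b)"
    proof (intro mult_right_mono powr_mono D1)
      have "0 \<le> 2 / q" using q by simp
      then show "\<bar>a\<bar> + \<bar>b\<bar> \<le> M" using M(1) by linarith
    qed auto
    finally have 1: "endpoint_weight n a b \<theta> \<le> D powr M * (s powr a * u powr b)" .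
    have e1: "1 - - cos \<theta> = 2 * u\<^sup>2" using cos_double_cos[of "\<theta> / 2"] by (simp add: u_def)
    have e2: "1 + - cos \<theta> = 2 * s\<^sup>2" using cos_double_sin[of "\<theta> / 2"] by (simp add: s_def)
    have e3: "sin \<theta> = 2 * (s * u)" using sin_double[of "\<theta> / 2"] by (simp add: s_def u_def)
    have "sin \<theta> ^ m * sin \<theta> powr (1 / p) = sin \<theta> powr (m + 1 / p)"
      using sin_gt_zero[of \<theta>] th by (simp add: powr_add powr_realpow)
    then have "jacobi_weight \<alpha> \<beta> (- cos \<theta>) * sin \<theta> ^ m * sin \<theta> powr (1 / p)
       = (2 * u\<^sup>2) powr \<alpha> * (2 * s\<^sup>2) powr \<beta> * (2 * (s * u)) powr (m + 1 / p)"
      unfolding jacobi_weight_def e1 e2 by (simp add: e3 mult.assoc)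
    also have "\<dots> = 2 powr (\<alpha> + \<beta> + m + 1 / p) * (s powr a * u powr b)"
    proof -
      have sq: "(2 * x\<^sup>2) powr e = 2 powr e * x powr (2 * e)" if "x > 0" for x e :: real
      proof -
        have "x\<^sup>2 = x powr 2" using that by simp
        then show ?thesis by (simp only: powr_mult powr_powr)
      qed
      have aa: "a = 2 * \<beta> + (m + 1 / p)" "b = 2 * \<alpha> + (m + 1 / p)" "\<alpha> + \<beta> + m + 1 / p = \<alpha> + \<beta> + (m + 1 / p)"
        by (simp_all add: a b)
      show ?thesis unfolding sq[OF s(1)] sq[OF u(1)] aa by (simp only: powr_mult powr_add mult_ac)
    qed
    finally have 2: "jacobi_weight \<alpha> \<beta> (- cos \<theta>) * sin \<theta> ^ m * sin \<theta> powr (1 / p)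
       = 2 powr (\<alpha> + \<beta> + m + 1 / p) * (s powr a * u powr b)" .
    have "1 \<le> 2 powr (M + (\<alpha> + \<beta> + m + 1 / p))" using M(2) by (intro ge_one_powr_ge_zero) auto
    also have "\<dots> = 2 powr M * 2 powr (\<alpha> + \<beta> + m + 1 / p)" by (rule powr_add)
    finally have 3: "1 \<le> 2 powr M * 2 powr (\<alpha> + \<beta> + m + 1 / p)" .
    have "D powr M * (s powr a * u powr b) * 1 \<le> D powr M * (s powr a * u powr b) * (2 powr M * 2 powr (\<alpha> + \<beta>
        + m + 1 / p))"
      using 3 by (intro mult_left_mono) auto
    also have "\<dots> = (2 powr M * D powr M) * (2 powr (\<alpha> + \<beta> + m + 1 / p) * (s powr a * u powr b))"
      by (simp only: mult_ac)
    also have "2 powr M * D powr M = K" using D1 by (simp add: K_def powr_realpow power_mult_distrib)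
    finally show ?thesis using 1 2 by simp
  qed
  have "ennreal I \<le> ennreal ((2 powr (3 / q + 1 + M)) powr p) * (\<integral>\<^sup>+\<theta>\<in>{0..pi}. ennreal (\<bar>F \<theta>\<bar> powr p) \<partial>lborel)"
    unfolding I_def
  proof (rule local_average_norm_le_inner_samples[OF q n Q M(1) F])
    fix \<theta> assume \<theta>: "\<theta> \<in> {inner_margin q M / n..pi - inner_margin q M / n}"
    obtain \<tau> where \<tau>: "\<tau> \<in> {0..pi}" "\<bar>\<tau> - \<theta>\<bar> \<le> pi * c / n"
       "jacobi_weight \<alpha> \<beta> (- cos \<theta>) * sin \<theta> ^ m * \<bar>poly Q (- cos \<tau>)\<bar> \<le> \<eta> * \<bar>f (- cos \<theta>)\<bar>"
      using sample[of \<theta>] \<theta> unfolding c_def by blast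
    have "endpoint_weight n a b \<theta> * \<bar>poly Q (- cos \<tau>)\<bar>
       \<le> K * (jacobi_weight \<alpha> \<beta> (- cos \<theta>) * sin \<theta> ^ m * sin \<theta> powr (1 / p)) * \<bar>poly Q (- cos \<tau>)\<bar>"
      using V[of \<theta>] \<theta> unfolding c_def by (intro mult_right_mono) auto
    also have "\<dots> = K * sin \<theta> powr (1 / p) * (jacobi_weight \<alpha> \<beta> (- cos \<theta>) * sin \<theta> ^ m * \<bar>poly Q (- cos \<tau>)\<bar>)"
      by (simp only: mult_ac)
    also have "\<dots> \<le> K * sin \<theta> powr (1 / p) * (\<eta> * \<bar>f (- cos \<theta>)\<bar>)"
      using \<tau>(3) K0 by (intro mult_left_mono) auto
    also have "\<dots> = \<bar>F \<theta>\<bar>" using K0 \<eta> by (simp add: F_def abs_mult mult_ac)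
    finally show "\<exists>\<tau>\<in>{0..pi}. \<bar>\<tau> - \<theta>\<bar> \<le> pi * inner_margin q M / n \<and>
        endpoint_weight n a b \<theta> * \<bar>poly Q (- cos \<tau>)\<bar> \<le> \<bar>F \<theta>\<bar>"
      using \<tau> unfolding c_def by blast
  qed
  also have "(\<integral>\<^sup>+\<theta>\<in>{0..pi}. ennreal (\<bar>F \<theta>\<bar> powr p) \<partial>lborel)
     = (\<integral>\<^sup>+\<theta>. ennreal ((K * \<eta>) powr p) * (ennreal ((\<bar>f (- cos \<theta>)\<bar> * sin \<theta> powr (1 / p)) powr p) * indicator
         {0..pi} \<theta>) \<partial>lborel)"
  proof (intro nn_integral_cong)
    fix \<theta> :: real
    have "\<bar>F \<theta>\<bar> powr p = (K * \<eta>) powr p * (\<bar>f (- cos \<theta>)\<bar> * sin \<theta> powr (1 / p)) powr p"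
      using K0 \<eta> unfolding F_def abs_mult by (simp only: powr_mult) (simp add: powr_mult)
    then show "ennreal (\<bar>F \<theta>\<bar> powr p) * indicator {0..pi} \<theta>
      = ennreal ((K * \<eta>) powr p) * (ennreal ((\<bar>f (- cos \<theta>)\<bar> * sin \<theta> powr (1 / p)) powr p) * indicator {0..pi} \<theta>)"
      by (simp only: ennreal_mult[OF powr_ge_zero powr_ge_zero] mult.assoc)
  qed
  also have "\<dots> = ennreal ((K * \<eta>) powr p) * (\<integral>\<^sup>+\<theta>\<in>{0..pi}. ennreal ((\<bar>f (- cos \<theta>)\<bar> * sin \<theta> powr (1 / p)) powr
      p) \<partial>lborel)"
    by (rule nn_integral_cmult) measurable
  also have "\<dots> = ennreal ((K * \<eta>) powr p) * (\<integral>\<^sup>+x. ennreal (\<bar>f x\<bar> powr p) \<partial>lebesgue_on {-1..1})"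
    by (simp only: Lp_integral_cos_substitution[OF f p])
  finally have main: "ennreal I \<le> ennreal ((\<eta> * lower_const q M) powr p) * (\<integral>\<^sup>+x. ennreal (\<bar>f x\<bar> powr p)
      \<partial>lebesgue_on {-1..1})"
  proof -
    assume h: "ennreal I \<le> ennreal ((2 powr (3 / q + 1 + M)) powr p) * (ennreal ((K * \<eta>) powr p)
        * (\<integral>\<^sup>+x. ennreal (\<bar>f x\<bar> powr p) \<partial>lebesgue_on {-1..1}))"
    have "\<eta> * lower_const q M = 2 powr (3 / q + 1 + M) * (K * \<eta>)"
      by (simp add: lower_const_def K_def D_def c_def)
    then have "(\<eta> * lower_const q M) powr p = (2 powr (3 / q + 1 + M)) powr p * (K * \<eta>) powr p"
      by (simp only: powr_mult)
    then have "ennreal ((\<eta> * lower_const q M) powr p) = ennreal ((2 powr (3 / q + 1 + M)) powr p) * ennreal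
        ((K * \<eta>) powr p)"
      by (simp only: ennreal_mult[OF powr_ge_zero powr_ge_zero])
    with h show ?thesis by (simp only: mult.assoc)
  qed
  have I0: "I \<ge> 0"
    unfolding I_def
  proof (rule hk_integral_nonneg)
    have "continuous_on {0..pi} (\<lambda>\<tau>. poly Q (- cos \<tau>))" by (intro continuous_intros)
    then show "(\<lambda>\<theta>. (endpoint_weight n a b \<theta> * local_average q M n (\<lambda>\<tau>. poly Q (- cos \<tau>)) \<theta>) powr p)
        integrable_on {0..pi}"
      using p endpoint_weight_pos[OF n] local_average_nonneg
      by (intro integrable_continuous_real continuous_on_powr' continuous_on_mult
          continuous_on_endpoint_weight[OF n]
           continuous_on_local_average[OF q(1)] continuous_on_const) (auto simp: less_imp_le)
  qed auto
  show ?thesis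
  proof (rule Lp_norm_geI[OF p])
    show "0 \<le> averaged_norm p q M n a b Q" by (simp add: averaged_norm_def)
    show "0 < \<eta> * lower_const q M"
      using \<eta> K0 by (simp add: lower_const_def K_def D_def c_def)
    have "averaged_norm p q M n a b Q powr p = I"
      using p I0 by (simp add: averaged_norm_def I_def[symmetric] powr_powr)
    then show "ennreal (averaged_norm p q M n a b Q powr p)
      \<le> ennreal ((\<eta> * lower_const q M) powr p) * (\<integral>\<^sup>+x. ennreal (\<bar>f x\<bar> powr p) \<partial>lebesgue_on {-1..1})"
      using main by simp
  qed
qed

section \<open>Differences of polynomials as sampled derivatives\<close>

text \<open>
  Factor \<open>cos \<theta> - cos \<tau>\<close> as \<open>2 sin ((\<theta> + \<tau>) / 2) sin ((\<tau> - \<theta>) / 2)\<close> and cancel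
  \<open>sin \<theta> \<le> 2 sin ((\<theta> + \<tau>) / 2)\<close>.
\<close>
lemma angle_distance_le:
  assumes \<theta>: "\<theta> \<in> {0<..<pi}" and \<tau>: "\<tau> \<in> {0..pi}" and d: "\<bar>cos \<theta> - cos \<tau>\<bar> \<le> d * sin \<theta>"
  shows "\<bar>\<tau> - \<theta>\<bar> \<le> pi * d"
proof -
  have s: "sin ((\<theta> + \<tau>) / 2) > 0" using \<theta> \<tau> by (intro sin_gt_zero) auto
  have "sin \<theta> \<le> sin \<theta> + sin \<tau>" using \<tau> sin_ge_zero[of \<tau>] by auto
  also have "\<dots> = 2 * sin ((\<theta> + \<tau>) / 2) * cos ((\<theta> - \<tau>) / 2)" by (rule sin_plus_sin)
  also have "\<dots> \<le> 2 * sin ((\<theta> + \<tau>) / 2) * 1" using s by (intro mult_left_mono) auto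
  finally have 1: "sin \<theta> \<le> 2 * sin ((\<theta> + \<tau>) / 2)" by simp
  have d0: "d \<ge> 0"
    using d sin_gt_zero[of \<theta>] \<theta> abs_ge_zero[of "cos \<theta> - cos \<tau>"]
    by (smt (verit) greaterThanLessThan_iff mult_neg_pos)
  have "\<bar>cos \<theta> - cos \<tau>\<bar> = 2 * sin ((\<theta> + \<tau>) / 2) * \<bar>sin ((\<tau> - \<theta>) / 2)\<bar>"
    using s by (simp add: cos_diff_cos abs_mult)
  then have "2 * sin ((\<theta> + \<tau>) / 2) * \<bar>sin ((\<tau> - \<theta>) / 2)\<bar> \<le> d * (2 * sin ((\<theta> + \<tau>) / 2))"
    using d mult_left_mono[OF 1 d0] by linarith
  then have 2: "\<bar>sin ((\<tau> - \<theta>) / 2)\<bar> \<le> d" using s by (simp add: mult.commute)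
  have "\<bar>\<tau> - \<theta>\<bar> / pi \<le> sin (\<bar>\<tau> - \<theta>\<bar> / 2)" using \<theta> \<tau> by (intro sin_half_ge) auto
  also have "sin (\<bar>\<tau> - \<theta>\<bar> / 2) = sin \<bar>(\<tau> - \<theta>) / 2\<bar>" by simp
  also have "sin \<bar>z\<bar> \<le> \<bar>sin z\<bar>" for z :: real by (cases "z \<ge> 0") auto
  finally have "\<bar>\<tau> - \<theta>\<bar> / pi \<le> d" using 2 by linarith
  then show ?thesis by (simp add: field_simps)
qed

text \<open>
  Stated for a sequence of successive derivatives, so that the induction hypothesis applies to
  \<open>g (x + d) - g x\<close>; one more mean value theorem converts the difference that remains.
\<close>
lemma forward_difference_mean_value:
  fixes g :: "nat \<Rightarrow> real \<Rightarrow> real"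
  assumes "\<And>i x. (g i has_real_derivative g (Suc i) x) (at x)" and "d \<ge> 0"
  shows "\<exists>\<xi>\<in>{y..y + k * d}. (\<Sum>i\<le>k. real (k choose i) * (-1) ^ (k - i) * g 0 (y + i * d)) = d ^ k * g k \<xi>"
  using assms(1)
proof (induction k arbitrary: g y)
  case 0
  then show ?case by auto
next
  case (Suc k)
  define u where "u i x = g i (x + d) - g i x" for i x
  have "(u i has_real_derivative u (Suc i) x) (at x)" for i x
    unfolding u_def by (intro DERIV_diff Suc.prems DERIV_shift[THEN iffD1])
  from Suc.IH[of u, OF this] obtain \<xi> where \<xi>: "\<xi> \<in> {y..y + k * d}"
    "(\<Sum>i\<le>k. real (k choose i) * (-1) ^ (k - i) * u 0 (y + i * d)) = d ^ k * u k \<xi>" by blast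
  have "(\<Sum>i\<le>k. real (k choose i) * (-1) ^ (k - i) * u 0 (y + i * d))
     = (\<Sum>i\<le>k. real (k choose i) * (-1) ^ (k - i) * g 0 (y + Suc i * d))
       - (\<Sum>i\<le>k. real (k choose i) * (-1) ^ (k - i) * g 0 (y + i * d))"
    by (simp add: u_def right_diff_distrib sum_subtractf algebra_simps)
  also have "\<dots> = (\<Sum>i\<le>Suc k. real (Suc k choose i) * (-1) ^ (Suc k - i) * g 0 (y + i * d))"
  proof -
    have "(\<Sum>i\<le>Suc k. real (Suc k choose i) * (-1) ^ (Suc k - i) * g 0 (y + i * d))
       = (-1) ^ Suc k * g 0 y + (\<Sum>i\<le>k. real (Suc k choose Suc i) * (-1) ^ (k - i) * g 0 (y + Suc i * d))"
      by (subst sum.atMost_Suc_shift) simp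
    also have "\<dots> = (-1) ^ Suc k * g 0 y + (\<Sum>i\<le>k. real (k choose Suc i) * (-1) ^ (k - i) * g 0 (y + Suc i * d))
        + (\<Sum>i\<le>k. real (k choose i) * (-1) ^ (k - i) * g 0 (y + Suc i * d))"
      by (simp add: distrib_right sum.distrib)
    also have "(\<Sum>i\<le>k. real (k choose Suc i) * (-1) ^ (k - i) * g 0 (y + Suc i * d))
        = (\<Sum>i<k. real (k choose Suc i) * (-1) ^ (k - i) * g 0 (y + Suc i * d))"
      by (intro sum.mono_neutral_right) (auto simp: not_less binomial_eq_0)
    also have "(-1) ^ Suc k * g 0 y + (\<Sum>i<k. real (k choose Suc i) * (-1) ^ (k - i) * g 0 (y + Suc i * d))
        = - (\<Sum>i\<le>k. real (k choose i) * (-1) ^ (k - i) * g 0 (y + i * d))"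
    proof -
      have "(\<Sum>i\<le>k. real (k choose i) * (-1) ^ (k - i) * g 0 (y + i * d))
         = (-1) ^ k * g 0 y + (\<Sum>i<k. real (k choose Suc i) * (-1) ^ (k - Suc i) * g 0 (y + Suc i * d))"
        by (subst sum.atMost_shift) simp
      moreover have "(\<Sum>i<k. real (k choose Suc i) * (-1) ^ (k - i) * g 0 (y + Suc i * d))
         = - (\<Sum>i<k. real (k choose Suc i) * (-1) ^ (k - Suc i) * g 0 (y + Suc i * d))"
        unfolding sum_negf[symmetric]
      proof (intro sum.cong refl)
        fix i assume "i \<in> {..<k}"
        then have "k - i = Suc (k - Suc i)" by auto
        then show "real (k choose Suc i) * (-1) ^ (k - i) * g 0 (y + Suc i * d)
          = - (real (k choose Suc i) * (-1) ^ (k - Suc i) * g 0 (y + Suc i * d))" by simp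
      qed
      ultimately show ?thesis by simp
    qed
    finally show ?thesis by simp
  qed
  finally have e: "(\<Sum>i\<le>Suc k. real (Suc k choose i) * (-1) ^ (Suc k - i) * g 0 (y + i * d)) = d ^ k * u k \<xi>"
    using \<xi>(2) by simp
  show ?case
  proof (cases "d = 0")
    case True
    then show ?thesis using e by (auto simp: u_def)
  next
    case False
    then have "\<exists>z. \<xi> < z \<and> z < \<xi> + d \<and> g k (\<xi> + d) - g k \<xi> = (\<xi> + d - \<xi>) * g (Suc k) z"
      using assms(2) by (intro MVT2 Suc.prems) auto
    then obtain z where z: "\<xi> < z" "z < \<xi> + d" "u k \<xi> = d * g (Suc k) z" by (auto simp: u_def)
    have "z \<in> {y..y + Suc k * d}" using z \<xi>(1) by (auto simp: algebra_simps)
    moreover have "d ^ k * u k \<xi> = d ^ Suc k * g (Suc k) z" using z(3) by simp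
    ultimately show ?thesis using e by metis
  qed
qed

lemma sym_diff_poly_mean_value:
  fixes P :: "real poly"
  assumes "d \<ge> 0" and "{x - k * d / 2..x + k * d / 2} \<subseteq> S"
  shows "\<exists>\<xi>. \<bar>\<xi> - x\<bar> \<le> k * d / 2 \<and> \<xi> \<in> S \<and> sym_diff k d (poly ((pderiv ^^ r) P)) x S
      = d ^ k * poly ((pderiv ^^ (k + r)) P) \<xi>"
proof -
  define g where "g i = poly ((pderiv ^^ (i + r)) P)" for i
  have "(g i has_real_derivative g (Suc i) x) (at x)" for i x
    unfolding g_def by (auto intro: poly_DERIV)
  from forward_difference_mean_value[of g, OF this assms(1), of "x - k * d / 2" k]
  obtain \<xi> where \<xi>: "\<xi> \<in> {x - k * d / 2..x - k * d / 2 + k * d}"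
    "(\<Sum>i\<le>k. real (k choose i) * (-1) ^ (k - i) * g 0 (x - k * d / 2 + i * d)) = d ^ k * g k \<xi>" by blast
  have "x - k * d / 2 + k * d = x + k * d / 2" by (simp add: field_simps)
  with \<xi>(1) have "\<xi> \<in> {x - k * d / 2..x + k * d / 2}" by simp
  moreover from this have "\<bar>\<xi> - x\<bar> \<le> k * d / 2" unfolding abs_le_iff atLeastAtMost_iff by linarith
  ultimately show ?thesis using assms(2) \<xi>(2)
    by (intro exI[of _ \<xi>]) (auto simp: sym_diff_def g_def)
qed

lemma sym_diff_sample:
  fixes P :: "real poly" and h :: real
  assumes \<theta>: "\<theta> \<in> {0<..<pi}" and h: "h \<ge> 0" and S: "S \<subseteq> {-1..1}"
    and inside: "{- cos \<theta> - k * (h * sin \<theta>) / 2..- cos \<theta> + k * (h * sin \<theta>) / 2} \<subseteq> S"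
  shows "\<exists>\<tau>\<in>{0..pi}. \<bar>\<tau> - \<theta>\<bar> \<le> pi * (k * h / 2) \<and>
      \<bar>sym_diff k (h * sin \<theta>) (poly ((pderiv ^^ r) P)) (- cos \<theta>) S\<bar>
        = h ^ k * sin \<theta> ^ k * \<bar>poly ((pderiv ^^ (k + r)) P) (- cos \<tau>)\<bar>"
proof -
  have s: "sin \<theta> > 0" using \<theta> by (intro sin_gt_zero) auto
  obtain \<xi> where \<xi>: "\<bar>\<xi> - - cos \<theta>\<bar> \<le> k * (h * sin \<theta>) / 2" "\<xi> \<in> S"
    "sym_diff k (h * sin \<theta>) (poly ((pderiv ^^ r) P)) (- cos \<theta>) S = (h * sin \<theta>) ^ k * poly ((pderiv ^^ (k
        + r)) P) \<xi>"
    using sym_diff_poly_mean_value[of "h * sin \<theta>" "- cos \<theta>" k S r P] h s inside by auto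
  have x: "- \<xi> \<in> {-1..1}" using \<xi>(2) S by auto
  define \<tau> where "\<tau> = arccos (- \<xi>)"
  have \<tau>: "\<tau> \<in> {0..pi}" "cos \<tau> = - \<xi>" using x by (auto simp: \<tau>_def arccos_lbound arccos_ubound)
  have "\<bar>\<tau> - \<theta>\<bar> \<le> pi * (k * h / 2)"
    using \<xi>(1) by (intro angle_distance_le[OF \<theta> \<tau>(1)]) (simp add: \<tau>(2) algebra_simps)
  moreover have "poly ((pderiv ^^ (k + r)) P) \<xi> = poly ((pderiv ^^ (k + r)) P) (- cos \<tau>)" using \<tau>(2) by simp
  ultimately show ?thesis
    using \<tau>(1) \<xi>(3) h s by (intro bexI[of _ \<tau>]) (auto simp: abs_mult power_mult_distrib power_abs)
qed

lemma phi_measurable [measurable]: "phi \<in> borel_measurable borel"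
  unfolding phi_def[abs_def] by measurable

lemma jacobi_weight_measurable [measurable]: "jacobi_weight \<alpha> \<beta> \<in> borel_measurable borel"
  unfolding jacobi_weight_def[abs_def] by measurable

lemma shifted_weight_measurable [measurable]: "shifted_weight \<delta> \<xi> \<zeta> \<in> borel_measurable borel"
  unfolding shifted_weight_def[abs_def] by measurable

lemma poly_borel_measurable [measurable]: "poly P \<in> borel_measurable borel" for P :: "real poly"
  by (intro borel_measurable_continuous_onI continuous_intros)

lemma sym_diff_measurable [measurable]:
  "(\<lambda>x. sym_diff k (h * phi x) (poly P) x {u..v}) \<in> borel_measurable borel" for P :: "real poly"
  unfolding sym_diff_def atLeastatMost_subset_iff
  by measurable

lemma sym_diff_eq_of_subset:
  assumes "S \<subseteq> T" "sym_diff k d g x S \<noteq> 0"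
  shows "sym_diff k d g x T = sym_diff k d g x S"
  using assms by (auto simp: sym_diff_def split: if_splits)

lemma sym_diff_nonzero_imp_mem:
  assumes "sym_diff k d g x S \<noteq> 0" "d \<ge> 0"
  shows "x \<in> S"
proof -
  have "{x - real k * d / 2..x + real k * d / 2} \<subseteq> S" using assms(1) by (auto simp: sym_diff_def split: if_splits)
  then show ?thesis using assms(2) by auto
qed

lemma phi_nonneg: "x \<in> {-1..1} \<Longrightarrow> phi x \<ge> 0"
  by (auto simp: phi_def power_le_one_iff abs_square_le_1 abs_le_iff)

lemma main_interval_subset: "A \<ge> 0 \<Longrightarrow> main_interval A h \<subseteq> {-1..1}"
  by (auto simp: main_interval_def)

lemma shifted_weight_zero:
  assumes "\<theta> \<in> {0<..<pi}"
  shows "shifted_weight 0 (real r / 2 + \<alpha>) (real r / 2 + \<beta>) (- cos \<theta>) = jacobi_weight \<alpha> \<beta> (- cos \<theta>) * sin \<theta> ^ r"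
proof -
  have s: "sin \<theta> > 0" using assms by (intro sin_gt_zero) auto
  have c: "cos \<theta> < 1" "-1 < cos \<theta>"
  proof -
    have "(cos \<theta>)\<^sup>2 < 1" using sin_cos_squared_add[of \<theta>] zero_less_power[OF s, of 2] by linarith
    then have "\<bar>cos \<theta>\<bar> < 1" by (simp add: abs_square_less_1)
    then show "cos \<theta> < 1" "-1 < cos \<theta>" by auto
  qed
  have "(1 + cos \<theta>) * (1 - cos \<theta>) = (sin \<theta>)\<^sup>2"
    using sin_cos_squared_add[of \<theta>] by (simp add: power2_eq_square algebra_simps)
  then have "(1 + cos \<theta>) powr (real r / 2) * (1 - cos \<theta>) powr (real r / 2) = ((sin \<theta>)\<^sup>2) powr (real r / 2)"
    by (simp only: powr_mult[symmetric])
  also have "(sin \<theta>)\<^sup>2 = sin \<theta> powr 2" using s by simp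
  also have "(sin \<theta> powr 2) powr (real r / 2) = sin \<theta> powr real r" by (simp only: powr_powr) simp
  also have "sin \<theta> powr real r = sin \<theta> ^ r" using s by (rule powr_realpow)
  finally have e: "(1 + cos \<theta>) powr (real r / 2) * (1 - cos \<theta>) powr (real r / 2) = sin \<theta> ^ r" .
  show ?thesis
    unfolding shifted_weight_def jacobi_weight_def e[symmetric] by (simp add: powr_add mult_ac)
qed

text \<open>
  At angular distance \<open>c / n\<close> from the ends both \<open>1 - x\<close> and \<open>1 + x\<close> are at least
  \<open>2 (c / (n \<pi>))\<^sup>2\<close>, and each of the two quantities that are to fit into this gap takes at most half
  of it.
\<close>
lemma inner_point_margin:
  fixes A c h \<theta> :: real and k n :: nat
  assumes n: "n \<ge> 1" and c: "0 < c" and \<theta>: "\<theta> \<in> {c / n..pi - c / n}" and h: "0 \<le> h"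
    and kh: "k * h \<le> c / n / pi" and Ah: "A * h\<^sup>2 \<le> (c / n / pi)\<^sup>2"
  shows "\<theta> \<in> {0<..<pi}"
    and "k * (h * sin \<theta>) / 2 \<le> (1 - cos \<theta>) / 2" "k * (h * sin \<theta>) / 2 \<le> (1 + cos \<theta>) / 2"
    and "A * h\<^sup>2 \<le> (1 - cos \<theta>) / 2" "A * h\<^sup>2 \<le> (1 + cos \<theta>) / 2"
proof -
  have cn: "0 < c / n" using c n by simp
  then have z0: "0 < c / n / pi" by (rule divide_pos_pos) simp
  show th: "\<theta> \<in> {0<..<pi}" using \<theta> cn by auto
  define s where "s = sin (\<theta> / 2)"
  define u where "u = cos (\<theta> / 2)"
  have "\<theta> / pi \<le> s" unfolding s_def using th by (intro sin_half_ge) auto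
  moreover have "c / n / pi \<le> \<theta> / pi" using \<theta> by (intro divide_right_mono) auto
  ultimately have s1: "c / n / pi \<le> s" by linarith
  have "(pi - \<theta>) / pi \<le> sin ((pi - \<theta>) / 2)" using th by (intro sin_half_ge) auto
  also have "sin ((pi - \<theta>) / 2) = u" by (simp add: u_def diff_divide_distrib sin_diff)
  finally have "(pi - \<theta>) / pi \<le> u" .
  moreover have "c / n / pi \<le> (pi - \<theta>) / pi" using \<theta> by (intro divide_right_mono) auto
  ultimately have u1: "c / n / pi \<le> u" by linarith
  have s0: "0 < s" "0 < u" "s \<le> 1" "u \<le> 1" using s1 u1 z0 by (auto simp: s_def u_def)
  have e1: "1 + cos \<theta> = 2 * u\<^sup>2" using cos_double_cos[of "\<theta> / 2"] by (simp add: u_def)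
  have e2: "1 - cos \<theta> = 2 * s\<^sup>2" using cos_double_sin[of "\<theta> / 2"] by (simp add: s_def)
  have e3: "sin \<theta> = 2 * (s * u)" using sin_double[of "\<theta> / 2"] by (simp add: s_def u_def)
  have "(k * h) * (s * u) \<le> s * (s * 1)" using kh s1 s0 h by (intro mult_mono) auto
  then show "k * (h * sin \<theta>) / 2 \<le> (1 - cos \<theta>) / 2" unfolding e2 e3 by (simp add: power2_eq_square mult_ac)
  have "(k * h) * (s * u) \<le> u * (1 * u)" using kh u1 s0 h by (intro mult_mono) auto
  then show "k * (h * sin \<theta>) / 2 \<le> (1 + cos \<theta>) / 2" unfolding e1 e3 by (simp add: power2_eq_square mult_ac)
  have "(c / n / pi)\<^sup>2 \<le> s\<^sup>2" "(c / n / pi)\<^sup>2 \<le> u\<^sup>2" using s1 u1 z0 by (auto intro!: power_mono)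
  then show "A * h\<^sup>2 \<le> (1 - cos \<theta>) / 2" "A * h\<^sup>2 \<le> (1 + cos \<theta>) / 2" using Ah unfolding e1 e2 by auto
qed

lemma shifted_weight_inner_ge:
  fixes \<xi> \<zeta> \<delta> \<theta> :: real
  assumes \<theta>: "\<theta> \<in> {0<..<pi}" and \<delta>: "0 \<le> \<delta>"
    and "\<delta> * sin \<theta> / 2 \<le> (1 - cos \<theta>) / 2" "\<delta> * sin \<theta> / 2 \<le> (1 + cos \<theta>) / 2"
    and M: "\<bar>\<xi>\<bar> + \<bar>\<zeta>\<bar> \<le> real M"
  shows "shifted_weight 0 \<xi> \<zeta> (- cos \<theta>) \<le> 2 ^ M * shifted_weight \<delta> \<xi> \<zeta> (- cos \<theta>)"
proof -
  have s: "sin \<theta> > 0" using \<theta> by (intro sin_gt_zero) auto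
  have "(cos \<theta>)\<^sup>2 < 1" using sin_cos_squared_add[of \<theta>] zero_less_power[OF s, of 2] by linarith
  then have "\<bar>cos \<theta>\<bar> < 1" by (simp add: abs_square_less_1)
  then have c: "0 < 1 - cos \<theta>" "0 < 1 + cos \<theta>" by auto
  have d: "0 \<le> \<delta> * sin \<theta> / 2" using \<delta> s by simp
  have ph: "phi (- cos \<theta>) = sin \<theta>" using \<theta> by (intro phi_minus_cos) auto
  have gen: "X powr e \<le> 2 powr \<bar>e\<bar> * (X - y) powr e" if "0 < X" "0 \<le> y" "y \<le> X / 2" for X y e :: real
    using that by (intro powr_le_of_comparable) auto
  have 1: "(1 - - cos \<theta>) powr \<xi> \<le> 2 powr \<bar>\<xi>\<bar> * (1 - - cos \<theta> - \<delta> * sin \<theta> / 2) powr \<xi>"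
    using c d assms(4) by (intro gen) auto
  have 2: "(1 + - cos \<theta>) powr \<zeta> \<le> 2 powr \<bar>\<zeta>\<bar> * (1 + - cos \<theta> - \<delta> * sin \<theta> / 2) powr \<zeta>"
    using c d assms(3) by (intro gen) auto
  have "shifted_weight 0 \<xi> \<zeta> (- cos \<theta>) \<le> 2 powr (\<bar>\<xi>\<bar> + \<bar>\<zeta>\<bar>) * shifted_weight \<delta> \<xi> \<zeta> (- cos \<theta>)"
    using mult_mono[OF 1 2] by (simp add: shifted_weight_def ph powr_add mult_ac)
  also have "\<dots> \<le> 2 powr real M * shifted_weight \<delta> \<xi> \<zeta> (- cos \<theta>)"
    using M by (intro mult_right_mono powr_mono) (auto simp: shifted_weight_def)
  finally show ?thesis by (simp add: powr_realpow)
qed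

section \<open>Constants that are uniform in the exponent\<close>

text \<open>
  The decay order of the local averages: it exceeds every sum of weight exponents that occurs, for
  all \<open>p \<ge> q\<close> at once.
\<close>
definition decay_order :: "real \<Rightarrow> real \<Rightarrow> real \<Rightarrow> nat \<Rightarrow> nat" where
  "decay_order \<alpha> \<beta> q m = nat \<lceil>2 * \<bar>\<alpha>\<bar> + 2 * \<bar>\<beta>\<bar> + 2 * m + 4 / q\<rceil>"

lemma decay_order_bounds:
  fixes \<alpha> \<beta> p q :: real and k m r :: nat
  assumes q: "0 < q" "q \<le> p" and kr: "k + r = m"
  defines "M \<equiv> decay_order \<alpha> \<beta> q m"
  shows "\<bar>2 * \<beta> + m + 1 / p\<bar> + \<bar>2 * \<alpha> + m + 1 / p\<bar> + 2 / q \<le> M"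
    and "\<bar>r / 2 + \<alpha>\<bar> + \<bar>r / 2 + \<beta>\<bar> + (k + 1 / p) \<le> M"
    and "\<bar>\<alpha> + \<beta> + m + 1 / p\<bar> \<le> M"
proof -
  have p: "0 < 1 / p" "1 / p \<le> 1 / q" using q by (auto simp: frac_le)
  have M: "2 * \<bar>\<alpha>\<bar> + 2 * \<bar>\<beta>\<bar> + 2 * m + 4 * (1 / q) \<le> M"
    unfolding M_def decay_order_def by (rule order_trans[OF _ real_nat_ceiling_ge]) simp
  have kr': "real k + real r = real m" using kr by (metis of_nat_add)
  have 2: "2 / q = 2 * (1 / q)" by simp
  show "\<bar>2 * \<beta> + m + 1 / p\<bar> + \<bar>2 * \<alpha> + m + 1 / p\<bar> + 2 / q \<le> M"
    using M p unfolding 2 by linarith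
  show "\<bar>r / 2 + \<alpha>\<bar> + \<bar>r / 2 + \<beta>\<bar> + (k + 1 / p) \<le> M" using M p kr' by linarith
  show "\<bar>\<alpha> + \<beta> + m + 1 / p\<bar> \<le> M" using M p by linarith
qed

text \<open>
  The finite exponents \<open>p\<close> with \<open>min 1 p = q\<close>, for \<open>0 < q \<le> 1\<close>, that allow the weight.
\<close>
definition admissible_exponent :: "real \<Rightarrow> real \<Rightarrow> real \<Rightarrow> real \<Rightarrow> bool" where
  "admissible_exponent \<alpha> \<beta> q p \<longleftrightarrow> q \<le> p \<and> (q = 1 \<or> p = q) \<and> - (1 / p) < \<alpha> \<and> - (1 / p) < \<beta>"

text \<open>
  A value of \<open>L\<close> that serves both ends. The absolute values keep it above \<open>2\<close> for all arguments,
  also for those at which the singularities are not integrable.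
\<close>
definition singularity_bound :: "real \<Rightarrow> real \<Rightarrow> real \<Rightarrow> real" where
  "singularity_bound \<alpha> \<beta> p = 2 + \<bar>1 / (\<alpha> * p + 1)\<bar> + \<bar>1 / (\<beta> * p + 1)\<bar>"

lemma singularity_bound_ge: "singularity_bound \<alpha> \<beta> p \<ge> 2" "1 + \<bar>1 / (\<beta> * p + 1)\<bar> \<le> singularity_bound \<alpha> \<beta> p"
    "1 + \<bar>1 / (\<alpha> * p + 1)\<bar> \<le> singularity_bound \<alpha> \<beta> p"
  by (simp_all add: singularity_bound_def)

text \<open>
  If the angular exponent \<open>2 \<beta> + m + 1/p\<close> is negative then \<open>p < 1\<close>, because
  \<open>2 \<beta> + m + 1/p > m - 1/p\<close> and \<open>m \<ge> 1\<close>. Hence a singularity occurs for the single exponent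
  \<open>p = q\<close> at most, and \<open>L\<close> can be chosen in terms of \<open>q\<close>.
\<close>
lemma endpoint_admissible_unshifted:
  assumes q: "0 < q" "q \<le> 1" "q \<le> p" "q = 1 \<or> p = q" and \<beta>: "- (1 / p) < \<beta>" and k: "k \<ge> 1"
    and L: "2 \<le> L" "1 + \<bar>1 / (\<beta> * q + 1)\<bar> \<le> L"
  shows "endpoint_admissible p 0 (real r / 2 + \<beta>) (2 * (real r / 2 + \<beta>) + (real k + 1 / p)) L"
proof (cases "2 * (real r / 2 + \<beta>) + (real k + 1 / p) \<ge> 0")
  case True
  then show ?thesis using L by (simp add: endpoint_admissible_def)
next
  case False
  have p: "p > 0" using q by simp
  have "q \<noteq> 1"
  proof
    assume "q = 1"
    then have "1 / p \<le> 1" using q by simp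
    then show False using False \<beta> k by simp
  qed
  then have pq: "p = q" using q by simp
  have b: "0 < \<beta> * q + 1" using \<beta> p unfolding pq by (simp add: field_simps)
  have "\<beta> * q + 1 \<le> (real r / 2 + \<beta>) * p + 1" using p pq by simp
  then have "1 / ((real r / 2 + \<beta>) * p + 1) \<le> 1 / (\<beta> * q + 1)" using b
      by (intro divide_left_mono mult_pos_pos) auto
  then have "1 + 1 / ((real r / 2 + \<beta>) * p + 1) \<le> L" using L(2) by linarith
  moreover have "real r / 2 + \<beta> < 0" using False p by (smt (verit) divide_pos_pos of_nat_0_le_iff)
  moreover have "- (1 / p) < real r / 2 + \<beta>" using \<beta> by (smt (verit) divide_nonneg_pos of_nat_0_le_iff)
  ultimately show ?thesis by (simp add: endpoint_admissible_def)
qed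

text \<open>
  For \<open>r \<ge> 1\<close> and \<open>p \<ge> 1\<close> the condition \<open>\<beta> > - 1/p\<close> gives \<open>(r/2 + \<beta>) p + 1 > p/2 \<ge> 1/2\<close>, so the
  singularity is uniformly integrable. For \<open>r = 0\<close> it degenerates as \<open>p\<close> increases to
  \<open>- 1/\<beta>\<close>, and \<open>L\<close> has to depend on \<open>p\<close>.
\<close>
lemma endpoint_admissible_shifted:
  assumes q: "0 < q" "q \<le> 1" "q \<le> p" "q = 1 \<or> p = q" and \<beta>: "- (1 / p) < \<beta>"
    and L: "3 \<le> L" "1 + \<bar>1 / (\<beta> * q + 1)\<bar> \<le> L"
    and r0: "r = 0 \<Longrightarrow> \<beta> < 0 \<Longrightarrow> 1 + \<bar>1 / (\<beta> * p + 1)\<bar> \<le> L"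
  shows "endpoint_admissible p \<delta> (real r / 2 + \<beta>) (2 * (real r / 2 + \<beta>) + (real k + 1 / p)) L"
proof (cases "real r / 2 + \<beta> \<ge> 0")
  case True
  have "1 / p > 0" using q by simp
  then show ?thesis using L True by (simp add: endpoint_admissible_def)
next
  case False
  have p: "p > 0" using q by simp
  have e1: "- (1 / p) < real r / 2 + \<beta>" using \<beta> by (smt (verit) divide_nonneg_pos of_nat_0_le_iff)
  have "1 + 1 / ((real r / 2 + \<beta>) * p + 1) \<le> L"
  proof (cases "r = 0")
    case True
    then have "1 + \<bar>1 / (\<beta> * p + 1)\<bar> \<le> L" using r0 False by simp
    then have "1 + 1 / (\<beta> * p + 1) \<le> L" by linarith
    then show ?thesis by (simp add: True)
  next
    case r: False
    show ?thesis
      using q(4)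
    proof
      assume q1: "q = 1"
      have "1 / 2 + \<beta> \<le> real r / 2 + \<beta>" using r by simp
      then have "(1 / 2 - 1 / p) * p \<le> (real r / 2 + \<beta>) * p" using \<beta> p by (intro mult_right_mono) auto
      moreover have "(1 / 2 - 1 / p) * p = p / 2 - 1" using p by (simp add: field_simps)
      ultimately have "1 / 2 \<le> (real r / 2 + \<beta>) * p + 1" using q q1 by simp
      then have "1 / ((real r / 2 + \<beta>) * p + 1) \<le> 1 / (1 / 2)" by (intro divide_left_mono mult_pos_pos) auto
      then show ?thesis using L(1) by simp
    next
      assume pq: "p = q"
      have b: "0 < \<beta> * q + 1" using \<beta> p unfolding pq by (simp add: field_simps)
      have "\<beta> * q + 1 \<le> (real r / 2 + \<beta>) * p + 1" using p pq by simp
      then have "1 / ((real r / 2 + \<beta>) * p + 1) \<le> 1 / (\<beta> * q + 1)" using b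
          by (intro divide_left_mono mult_pos_pos) auto
      then show ?thesis using L(2) by linarith
    qed
  qed
  then show ?thesis using False e1 by (simp add: endpoint_admissible_def)
qed

definition comparison_const :: "real \<Rightarrow> real \<Rightarrow> real \<Rightarrow> nat \<Rightarrow> real \<Rightarrow> real" where
  "comparison_const \<alpha> \<beta> q m L =
     upper_const q (decay_order \<alpha> \<beta> q m) * (2 * L) powr (1 / q) * lower_const q (decay_order \<alpha> \<beta> q m)"

lemma lower_const_pos: "q > 0 \<Longrightarrow> lower_const q M > 0"
  using inner_margin_bounds(1)[of q M] by (auto simp: lower_const_def add_pos_pos intro!: mult_pos_pos
      zero_less_power)

lemma upper_const_pos: "q > 0 \<Longrightarrow> upper_const q M > 0"
  using local_bound_const_ge_one[of q M] by (auto simp: upper_const_def intro!: mult_pos_pos)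

lemma comparison_const_pos: "q > 0 \<Longrightarrow> L > 0 \<Longrightarrow> comparison_const \<alpha> \<beta> q m L > 0"
  unfolding comparison_const_def by (intro mult_pos_pos upper_const_pos lower_const_pos) auto

lemma through_averaged_norm:
  fixes R x y :: real
  assumes "X \<le> ennreal (x * R)" "ennreal R \<le> ennreal y * Y" "0 \<le> x" "0 \<le> y"
  shows "X \<le> ennreal (x * y) * Y"
proof -
  have "X \<le> ennreal x * ennreal R" using assms(1,3) by (simp add: ennreal_mult')
  also have "\<dots> \<le> ennreal x * (ennreal y * Y)" by (intro mult_left_mono assms(2)) simp
  finally show ?thesis using assms by (simp add: ennreal_mult mult.assoc)
qed

section \<open>The moduli at a fixed step\<close>

abbreviation "derivative_fun \<alpha> \<beta> m P \<equiv> (\<lambda>x. jacobi_weight \<alpha> \<beta> x * phi x ^ m * poly ((pderiv ^^ m) P) x)"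

abbreviation "Psi_fun \<alpha> \<beta> k r P h \<equiv>
  (\<lambda>x. jacobi_weight \<alpha> \<beta> x * phi x ^ r * sym_diff k (h * phi x) (poly ((pderiv ^^ r) P)) x {-1..1})"

abbreviation "Omega_fun \<alpha> \<beta> k r P A h \<equiv>
  (\<lambda>x. jacobi_weight \<alpha> \<beta> x * phi x ^ r * sym_diff k (h * phi x) (poly ((pderiv ^^ r) P)) x (main_interval A h))"

abbreviation "omega_fun \<alpha> \<beta> k r P h \<equiv>
  (\<lambda>x. shifted_weight (real k * h) (real r / 2 + \<alpha>) (real r / 2 + \<beta>) x *
     sym_diff k (h * phi x) (poly ((pderiv ^^ r) P)) x {-1..1})"

text \<open>
  All estimates of this block are for one finite exponent, one polynomial and one step \<open>h\<close>.
\<close>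
context
  fixes \<alpha> \<beta> q p :: real and m n k r :: nat and P :: "real poly"
  assumes q: "0 < q" "q \<le> 1" and adm: "admissible_exponent \<alpha> \<beta> q p"
    and n: "n \<ge> 1" and P: "degree P \<le> n - 1" and k: "k \<ge> 1" and kr: "k + r = m"
begin

lemma admissible_exponentD: "q \<le> p" "q = 1 \<or> p = q" "- (1 / p) < \<alpha>" "- (1 / p) < \<beta>" "p > 0"
  using adm q by (auto simp: admissible_exponent_def)

abbreviation "M0 \<equiv> decay_order \<alpha> \<beta> q m"

abbreviation "c0 \<equiv> inner_margin q M0"

abbreviation "R \<equiv> averaged_norm p q M0 n (2 * \<beta> + m + 1 / p) (2 * \<alpha> + m + 1 / p) ((pderiv ^^ m) P)"

lemma degree_deriv: "degree ((pderiv ^^ m) P) \<le> n"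
proof -
  have "degree ((pderiv ^^ j) P) \<le> degree P" for j
    by (induction j) (auto simp: degree_pderiv)
  then show ?thesis using P by (meson diff_le_self order_trans)
qed

lemma exponents_eq: "2 * \<beta> + m + 1 / p = 2 * (real r / 2 + \<beta>) + (k + 1 / p)" "2 * \<alpha> + m + 1 / p
    = 2 * (real r / 2 + \<alpha>) + (k + 1 / p)"
  using kr by auto

text \<open>
  The case \<open>\<delta> = 0\<close> belongs to \<open>\<Psi>\<close>, the case \<open>\<delta> = k h\<close> to \<open>\<omega>\<close>. Where the difference does not
  vanish, its interval lies in \<open>[-1, 1]\<close>, which is exactly the condition that the bases of the
  shifted weight are nonnegative.
\<close>
lemma weighted_difference_le:
  fixes W :: "real \<Rightarrow> real" and h \<delta> L :: real
  assumes h: "0 \<le> h" "k * h \<le> 1 / (2 * real n)" and \<delta>: "\<delta> = 0 \<or> \<delta> = k * h"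
    and W: "W \<in> borel_measurable borel" "\<And>\<theta>. \<theta> \<in> {0<..<pi} \<Longrightarrow> W (- cos \<theta>) = shifted_weight \<delta> (real r / 2
        + \<alpha>) (real r / 2 + \<beta>) (- cos \<theta>)"
    and L: "endpoint_admissible p \<delta> (real r / 2 + \<beta>) (2 * (real r / 2 + \<beta>) + (real k + 1 / p)) L"
      "endpoint_admissible p \<delta> (real r / 2 + \<alpha>) (2 * (real r / 2 + \<alpha>) + (real k + 1 / p)) L"
  shows "Lp_norm (ennreal p) {-1..1} (\<lambda>x. W x * sym_diff k (h * phi x) (poly ((pderiv ^^ r) P)) x {-1..1})
    \<le> ennreal (h ^ k * (upper_const q M0 * (2 * L) powr (1 / q)) * R)"
  unfolding exponents_eq
proof (rule Lp_norm_le_averaged_norm[OF q admissible_exponentD(1) n degree_deriv refl refl refl _ _ _ _ L])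
  note b = decay_order_bounds[OF q(1) admissible_exponentD(1) kr, where \<alpha> = \<alpha> and \<beta> = \<beta>]
  show "\<bar>2 * (real r / 2 + \<beta>) + (k + 1 / p)\<bar> + \<bar>2 * (real r / 2 + \<alpha>) + (k + 1 / p)\<bar> + 2 / q \<le> M0"
    using b(1) unfolding exponents_eq .
  show "\<bar>real r / 2 + \<alpha>\<bar> + \<bar>real r / 2 + \<beta>\<bar> + (k + 1 / p) \<le> M0" by (rule b(2))
  show "0 \<le> \<delta>" "\<delta> \<le> 1 / (2 * real n)" using \<delta> h by auto
  show "(\<lambda>x. W x * sym_diff k (h * phi x) (poly ((pderiv ^^ r) P)) x {-1..1}) \<in> borel_measurable borel"
    using W(1) by measurable
  show "0 \<le> h ^ k" using h by simp
  fix \<theta> assume \<theta>: "\<theta> \<in> {0<..<pi}"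
  have s: "sin \<theta> > 0" using \<theta> by (intro sin_gt_zero) auto
  have ph: "phi (- cos \<theta>) = sin \<theta>" using \<theta> by (intro phi_minus_cos) auto
  show "W (- cos \<theta>) * sym_diff k (h * phi (- cos \<theta>)) (poly ((pderiv ^^ r) P)) (- cos \<theta>) {-1..1} = 0 \<or>
    \<delta> * sin \<theta> / 2 \<le> 1 - cos \<theta> \<and> \<delta> * sin \<theta> / 2 \<le> 1 + cos \<theta> \<and>
    (\<exists>\<tau>\<in>{0..pi}. \<bar>\<tau> - \<theta>\<bar> \<le> 1 / n \<and>
      \<bar>W (- cos \<theta>) * sym_diff k (h * phi (- cos \<theta>)) (poly ((pderiv ^^ r) P)) (- cos \<theta>) {-1..1}\<bar>
      \<le> shifted_weight \<delta> (real r / 2 + \<alpha>) (real r / 2 + \<beta>) (- cos \<theta>) *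
        (h ^ k * sin \<theta> ^ k * \<bar>poly ((pderiv ^^ m) P) (- cos \<tau>)\<bar>))"
  proof (cases "{- cos \<theta> - k * (h * sin \<theta>) / 2..- cos \<theta> + k * (h * sin \<theta>) / 2} \<subseteq> {-1..1}")
    case False
    have "sym_diff k (h * phi (- cos \<theta>)) (poly ((pderiv ^^ r) P)) (- cos \<theta>) {-1..1} = 0"
      unfolding sym_diff_def ph by (rule if_not_P[OF False])
    then show ?thesis by simp
  next
    case True
    have d: "0 \<le> k * (h * sin \<theta>)" using h s by simp
    then have io: "k * (h * sin \<theta>) / 2 \<le> 1 - cos \<theta>" "k * (h * sin \<theta>) / 2 \<le> 1 + cos \<theta>"
      using True by (auto simp: atLeastatMost_subset_iff)
    have cond: "\<delta> * sin \<theta> / 2 \<le> 1 - cos \<theta>" "\<delta> * sin \<theta> / 2 \<le> 1 + cos \<theta>"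
      using \<delta> io d by (auto simp: mult.assoc)
    obtain \<tau> where \<tau>: "\<tau> \<in> {0..pi}" "\<bar>\<tau> - \<theta>\<bar> \<le> pi * (k * h / 2)"
      "\<bar>sym_diff k (h * sin \<theta>) (poly ((pderiv ^^ r) P)) (- cos \<theta>) {-1..1}\<bar>
        = h ^ k * sin \<theta> ^ k * \<bar>poly ((pderiv ^^ (k + r)) P) (- cos \<tau>)\<bar>"
      using sym_diff_sample[OF \<theta> h(1) order_refl True] by blast
    have "pi * (k * h / 2) \<le> 4 * (1 / (2 * real n) / 2)"
      using h pi_less_4 by (intro mult_mono divide_right_mono) auto
    then have "\<bar>\<tau> - \<theta>\<bar> \<le> 1 / n" using \<tau>(2) by simp
    moreover have "W (- cos \<theta>) \<ge> 0" unfolding W(2)[OF \<theta>] by (simp add: shifted_weight_def)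
    ultimately show ?thesis using \<tau> cond W(2)[OF \<theta>] kr by (auto simp: ph abs_mult)
  qed
qed

lemma averaged_norm_le_derivative_norm:
  "ennreal R \<le> ennreal (lower_const q M0)
     * Lp_norm (ennreal p) {-1..1} (derivative_fun \<alpha> \<beta> m P)"
proof -
  note b = decay_order_bounds[OF q(1) admissible_exponentD(1) kr, where \<alpha> = \<alpha> and \<beta> = \<beta>]
  have c: "0 < c0 / n" using inner_margin_bounds[OF q(1)] n by simp
  then have pc: "0 \<le> pi * c0 / n" by (metis less_imp_le mult_nonneg_nonneg pi_ge_zero times_divide_eq_right)
  have "ennreal R \<le> ennreal (1 * lower_const q M0)
     * Lp_norm (ennreal p) {-1..1} (derivative_fun \<alpha> \<beta> m P)"
  proof (rule averaged_norm_le_Lp_norm[OF q admissible_exponentD(1) n degree_deriv refl refl b(1,3)])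
    show "(derivative_fun \<alpha> \<beta> m P) \<in> borel_measurable borel" by measurable
    fix \<theta> assume "\<theta> \<in> {c0 / n..pi - c0 / n}"
    then have th: "\<theta> \<in> {0..pi}" using c by auto
    have "sin \<theta> \<ge> 0" using th by (intro sin_ge_zero) auto
    then show "\<exists>\<tau>\<in>{0..pi}. \<bar>\<tau> - \<theta>\<bar> \<le> pi * c0 / n \<and>
       jacobi_weight \<alpha> \<beta> (- cos \<theta>) * sin \<theta> ^ m * \<bar>poly ((pderiv ^^ m) P) (- cos \<tau>)\<bar>
         \<le> 1 * \<bar>jacobi_weight \<alpha> \<beta> (- cos \<theta>) * phi (- cos \<theta>) ^ m * poly ((pderiv ^^ m) P) (- cos \<theta>)\<bar>"
      using th pc by (intro bexI[of _ \<theta>]) (auto simp: phi_minus_cos abs_mult jacobi_weight_def)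
  qed simp
  then show ?thesis by simp
qed

lemma derivative_norm_le_averaged_norm:
  "Lp_norm (ennreal p) {-1..1} (derivative_fun \<alpha> \<beta> m P)
    \<le> ennreal (upper_const q M0 * (2 * singularity_bound \<alpha> \<beta> q) powr (1 / q) * R)"
proof -
  have m: "m + 0 = m" "m \<ge> 1" using k kr by auto
  note b = decay_order_bounds[OF q(1) admissible_exponentD(1) m(1), where \<alpha> = \<alpha> and \<beta> = \<beta>]
  have bl: "2 \<le> singularity_bound \<alpha> \<beta> q" "1 + \<bar>1 / (\<beta> * q + 1)\<bar> \<le> singularity_bound \<alpha> \<beta> q" "1 + \<bar>1 / (\<alpha> * q
      + 1)\<bar> \<le> singularity_bound \<alpha> \<beta> q"
    by (simp_all add: singularity_bound_def)
  have "Lp_norm (ennreal p) {-1..1} (derivative_fun \<alpha> \<beta> m P)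
    \<le> ennreal (1 * (upper_const q M0 * (2 * singularity_bound \<alpha> \<beta> q) powr (1 / q)) * R)"
  proof (rule Lp_norm_le_averaged_norm[OF q admissible_exponentD(1) n degree_deriv refl, where k = m and ?e2.0
      = \<beta> and ?e1.0 = \<alpha> and \<delta> = 0])
    show "2 * \<beta> + m + 1 / p = 2 * \<beta> + (m + 1 / p)" "2 * \<alpha> + m + 1 / p = 2 * \<alpha> + (m + 1 / p)" by auto
    show "endpoint_admissible p 0 \<beta> (2 * \<beta> + m + 1 / p) (singularity_bound \<alpha> \<beta> q)"
      using endpoint_admissible_unshifted[OF q admissible_exponentD(1,2,4) m(2) bl(1,2), of 0]
          by (simp add: add.assoc)
    show "endpoint_admissible p 0 \<alpha> (2 * \<alpha> + m + 1 / p) (singularity_bound \<alpha> \<beta> q)"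
      using endpoint_admissible_unshifted[OF q admissible_exponentD(1,2,3) m(2) bl(1,3), of 0]
          by (simp add: add.assoc)
    show "(derivative_fun \<alpha> \<beta> m P) \<in> borel_measurable borel" by measurable
    fix \<theta> assume \<theta>: "\<theta> \<in> {0<..<pi}"
    have s: "sin \<theta> > 0" using \<theta> by (intro sin_gt_zero) auto
    have ph: "phi (- cos \<theta>) = sin \<theta>" using \<theta> by (intro phi_minus_cos) auto
    have sw: "shifted_weight 0 \<alpha> \<beta> (- cos \<theta>) = jacobi_weight \<alpha> \<beta> (- cos \<theta>)"
      using shifted_weight_zero[OF \<theta>, of 0] by simp
    show "jacobi_weight \<alpha> \<beta> (- cos \<theta>) * phi (- cos \<theta>) ^ m * poly ((pderiv ^^ m) P) (- cos \<theta>) = 0 \<or>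
      0 * sin \<theta> / 2 \<le> 1 - cos \<theta> \<and> 0 * sin \<theta> / 2 \<le> 1 + cos \<theta> \<and>
      (\<exists>\<tau>\<in>{0..pi}. \<bar>\<tau> - \<theta>\<bar> \<le> 1 / n \<and>
        \<bar>jacobi_weight \<alpha> \<beta> (- cos \<theta>) * phi (- cos \<theta>) ^ m * poly ((pderiv ^^ m) P) (- cos \<theta>)\<bar>
        \<le> shifted_weight 0 \<alpha> \<beta> (- cos \<theta>) * (1 * sin \<theta> ^ m * \<bar>poly ((pderiv ^^ m) P) (- cos \<tau>)\<bar>))"
      using \<theta> s by (intro disjI2 conjI bexI[of _ \<theta>]) (auto simp: ph sw abs_mult jacobi_weight_def, smt (verit)
          cos_ge_minus_one)
  qed (use b in auto)
  then show ?thesis by simp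
qed

text \<open>
  The samples are the values of the \<open>m\<close>-th derivative that represent the differences.
\<close>
lemma averaged_norm_le_weighted_difference:
  fixes W :: "real \<Rightarrow> real" and h B u v :: real
  assumes h: "0 < h" "k * h \<le> c0 / n / pi" and uv: "{u..v} \<subseteq> {-1..1}" and B: "B > 0"
    and W: "W \<in> borel_measurable borel"
    and inner: "\<And>\<theta>. \<theta> \<in> {c0 / n..pi - c0 / n} \<Longrightarrow>
      {- cos \<theta> - k * (h * sin \<theta>) / 2..- cos \<theta> + k * (h * sin \<theta>) / 2} \<subseteq> {u..v} \<and>
      jacobi_weight \<alpha> \<beta> (- cos \<theta>) * sin \<theta> ^ r \<le> B * \<bar>W (- cos \<theta>)\<bar>"
  shows "ennreal R \<le> ennreal (B / h ^ k * lower_const q M0) *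
     Lp_norm (ennreal p) {-1..1} (\<lambda>x. W x * sym_diff k (h * phi x) (poly ((pderiv ^^ r) P)) x {u..v})"
proof (rule averaged_norm_le_Lp_norm[OF q admissible_exponentD(1) n _ refl refl])
  note b = decay_order_bounds[OF q(1) admissible_exponentD(1) kr, where \<alpha> = \<alpha> and \<beta> = \<beta>]
  show "degree ((pderiv ^^ m) P) \<le> n" by (rule degree_deriv)
  show "(\<lambda>x. W x * sym_diff k (h * phi x) (poly ((pderiv ^^ r) P)) x {u..v}) \<in> borel_measurable borel"
    using W by measurable
  show "0 < B / h ^ k" using B h by simp
  fix \<theta> assume \<theta>: "\<theta> \<in> {c0 / n..pi - c0 / n}"
  have c: "0 < c0 / n" using inner_margin_bounds[OF q(1)] n by simp
  have th: "\<theta> \<in> {0<..<pi}" using \<theta> c by auto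
  have s: "sin \<theta> > 0" using th by (intro sin_gt_zero) auto
  have ph: "phi (- cos \<theta>) = sin \<theta>" using th by (intro phi_minus_cos) auto
  note i = inner[OF \<theta>]
  obtain \<tau> where \<tau>: "\<tau> \<in> {0..pi}" "\<bar>\<tau> - \<theta>\<bar> \<le> pi * (k * h / 2)"
    "\<bar>sym_diff k (h * sin \<theta>) (poly ((pderiv ^^ r) P)) (- cos \<theta>) {u..v}\<bar>
      = h ^ k * sin \<theta> ^ k * \<bar>poly ((pderiv ^^ (k + r)) P) (- cos \<tau>)\<bar>"
    using sym_diff_sample[OF th less_imp_le[OF h(1)] uv conjunct1[OF i]] by blast
  have "k * h / 2 \<le> c0 / n"
  proof -
    have "c0 / n / pi \<le> c0 / n / 1" using c pi_ge_two by (intro divide_left_mono) auto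
    then show ?thesis using h c by (smt (verit) div_by_1 field_sum_of_halves mult_nonneg_nonneg of_nat_0_le_iff)
  qed
  then have "\<bar>\<tau> - \<theta>\<bar> \<le> pi * (c0 / n)" using \<tau>(2) by (smt (verit) mult_left_mono pi_ge_zero)
  then have t: "\<bar>\<tau> - \<theta>\<bar> \<le> pi * c0 / n" by simp
  have "jacobi_weight \<alpha> \<beta> (- cos \<theta>) * sin \<theta> ^ m * \<bar>poly ((pderiv ^^ m) P) (- cos \<tau>)\<bar>
     = (jacobi_weight \<alpha> \<beta> (- cos \<theta>) * sin \<theta> ^ r) * (sin \<theta> ^ k * \<bar>poly ((pderiv ^^ m) P) (- cos \<tau>)\<bar>)"
    unfolding kr[symmetric] by (simp add: power_add mult_ac)
  also have "\<dots> \<le> (B * \<bar>W (- cos \<theta>)\<bar>) * (sin \<theta> ^ k * \<bar>poly ((pderiv ^^ m) P) (- cos \<tau>)\<bar>)"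
    using i s by (intro mult_right_mono) auto
  also have "\<dots> = B / h ^ k * \<bar>W (- cos \<theta>) * sym_diff k (h * phi (- cos \<theta>)) (poly ((pderiv ^^ r) P)) (- cos \<theta>)
      {u..v}\<bar>"
    unfolding ph abs_mult \<tau>(3) kr using h(1) by simp
  finally show "\<exists>\<tau>\<in>{0..pi}. \<bar>\<tau> - \<theta>\<bar> \<le> pi * c0 / n \<and>
     jacobi_weight \<alpha> \<beta> (- cos \<theta>) * sin \<theta> ^ m * \<bar>poly ((pderiv ^^ m) P) (- cos \<tau>)\<bar>
      \<le> B / h ^ k * \<bar>W (- cos \<theta>) * sym_diff k (h * phi (- cos \<theta>)) (poly ((pderiv ^^ r) P)) (- cos \<theta>) {u..v}\<bar>"
    using \<tau>(1) t by blast
qed (rule decay_order_bounds[OF q(1) admissible_exponentD(1) kr])+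

text \<open>
  The bound on \<open>h\<close> makes the inner points see neither the boundary of the main interval nor, up to
  a constant, the shift of the weight.
\<close>
lemma averaged_norm_le_step_norms:
  fixes h A :: real
  assumes A: "A > 0" and h: "0 < h" "h \<le> c0 / (pi * (m + 1 + A)) / n"
  shows "ennreal R \<le> ennreal (1 / h ^ k * lower_const q M0) *
     Lp_norm (ennreal p) (main_interval A h)
       (Omega_fun \<alpha> \<beta> k r P A h)"
    and "ennreal R \<le> ennreal (2 ^ M0 / h ^ k * lower_const q M0) *
     Lp_norm (ennreal p) {-1..1}
       (omega_fun \<alpha> \<beta> k r P h)"
proof -
  let ?z = "c0 / n / pi"
  note b = decay_order_bounds[OF q(1) admissible_exponentD(1) kr, where \<alpha> = \<alpha> and \<beta> = \<beta>]
  have c: "0 < c0" using inner_margin_bounds[OF q(1)] by simp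
  have z: "0 < ?z" using c n by simp
  have D: "m + 1 + A > 0" using A by simp
  have hz: "h \<le> ?z / (m + 1 + A)" using h(2) by (simp add: field_simps)
  then have hD: "(m + 1 + A) * h \<le> ?z" using D by (simp only: pos_le_divide_eq mult.commute)
  have "real k * h \<le> (m + 1 + A) * h" using A h(1) kr by (intro mult_right_mono) auto
  then have kh: "k * h \<le> ?z" using hD by linarith
  have "A * h\<^sup>2 \<le> (m + 1 + A)\<^sup>2 * h\<^sup>2"
  proof (intro mult_right_mono)
    have "A * 1 \<le> (m + 1 + A) * (m + 1 + A)" using A by (intro mult_mono) auto
    then show "A \<le> (m + 1 + A)\<^sup>2" by (simp add: power2_eq_square)
  qed simp
  also have "\<dots> = ((m + 1 + A) * h)\<^sup>2" by (simp add: power_mult_distrib)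
  also have "\<dots> \<le> ?z\<^sup>2" using hD D h(1) by (intro power_mono) auto
  finally have Ah: "A * h\<^sup>2 \<le> ?z\<^sup>2" .
  note ip = inner_point_margin[OF n c _ less_imp_le[OF h(1)] kh Ah]
  have lin1: "-1 + z \<le> - x - y" if "y \<le> (1 - x) / 2" "z \<le> (1 - x) / 2" for x y z :: real
    using add_mono[OF that] unfolding field_sum_of_halves by simp
  have lin2: "- x + y \<le> 1 - z" if "y \<le> (1 + x) / 2" "z \<le> (1 + x) / 2" for x y z :: real
    using add_mono[OF that] unfolding field_sum_of_halves by simp
  have sw: "jacobi_weight \<alpha> \<beta> (- cos \<theta>) * sin \<theta> ^ r = shifted_weight 0 (real r / 2 + \<alpha>) (real r / 2 + \<beta>) (- cos \<theta>)"
    if "\<theta> \<in> {c0 / n..pi - c0 / n}" for \<theta>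
    by (rule shifted_weight_zero[OF ip(1)[OF that], symmetric])
  have "ennreal R \<le> ennreal (1 / h ^ k * lower_const q M0) *
     Lp_norm (ennreal p) {-1..1}
       (\<lambda>x. (jacobi_weight \<alpha> \<beta> x * phi x ^ r) * sym_diff k (h * phi x) (poly ((pderiv ^^ r) P)) x {-1 + A
           * h\<^sup>2..1 - A * h\<^sup>2})"
  proof (rule averaged_norm_le_weighted_difference[OF h(1) kh])
    show "{-1 + A * h\<^sup>2..1 - A * h\<^sup>2} \<subseteq> {-1..1}" using A by auto
    show "(\<lambda>x. jacobi_weight \<alpha> \<beta> x * phi x ^ r) \<in> borel_measurable borel" by measurable
    fix \<theta> assume \<theta>: "\<theta> \<in> {c0 / n..pi - c0 / n}"
    have s: "sin \<theta> > 0" using ip(1)[OF \<theta>] by (intro sin_gt_zero) auto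
    have ph: "phi (- cos \<theta>) = sin \<theta>" using ip(1)[OF \<theta>] by (intro phi_minus_cos) auto
    have "{- cos \<theta> - k * (h * sin \<theta>) / 2..- cos \<theta> + k * (h * sin \<theta>) / 2} \<subseteq> {-1 + A * h\<^sup>2..1 - A * h\<^sup>2}"
      unfolding atLeastatMost_subset_iff
      by (intro disjI2 conjI lin1[OF ip(2,4)[OF \<theta>]] lin2[OF ip(3,5)[OF \<theta>]])
    then show "{- cos \<theta> - k * (h * sin \<theta>) / 2..- cos \<theta> + k * (h * sin \<theta>) / 2} \<subseteq> {-1 + A * h\<^sup>2..1 - A * h\<^sup>2} \<and>
      jacobi_weight \<alpha> \<beta> (- cos \<theta>) * sin \<theta> ^ r \<le> 1 * \<bar>jacobi_weight \<alpha> \<beta> (- cos \<theta>) * phi (- cos \<theta>) ^ r\<bar>"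
      by (simp add: ph)
  qed simp
  also have "\<dots> \<le> ennreal (1 / h ^ k * lower_const q M0) *
     Lp_norm (ennreal p) (main_interval A h)
       (Omega_fun \<alpha> \<beta> k r P A h)"
    unfolding main_interval_def[symmetric]
  proof (intro mult_left_mono Lp_norm_mono_supported admissible_exponentD)
    show "main_interval A h \<in> sets borel" by (simp add: main_interval_def)
    fix x :: real
    assume x: "x \<in> {-1..1}" and nz: "jacobi_weight \<alpha> \<beta> x * phi x ^ r *
       sym_diff k (h * phi x) (poly ((pderiv ^^ r) P)) x (main_interval A h) \<noteq> 0"
    then have "sym_diff k (h * phi x) (poly ((pderiv ^^ r) P)) x (main_interval A h) \<noteq> 0" by auto
    then have "x \<in> main_interval A h" using h(1) phi_nonneg[OF x]
        by (rule sym_diff_nonzero_imp_mem[OF _ mult_nonneg_nonneg[OF less_imp_le]])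
    then show "x \<in> main_interval A h \<and> \<bar>jacobi_weight \<alpha> \<beta> x * phi x ^ r *
       sym_diff k (h * phi x) (poly ((pderiv ^^ r) P)) x (main_interval A h)\<bar> \<le> \<bar>jacobi_weight \<alpha> \<beta> x * phi x ^ r *
       sym_diff k (h * phi x) (poly ((pderiv ^^ r) P)) x (main_interval A h)\<bar>" by simp
  qed auto
  finally show "ennreal R \<le> ennreal (1 / h ^ k * lower_const q M0) *
     Lp_norm (ennreal p) (main_interval A h)
       (Omega_fun \<alpha> \<beta> k r P A h)" .
  show "ennreal R \<le> ennreal (2 ^ M0 / h ^ k * lower_const q M0) *
     Lp_norm (ennreal p) {-1..1}
       (omega_fun \<alpha> \<beta> k r P h)"
  proof (rule averaged_norm_le_weighted_difference[OF h(1) kh order_refl])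
    show "shifted_weight (k * h) (real r / 2 + \<alpha>) (real r / 2 + \<beta>) \<in> borel_measurable borel" by measurable
    fix \<theta> assume \<theta>: "\<theta> \<in> {c0 / n..pi - c0 / n}"
    have "{- cos \<theta> - k * (h * sin \<theta>) / 2..- cos \<theta> + k * (h * sin \<theta>) / 2} \<subseteq> {-1..1}"
      unfolding atLeastatMost_subset_iff
      using lin1[OF ip(2)[OF \<theta>], of 0] lin2[OF ip(3)[OF \<theta>], of 0] cos_ge_minus_one[of \<theta>] cos_le_one[of \<theta>] by auto
    moreover have "shifted_weight 0 (real r / 2 + \<alpha>) (real r / 2 + \<beta>) (- cos \<theta>)
       \<le> 2 ^ M0 * shifted_weight (k * h) (real r / 2 + \<alpha>) (real r / 2 + \<beta>) (- cos \<theta>)"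
    proof (rule shifted_weight_inner_ge[OF ip(1)[OF \<theta>]])
      have "0 \<le> k + 1 / p" using admissible_exponentD(5) by simp
      then show "\<bar>real r / 2 + \<alpha>\<bar> + \<bar>real r / 2 + \<beta>\<bar> \<le> M0" using b(2) by linarith
    qed (use ip(2-3)[OF \<theta>] h(1) in \<open>auto simp: mult_ac\<close>)
    ultimately show "{- cos \<theta> - k * (h * sin \<theta>) / 2..- cos \<theta> + k * (h * sin \<theta>) / 2} \<subseteq> {-1..1} \<and>
      jacobi_weight \<alpha> \<beta> (- cos \<theta>) * sin \<theta> ^ r \<le> 2 ^ M0 * \<bar>shifted_weight (k * h) (real r / 2 + \<alpha>) (real r / 2
          + \<beta>) (- cos \<theta>)\<bar>"
      unfolding sw[OF \<theta>] by (simp add: shifted_weight_def)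
  qed simp
qed

lemma finite_exponent_bounds:
  fixes h t A :: real
  shows "0 \<le> h \<Longrightarrow> h \<le> t \<Longrightarrow> k * h \<le> 1 / (2 * real n) \<Longrightarrow>
      Lp_norm (ennreal p) {-1..1} (Psi_fun \<alpha> \<beta> k r P h)
        \<le> ennreal (t ^ k * comparison_const \<alpha> \<beta> q m (singularity_bound \<alpha> \<beta> q)) * Lp_norm (ennreal p) {-1..1}
            (derivative_fun \<alpha> \<beta> m P)"
    and "0 \<le> h \<Longrightarrow> h \<le> t \<Longrightarrow> k * h \<le> 1 / (2 * real n) \<Longrightarrow>
      Lp_norm (ennreal p) {-1..1} (omega_fun \<alpha> \<beta> k r P h)
        \<le> ennreal (t ^ k * comparison_const \<alpha> \<beta> q m
              (3 + singularity_bound \<alpha> \<beta> q + (if r = 0 \<and> min \<alpha> \<beta> < 0 then singularity_bound \<alpha> \<beta> p else 0)))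
            * Lp_norm (ennreal p) {-1..1} (derivative_fun \<alpha> \<beta> m P)"
    and "A > 0 \<Longrightarrow> 0 < h \<Longrightarrow> h \<le> c0 / (pi * (m + 1 + A)) / n \<Longrightarrow>
      Lp_norm (ennreal p) {-1..1} (derivative_fun \<alpha> \<beta> m P)
        \<le> ennreal (comparison_const \<alpha> \<beta> q m (singularity_bound \<alpha> \<beta> q) / h ^ k) * Lp_norm (ennreal p)
            (main_interval A h) (Omega_fun \<alpha> \<beta> k r P A h)"
    and "A > 0 \<Longrightarrow> 0 < h \<Longrightarrow> h \<le> c0 / (pi * (m + 1 + A)) / n \<Longrightarrow>
      Lp_norm (ennreal p) {-1..1} (derivative_fun \<alpha> \<beta> m P)
        \<le> ennreal (2 ^ M0 * comparison_const \<alpha> \<beta> q m (singularity_bound \<alpha> \<beta> q) / h ^ k) * Lp_norm (ennreal p)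
            {-1..1} (omega_fun \<alpha> \<beta> k r P h)"
    and "A \<ge> 0 \<Longrightarrow> 0 \<le> h \<Longrightarrow>
      Lp_norm (ennreal p) (main_interval A h) (Omega_fun \<alpha> \<beta> k r P A h) \<le> ennreal 1 * Lp_norm (ennreal p)
          {-1..1} (Psi_fun \<alpha> \<beta> k r P h)"
proof -
  note bl = singularity_bound_ge[where \<alpha> = \<alpha> and \<beta> = \<beta>]
  have u0: "0 \<le> upper_const q M0 * (2 * L) powr (1 / q)" for L using upper_const_pos[OF q(1), of M0] by simp
  have l0: "0 \<le> lower_const q M0" using lower_const_pos[OF q(1), of M0] by simp
  have Rle: "ennreal (R)
     \<le> ennreal (lower_const q M0) * Lp_norm (ennreal p) {-1..1} (derivative_fun \<alpha> \<beta> m P)"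
    by (rule averaged_norm_le_derivative_norm)
  have leN: "Lp_norm (ennreal p) {-1..1} (derivative_fun \<alpha> \<beta> m P)
     \<le> ennreal ((upper_const q M0 * (2 * singularity_bound \<alpha> \<beta> q) powr (1 / q)) * R)"
    by (rule derivative_norm_le_averaged_norm)
  {
    assume h: "0 \<le> h" "h \<le> t" "k * h \<le> 1 / (2 * real n)"
    have hk: "h ^ k \<le> t ^ k" "0 \<le> h ^ k" using h by (auto intro: power_mono)
    have up: "X \<le> ennreal (t ^ k * comparison_const \<alpha> \<beta> q m L) * Lp_norm (ennreal p) {-1..1} (derivative_fun \<alpha>
        \<beta> m P)"
      if "X \<le> ennreal (h ^ k * (upper_const q M0 * (2 * L) powr (1 / q)) * R)"
      for X L
    proof -
      have "X \<le> ennreal ((h ^ k * (upper_const q M0 * (2 * L) powr (1 / q))) * lower_const q M0) * Lp_norm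
          (ennreal p) {-1..1} (derivative_fun \<alpha> \<beta> m P)"
        using through_averaged_norm[OF that Rle mult_nonneg_nonneg[OF hk(2) u0] l0] .
      also have "(h ^ k * (upper_const q M0 * (2 * L) powr (1 / q))) * lower_const q M0
          = h ^ k * comparison_const \<alpha> \<beta> q m L"
        by (simp add: comparison_const_def mult.assoc)
      also have "ennreal (h ^ k * comparison_const \<alpha> \<beta> q m L) * Lp_norm (ennreal p) {-1..1} (derivative_fun \<alpha>
          \<beta> m P)
         \<le> ennreal (t ^ k * comparison_const \<alpha> \<beta> q m L) * Lp_norm (ennreal p) {-1..1} (derivative_fun \<alpha> \<beta> m P)"
        using hk u0[of L] l0 by (intro mult_right_mono ennreal_leI) (auto simp: comparison_const_def)
      finally show ?thesis .
    qed
    show "Lp_norm (ennreal p) {-1..1} (Psi_fun \<alpha> \<beta> k r P h)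
        \<le> ennreal (t ^ k * comparison_const \<alpha> \<beta> q m (singularity_bound \<alpha> \<beta> q)) * Lp_norm (ennreal p) {-1..1}
            (derivative_fun \<alpha> \<beta> m P)"
    proof (rule up, rule weighted_difference_le[OF h(1,3), of 0])
      show "(\<lambda>x. jacobi_weight \<alpha> \<beta> x * phi x ^ r) \<in> borel_measurable borel" by measurable
      show "jacobi_weight \<alpha> \<beta> (- cos \<theta>) * phi (- cos \<theta>) ^ r = shifted_weight 0 (real r / 2 + \<alpha>) (real r / 2
          + \<beta>) (- cos \<theta>)"
        if "\<theta> \<in> {0<..<pi}" for \<theta>
        using shifted_weight_zero[OF that, of r \<alpha> \<beta>] that by (simp add: phi_minus_cos)
      show "endpoint_admissible p 0 (real r / 2 + \<beta>) (2 * (real r / 2 + \<beta>) + (real k + 1 / p))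
          (singularity_bound \<alpha> \<beta> q)"
        by (rule endpoint_admissible_unshifted[OF q admissible_exponentD(1,2,4) k bl(1,2)])
      show "endpoint_admissible p 0 (real r / 2 + \<alpha>) (2 * (real r / 2 + \<alpha>) + (real k + 1 / p))
          (singularity_bound \<alpha> \<beta> q)"
        by (rule endpoint_admissible_unshifted[OF q admissible_exponentD(1,2,3) k bl(1,3)])
    qed simp
    let ?L = "3 + singularity_bound \<alpha> \<beta> q + (if r = 0 \<and> min \<alpha> \<beta> < 0 then singularity_bound \<alpha> \<beta> p else 0)"
    have L: "3 \<le> ?L" "1 + \<bar>1 / (\<beta> * q + 1)\<bar> \<le> ?L" "1 + \<bar>1 / (\<alpha> * q + 1)\<bar> \<le> ?L"
      using bl(1)[of q] bl(2)[of q] bl(3)[of q] bl(1)[of p] by (simp_all del: abs_divide)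
    show "Lp_norm (ennreal p) {-1..1} (omega_fun \<alpha> \<beta> k r P h)
        \<le> ennreal (t ^ k * comparison_const \<alpha> \<beta> q m ?L) * Lp_norm (ennreal p) {-1..1} (derivative_fun \<alpha> \<beta> m P)"
    proof (rule up, rule weighted_difference_le[OF h(1,3), of "k * h"])
      show "shifted_weight (real k * h) (real r / 2 + \<alpha>) (real r / 2 + \<beta>) \<in> borel_measurable borel" by measurable
      have "1 + \<bar>1 / (\<beta> * p + 1)\<bar> \<le> ?L" if "r = 0" "\<beta> < 0"
        using that bl(1)[of q] bl(2)[of p] by (simp add: min_less_iff_disj del: abs_divide)
      then show "endpoint_admissible p (k * h) (real r / 2 + \<beta>) (2 * (real r / 2 + \<beta>) + (real k + 1 / p)) ?L"
        by (rule endpoint_admissible_shifted[OF q admissible_exponentD(1,2,4) L(1,2)])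
      have "1 + \<bar>1 / (\<alpha> * p + 1)\<bar> \<le> ?L" if "r = 0" "\<alpha> < 0"
        using that bl(1)[of q] bl(3)[of p] by (simp add: min_less_iff_disj del: abs_divide)
      then show "endpoint_admissible p (k * h) (real r / 2 + \<alpha>) (2 * (real r / 2 + \<alpha>) + (real k + 1 / p)) ?L"
        by (rule endpoint_admissible_shifted[OF q admissible_exponentD(1,2,3) L(1,3)])
    qed simp_all
  }
  {
    assume A: "A > 0" and h: "0 < h" "h \<le> c0 / (pi * (m + 1 + A)) / n"
    have hk: "0 < h ^ k" using h by simp
    note lo = averaged_norm_le_step_norms[OF A h]
    have "Lp_norm (ennreal p) {-1..1} (derivative_fun \<alpha> \<beta> m P)
      \<le> ennreal ((upper_const q M0 * (2 * singularity_bound \<alpha> \<beta> q) powr (1 / q)) * (1 / h ^ k * lower_const q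
          M0)) *
        Lp_norm (ennreal p) (main_interval A h) (Omega_fun \<alpha> \<beta> k r P A h)"
      using hk l0 by (intro through_averaged_norm[OF leN lo(1) u0]) auto
    then show "Lp_norm (ennreal p) {-1..1} (derivative_fun \<alpha> \<beta> m P)
        \<le> ennreal (comparison_const \<alpha> \<beta> q m (singularity_bound \<alpha> \<beta> q) / h ^ k) * Lp_norm (ennreal p)
            (main_interval A h) (Omega_fun \<alpha> \<beta> k r P A h)"
      by (simp add: comparison_const_def)
    have "Lp_norm (ennreal p) {-1..1} (derivative_fun \<alpha> \<beta> m P)
      \<le> ennreal ((upper_const q M0 * (2 * singularity_bound \<alpha> \<beta> q) powr (1 / q)) * (2 ^ M0 / h ^ k
          * lower_const q M0)) *
        Lp_norm (ennreal p) {-1..1} (omega_fun \<alpha> \<beta> k r P h)"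
      using hk l0 by (intro through_averaged_norm[OF leN lo(2) u0]) auto
    then show "Lp_norm (ennreal p) {-1..1} (derivative_fun \<alpha> \<beta> m P)
        \<le> ennreal (2 ^ M0 * comparison_const \<alpha> \<beta> q m (singularity_bound \<alpha> \<beta> q) / h ^ k) * Lp_norm (ennreal p)
            {-1..1} (omega_fun \<alpha> \<beta> k r P h)"
      by (simp add: comparison_const_def mult_ac)
  }
  {
    assume A: "A \<ge> 0" and h: "0 \<le> h"
    have "Lp_norm (ennreal p) (main_interval A h) (Omega_fun \<alpha> \<beta> k r P A h) \<le> Lp_norm (ennreal p) {-1..1}
        (Psi_fun \<alpha> \<beta> k r P h)"
    proof (rule Lp_norm_mono_supported[OF admissible_exponentD(5)])
      show "main_interval A h \<in> sets borel" by (simp add: main_interval_def)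
      fix x assume x: "x \<in> main_interval A h" and nz: "Omega_fun \<alpha> \<beta> k r P A h x \<noteq> 0"
      then have "sym_diff k (h * phi x) (poly ((pderiv ^^ r) P)) x (main_interval A h) \<noteq> 0" by auto
      from sym_diff_eq_of_subset[OF main_interval_subset[OF A] this]
      show "x \<in> {-1..1} \<and> \<bar>Omega_fun \<alpha> \<beta> k r P A h x\<bar> \<le> \<bar>Psi_fun \<alpha> \<beta> k r P h x\<bar>"
        using x main_interval_subset[OF A, of h] by (simp add: subset_iff)
    qed simp
    then show "Lp_norm (ennreal p) (main_interval A h) (Omega_fun \<alpha> \<beta> k r P A h)
        \<le> ennreal 1 * Lp_norm (ennreal p) {-1..1} (Psi_fun \<alpha> \<beta> k r P h)"
      by simp
  }
qed

end

text \<open>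
  If \<open>p = \<infinity>\<close> then \<open>q = 1\<close> and both weight exponents are nonnegative, so that every finite
  \<open>p' \<ge> 1\<close> is admissible and the bounds for these exponents, which share the constant, pass to
  the limit.
\<close>
lemma exponent_limit:
  fixes p :: ennreal and q \<alpha> \<beta> c :: real and f g :: "real \<Rightarrow> real"
  assumes p: "p > 0" "ennreal q = min 1 p" "\<alpha> \<in> J_range p" "\<beta> \<in> J_range p" and q: "0 < q"
    and c: "c > 0" and fg: "f \<in> borel_measurable borel" "g \<in> borel_measurable borel"
    and S: "S \<in> sets borel" "S \<subseteq> {-1..1}" "S' \<in> sets borel" "S' \<subseteq> {-1..1}"
    and fin: "\<And>p'. admissible_exponent \<alpha> \<beta> q p' \<Longrightarrow> p = ennreal p' \<and> p' > 0 \<or> p = \<infinity> \<Longrightarrow>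
        Lp_norm (ennreal p') S f \<le> ennreal c * Lp_norm (ennreal p') S' g"
  shows "Lp_norm p S f \<le> ennreal c * Lp_norm p S' g"
proof (cases "p = \<infinity>")
  case True
  then have "ennreal q = 1" using p by (simp add: min_def top_unique)
  then have q1: "q = 1" by simp
  have ab: "0 \<le> \<alpha>" "0 \<le> \<beta>" using p True by (auto simp: J_range_def)
  show ?thesis
    unfolding True
  proof (rule Lp_norm_infinity_le_of_all_finite[OF c fg S])
    fix p' :: real assume p': "p' \<ge> 1"
    then have "0 < 1 / p'" by simp
    then have "- (1 / p') < \<alpha>" "- (1 / p') < \<beta>" using ab by linarith+
    then have "admissible_exponent \<alpha> \<beta> q p'" using p' q1 by (auto simp: admissible_exponent_def)
    then show "Lp_norm (ennreal p') S f \<le> ennreal c * Lp_norm (ennreal p') S' g" using fin True by blast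
  qed
next
  case False
  then obtain p' where p': "p = ennreal p'" "p' \<ge> 0" by (cases p) auto
  then have p'0: "p' > 0" using p(1) by (simp add: ennreal_less_zero_iff)
  have J: "- (1 / p') < \<alpha>" "- (1 / p') < \<beta>" using p(3,4) p' by (auto simp: J_range_def)
  have "ennreal q = ennreal (min 1 p')" using p(2) p' by (simp add: min_def)
  then have "q = min 1 p'" using q p'0 by (simp add: ennreal_inj)
  then have "admissible_exponent \<alpha> \<beta> q p'" using J by (auto simp: admissible_exponent_def min_def)
  then show ?thesis using fin p' p'0 by blast
qed

section \<open>The equivalence\<close>

lemma ennreal_rescale:
  assumes "s > 0" "c \<ge> 0" and "X \<le> ennreal (s * c) * Y"
  shows "ennreal (1 / s) * X \<le> ennreal c * Y"
proof -
  have "ennreal (1 / s) * X \<le> ennreal (1 / s) * (ennreal (s * c) * Y)" by (intro mult_left_mono assms) simp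
  also have "\<dots> = ennreal c * Y" using assms by (simp add: mult.assoc[symmetric] ennreal_mult[symmetric])
  finally show ?thesis .
qed

lemma ennreal_rescale':
  assumes "s > 0" "c \<ge> 0" and "Y \<le> ennreal (c / s) * X"
  shows "Y \<le> ennreal c * (ennreal (1 / s) * X)"
  using assms by (simp add: mult.assoc[symmetric] ennreal_mult[symmetric])

lemma ennreal_le_trans_mult:
  assumes "X \<le> ennreal a * Y" "Y \<le> ennreal b * Z" "a \<ge> 0" "b \<ge> 0" "a * b \<le> c"
  shows "X \<le> ennreal c * Z"
proof -
  have "X \<le> ennreal a * (ennreal b * Z)" using assms(1,2) by (meson mult_left_mono order_trans zero_le)
  also have "\<dots> = ennreal (a * b) * Z" using assms by (simp add: ennreal_mult mult.assoc)
  also have "\<dots> \<le> ennreal c * Z" using assms by (intro mult_right_mono ennreal_leI) auto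
  finally show ?thesis .
qed

lemma ennreal_inverse_mult_le:
  assumes "X \<le> ennreal c * Y" "c > 0"
  shows "ennreal (1 / c) * X \<le> Y"
  using ennreal_rescale[of c 1 X Y] assms by simp

theorem corollary2p2:
  fixes \<alpha> \<beta> :: real and q :: ennreal
  shows "\<exists>\<rho> :: nat \<Rightarrow> real. (\<forall>k. \<rho> k > 0) \<and>
    (\<forall>(m::nat) (A::real). m \<ge> 1 \<and> A > 0 \<longrightarrow>
      (\<exists>(c::real) (C :: ennreal \<Rightarrow> real). c \<ge> 1 \<and> (\<forall>p. C p \<ge> 1) \<and>
        (\<forall>(p::ennreal) (n::nat) (P::real poly) (k::nat) (r::nat) (t::real).
          p > 0 \<and> q = min 1 p \<and> \<alpha> \<in> J_range p \<and> \<beta> \<in> J_range p \<and>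
          n \<ge> 1 \<and> degree P \<le> n - 1 \<and> k \<ge> 1 \<and> k + r = m \<and>
          0 < t \<and> t \<le> \<rho> k / real n \<longrightarrow>
          (let g = poly ((pderiv ^^ r) P);
               \<omega> = ennreal (1 / t ^ k) * omega_mod k r g t \<alpha> \<beta> p;
               \<Psi> = ennreal (1 / t ^ k) * Psi_mod k r g t \<alpha> \<beta> p;
               \<Omega> = ennreal (1 / t ^ k) * Omega_mod k r g A t \<alpha> \<beta> p;
               N = Lp_norm p {-1..1}
                     (\<lambda>x. jacobi_weight \<alpha> \<beta> x * phi x ^ m * poly ((pderiv ^^ m) P) x)
           in (ennreal (1 / c) * \<Psi> \<le> \<omega> \<and>
               \<omega> \<le> ennreal (if r = 0 \<and> min \<alpha> \<beta> < 0 then C p else c) * \<Psi>) \<and>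
              equiv_within c \<Psi> \<Omega> \<and> equiv_within c \<Omega> N))))"
  (is "\<exists>\<rho>. _ \<and> (\<forall>m A. _ \<longrightarrow> (\<exists>c C. _ \<and> _ \<and>
        (\<forall>p n P k r t. ?hyp \<rho> m p n P k r t \<longrightarrow> ?equiv m A c C p n P k r t)))")
proof -
  \<comment> \<open>Any choice with \<open>k * \<rho> k \<le> 1 / 2\<close> keeps \<open>k h\<close> below \<open>1 / (2 n)\<close>; the dependence of the constants
    on \<open>m\<close> is carried by \<open>c\<close> alone.\<close>
  define \<rho> :: "nat \<Rightarrow> real" where "\<rho> k = 1 / (2 * (real k + 1))" for k
  have \<rho>0: "\<rho> k > 0" for k by (simp add: \<rho>_def add_nonneg_pos)
  show ?thesis
  proof (cases "0 < q \<and> q \<le> 1")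
    case False
    have vac: "\<not> (p > 0 \<and> q = min 1 p)" for p :: ennreal using False by (auto simp: min_def)
    show ?thesis
      by (intro exI[of _ \<rho>] conjI allI impI exI[of _ "1::real"] exI[of _ "\<lambda>_. 1::real"])
         ((rule \<rho>0 | rule order_refl | (use vac in blast))+)
  next
    case True
    then obtain q' where q': "q = ennreal q'" "q' \<ge> 0" by (cases q) (auto simp: top_unique)
    have q0: "0 < q'" "q' \<le> 1" using True q' by (auto simp: ennreal_less_zero_iff)
    show ?thesis
    proof (intro exI[of _ \<rho>] conjI allI impI \<rho>0)
      fix m :: nat and A :: real
      assume mA: "m \<ge> 1 \<and> A > 0"
      let ?M = "decay_order \<alpha> \<beta> q' m"
      define \<eta> where "\<eta> = inner_margin q' ?M / (pi * (m + 1 + A))"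
      define c1 where "c1 = comparison_const \<alpha> \<beta> q' m (singularity_bound \<alpha> \<beta> q')"
      define c2 where "c2 e = comparison_const \<alpha> \<beta> q' m (3 + singularity_bound \<alpha> \<beta> q' + e)" for e
      define d where "d = 2 ^ ?M * c1 / \<eta> ^ m"
      define c where "c = 1 + (c1 + c2 0 + 1) * (d + 1)"
      define C where "C p = 1 + c2 (singularity_bound \<alpha> \<beta> (enn2real p)) * (d + 1)" for p :: ennreal
      have im: "0 < inner_margin q' ?M" "inner_margin q' ?M \<le> 1 / 2" using inner_margin_bounds[OF q0(1)] by auto
      have D1: "1 \<le> pi * (m + 1 + A)"
        using mult_mono[of 1 pi 1 "m + 1 + A"] pi_ge_two mA by simp
      have \<eta>: "0 < \<eta>" "\<eta> \<le> 1"
      proof -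
        show "0 < \<eta>" unfolding \<eta>_def using im D1 by (intro divide_pos_pos) auto
        have "\<eta> \<le> inner_margin q' ?M / 1" unfolding \<eta>_def using im D1 by (intro divide_left_mono) auto
        then show "\<eta> \<le> 1" using im by simp
      qed
      have bp: "0 < singularity_bound \<alpha> \<beta> x" for x using singularity_bound_ge(1)[of \<alpha> \<beta> x] by linarith
      have c1: "c1 > 0" unfolding c1_def by (intro comparison_const_pos q0 bp)
      have c2: "c2 e > 0" if "e \<ge> 0" for e
        unfolding c2_def using bp[of q'] that by (intro comparison_const_pos q0) auto
      have d: "d > 0" unfolding d_def using c1 \<eta> by (intro divide_pos_pos mult_pos_pos) auto
      have c_ge: "c \<ge> 1" "c1 \<le> c" "c1 * d \<le> c" "c2 0 * d \<le> c" "d \<le> c"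
      proof -
        have "0 \<le> c1 * d" "0 \<le> c2 0 * d" "0 \<le> c2 0" using c1 c2[of 0] d by auto
        moreover have "c = 1 + c1 * d + c2 0 * d + d + c1 + c2 0 + 1" by (simp add: c_def algebra_simps)
        ultimately show "c \<ge> 1" "c1 \<le> c" "c1 * d \<le> c" "c2 0 * d \<le> c" "d \<le> c" using c1 d by linarith+
      qed
      have C_ge: "C p \<ge> 1" "c2 (singularity_bound \<alpha> \<beta> (enn2real p)) * d \<le> C p" for p
      proof -
        have "0 < c2 (singularity_bound \<alpha> \<beta> (enn2real p))" using bp by (intro c2) (simp add: less_imp_le)
        then show "C p \<ge> 1" "c2 (singularity_bound \<alpha> \<beta> (enn2real p)) * d \<le> C p"
          using d by (auto simp: C_def distrib_left)
      qed
      show "\<exists>c C. c \<ge> 1 \<and> (\<forall>p. C p \<ge> 1) \<and> (\<forall>p n P k r t. ?hyp \<rho> m p n P k r t \<longrightarrow> ?equiv m A c C p n P k r t)"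
      proof (intro exI[of _ c] exI[of _ C] conjI allI impI c_ge(1) C_ge(1))
        fix p :: ennreal and n :: nat and P :: "real poly" and k r :: nat and t :: real
        assume "?hyp \<rho> m p n P k r t"
        then have p: "p > 0" "ennreal q' = min 1 p" "\<alpha> \<in> J_range p" "\<beta> \<in> J_range p"
          and n: "n \<ge> 1" and P: "degree P \<le> n - 1" and k: "k \<ge> 1" and kr: "k + r = m"
          and t: "0 < t" "t \<le> \<rho> k / real n" using q' by auto
        have A: "A > 0" "A \<ge> 0" using mA by auto
        let ?N = "Lp_norm p {-1..1} (derivative_fun \<alpha> \<beta> m P)"
        let ?g = "poly ((pderiv ^^ r) P)"
        \<comment> \<open>The bound of the one singularity that is not uniform in \<open>p\<close>.\<close>
        define E where "E = (if r = 0 \<and> min \<alpha> \<beta> < 0 then singularity_bound \<alpha> \<beta> (enn2real p) else 0)"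
        have E0: "E \<ge> 0" using bp by (simp add: E_def less_imp_le)
        have tk: "t ^ k > 0" using t by simp
        have mN: "derivative_fun \<alpha> \<beta> m P \<in> borel_measurable borel" by measurable
        have mPsi: "Psi_fun \<alpha> \<beta> k r P h \<in> borel_measurable borel" for h by measurable
        have mom: "omega_fun \<alpha> \<beta> k r P h \<in> borel_measurable borel" for h by measurable
        have mOm: "Omega_fun \<alpha> \<beta> k r P A h \<in> borel_measurable borel" for h
          unfolding main_interval_def by measurable
        have Sm: "{-1..1::real} \<in> sets borel" "{-1..1::real} \<subseteq> {-1..1}" by auto
        have Im: "main_interval A h \<in> sets borel" "main_interval A h \<subseteq> {-1..1}" for h
          using main_interval_subset[OF A(2), of h] by (auto simp: main_interval_def)
        have kh: "k * h \<le> 1 / (2 * real n)" if "0 \<le> h" "h \<le> t" for h :: real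
        proof -
          have "k * h \<le> k * (\<rho> k / n)" using that t by (intro mult_left_mono) auto
          also have "\<dots> = (k / (real k + 1)) * (1 / (2 * real n))" by (simp add: \<rho>_def)
          also have "\<dots> \<le> 1 * (1 / (2 * real n))" by (intro mult_right_mono) auto
          finally show ?thesis by simp
        qed
        have Psi_h: "Lp_norm p {-1..1} (Psi_fun \<alpha> \<beta> k r P h) \<le> ennreal (t ^ k * c1) * ?N" if h: "h \<in> {0..t}" for h
          unfolding c1_def
        proof (rule exponent_limit[OF p q0(1) _ mPsi mN Sm Sm])
          show "0 < t ^ k * comparison_const \<alpha> \<beta> q' m (singularity_bound \<alpha> \<beta> q')" using c1 tk by (simp add: c1_def)
        qed (use h kh[of h] in \<open>auto intro!: finite_exponent_bounds(1)[OF q0 _ n P k kr]\<close>)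
        have omega_h: "Lp_norm p {-1..1} (omega_fun \<alpha> \<beta> k r P h) \<le> ennreal (t ^ k * c2 E) * ?N" if h:
            "h \<in> {0..t}" for h
        proof (rule exponent_limit[OF p q0(1) _ mom mN Sm Sm])
          show "0 < t ^ k * c2 E" using c2[OF E0] tk by simp
          fix p' assume adm: "admissible_exponent \<alpha> \<beta> q' p'" and pp: "p = ennreal p' \<and> p' > 0 \<or> p = \<infinity>"
          have "E = (if r = 0 \<and> min \<alpha> \<beta> < 0 then singularity_bound \<alpha> \<beta> p' else 0)"
            using pp p(3,4) by (auto simp: E_def J_range_def)
          then show "Lp_norm (ennreal p') {-1..1} (omega_fun \<alpha> \<beta> k r P h)
              \<le> ennreal (t ^ k * c2 E) * Lp_norm (ennreal p') {-1..1} (derivative_fun \<alpha> \<beta> m P)"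
            unfolding c2_def using h kh[of h] finite_exponent_bounds(2)[OF q0 adm n P k kr, of h t] by auto
        qed
        \<comment> \<open>The lower bounds use this one step; it costs the factor \<open>\<eta> ^ k \<ge> \<eta> ^ m\<close>.\<close>
        define h0 where "h0 = \<eta> * t"
        have \<rho>1: "\<rho> k \<le> 1" by (simp add: \<rho>_def)
        have h0: "0 < h0" "h0 \<in> {0..t}" "h0 \<le> \<eta> / n"
        proof -
          show "0 < h0" using \<eta> t by (simp add: h0_def)
          then show "h0 \<in> {0..t}" using \<eta> t by (simp add: h0_def mult_left_le_one_le)
          have "t \<le> 1 / n" using t(2) divide_right_mono[OF \<rho>1, of "real n"] by simp
          then have "\<eta> * t \<le> \<eta> * (1 / n)" using \<eta> by (intro mult_left_mono) auto
          then show "h0 \<le> \<eta> / n" by (simp add: h0_def)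
        qed
        have dk: "2 ^ ?M * c1 / h0 ^ k \<le> d / t ^ k" "c1 / h0 ^ k \<le> d / t ^ k"
        proof -
          have "\<eta> ^ m \<le> \<eta> ^ k" using \<eta> kr by (intro power_decreasing) auto
          then have "2 ^ ?M * c1 / \<eta> ^ k \<le> d" unfolding d_def using \<eta> c1 by (intro divide_left_mono) auto
          then have "2 ^ ?M * c1 / \<eta> ^ k / t ^ k \<le> d / t ^ k" using tk by (intro divide_right_mono) auto
          then show 1: "2 ^ ?M * c1 / h0 ^ k \<le> d / t ^ k" by (simp add: h0_def power_mult_distrib)
          have "1 * c1 / h0 ^ k \<le> 2 ^ ?M * c1 / h0 ^ k" using c1 h0(1)
              by (intro divide_right_mono mult_right_mono) auto
          then show "c1 / h0 ^ k \<le> d / t ^ k" using 1 by simp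
        qed
        have N_Omega: "?N \<le> ennreal (d / t ^ k) * Lp_norm p (main_interval A h0) (Omega_fun \<alpha> \<beta> k r P A h0)"
        proof (rule order_trans)
          show "?N \<le> ennreal (c1 / h0 ^ k) * Lp_norm p (main_interval A h0) (Omega_fun \<alpha> \<beta> k r P A h0)"
          proof (rule exponent_limit[OF p q0(1) _ mN mOm Sm Im])
            show "0 < c1 / h0 ^ k" using c1 h0 by simp
          qed (use h0(3) in \<open>auto simp: c1_def \<eta>_def intro!: finite_exponent_bounds(3)[OF q0 _ n P k kr A(1)
              h0(1)]\<close>)
        qed (intro mult_right_mono ennreal_leI dk zero_le)
        have N_omega: "?N \<le> ennreal (d / t ^ k) * Lp_norm p {-1..1} (omega_fun \<alpha> \<beta> k r P h0)"
        proof (rule order_trans)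
          show "?N \<le> ennreal (2 ^ ?M * c1 / h0 ^ k) * Lp_norm p {-1..1} (omega_fun \<alpha> \<beta> k r P h0)"
          proof (rule exponent_limit[OF p q0(1) _ mN mom Sm Sm])
            show "0 < 2 ^ ?M * c1 / h0 ^ k" using c1 h0 by simp
          qed (use h0(3) in \<open>auto simp: c1_def \<eta>_def intro!: finite_exponent_bounds(4)[OF q0 _ n P k kr A(1)
              h0(1)]\<close>)
        qed (intro mult_right_mono ennreal_leI dk zero_le)
        have Omega_h: "Lp_norm p (main_interval A h) (Omega_fun \<alpha> \<beta> k r P A h) \<le> ennreal 1 * Lp_norm p {-1..1}
            (Psi_fun \<alpha> \<beta> k r P h)"
          if "h \<in> {0..t}" for h
          by (rule exponent_limit[OF p q0(1) _ mOm mPsi Im Sm])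
             (use that in \<open>auto intro!: finite_exponent_bounds(5)[OF q0 _ n P k kr A(2), simplified]\<close>)
        define \<omega> where "\<omega> = ennreal (1 / t ^ k) * omega_mod k r ?g t \<alpha> \<beta> p"
        define \<Psi> where "\<Psi> = ennreal (1 / t ^ k) * Psi_mod k r ?g t \<alpha> \<beta> p"
        define \<Omega> where "\<Omega> = ennreal (1 / t ^ k) * Omega_mod k r ?g A t \<alpha> \<beta> p"
        have b1: "\<Psi> \<le> ennreal c1 * ?N"
          unfolding \<Psi>_def Psi_mod_def using c1 by (intro ennreal_rescale tk SUP_least Psi_h) auto
        have b2: "\<omega> \<le> ennreal (c2 E) * ?N"
          unfolding \<omega>_def omega_mod_def using c2[OF E0] by (intro ennreal_rescale tk SUP_least omega_h) auto
        have b3: "?N \<le> ennreal d * \<Omega>"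
          unfolding \<Omega>_def
        proof (rule ennreal_rescale'[OF tk])
          have "Lp_norm p (main_interval A h0) (Omega_fun \<alpha> \<beta> k r P A h0) \<le> Omega_mod k r ?g A t \<alpha> \<beta> p"
            unfolding Omega_mod_def by (rule SUP_upper[OF h0(2)])
          then show "?N \<le> ennreal (d / t ^ k) * Omega_mod k r ?g A t \<alpha> \<beta> p"
            using N_Omega by (meson mult_left_mono order_trans zero_le)
        qed (use d in auto)
        have b4: "?N \<le> ennreal d * \<omega>"
          unfolding \<omega>_def
        proof (rule ennreal_rescale'[OF tk])
          have "Lp_norm p {-1..1} (omega_fun \<alpha> \<beta> k r P h0) \<le> omega_mod k r ?g t \<alpha> \<beta> p"
            unfolding omega_mod_def by (rule SUP_upper[OF h0(2)])
          then show "?N \<le> ennreal (d / t ^ k) * omega_mod k r ?g t \<alpha> \<beta> p"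
            using N_omega by (meson mult_left_mono order_trans zero_le)
        qed (use d in auto)
        have b5: "\<Omega> \<le> \<Psi>"
          unfolding \<Omega>_def \<Psi>_def Omega_mod_def Psi_mod_def
        proof (intro mult_left_mono SUP_mono zero_le)
          fix h assume "h \<in> {0..t}"
          then show "\<exists>h'\<in>{0..t}. Lp_norm p (main_interval A h) (Omega_fun \<alpha> \<beta> k r P A h)
              \<le> Lp_norm p {-1..1} (Psi_fun \<alpha> \<beta> k r P h')"
            using Omega_h[of h] by (intro bexI[of _ h]) auto
        qed
        then have b5': "\<Omega> \<le> ennreal 1 * \<Psi>" by simp
        have N_Psi: "?N \<le> ennreal d * \<Psi>"
          using b3 mult_left_mono[OF b5, of "ennreal d"] by (meson order_trans zero_le)
        have cpos: "0 < c" using c_ge(1) by linarith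
        have "ennreal (1 / c) * \<Psi> \<le> \<omega>"
          using c1 d c_ge(3) cpos by (intro ennreal_inverse_mult_le ennreal_le_trans_mult[OF b1 b4]) auto
        moreover have "\<omega> \<le> ennreal (if r = 0 \<and> min \<alpha> \<beta> < 0 then C p else c) * \<Psi>"
        proof (rule ennreal_le_trans_mult[OF b2 N_Psi])
          show "c2 E * d \<le> (if r = 0 \<and> min \<alpha> \<beta> < 0 then C p else c)"
            using C_ge(2)[of p] c_ge(4) by (simp add: E_def)
        qed (use c2[OF E0] d in auto)
        moreover have "equiv_within c \<Psi> \<Omega>"
          unfolding equiv_within_def
        proof
          show "ennreal (1 / c) * \<Omega> \<le> \<Psi>"
            using c_ge(1) cpos by (intro ennreal_inverse_mult_le ennreal_le_trans_mult[OF b5', of 1]) auto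
          show "\<Psi> \<le> ennreal c * \<Omega>"
            using c1 d c_ge(3) by (intro ennreal_le_trans_mult[OF b1 b3]) auto
        qed
        moreover have "equiv_within c \<Omega> ?N"
          unfolding equiv_within_def
        proof
          show "ennreal (1 / c) * ?N \<le> \<Omega>"
            using d c_ge(5) cpos by (intro ennreal_inverse_mult_le ennreal_le_trans_mult[OF b3, of 1 \<Omega>]) auto
          show "\<Omega> \<le> ennreal c * ?N"
            using c1 c_ge(2) by (intro ennreal_le_trans_mult[OF b5' b1]) auto
        qed
        ultimately show "?equiv m A c C p n P k r t"
          unfolding Let_def \<omega>_def \<Psi>_def \<Omega>_def by blast
      qed
    qed
  qed
qed

end
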